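(* Let $L_1$ be an analytic Jordan curve with interior $G_1$, let $\{p_n\}_{n\ge 0}$ be the polynomials orthonormal over $G_1$ with respect to $\pi^{-1}dx\,dy$, let $\Sigma_1\subset G_1$ be the set defined in the context, and let $\mathcal{Z}$ be the set of points $t\in\overline{\mathbb{C}}$ such that every neighborhood of $t$ contains zeros of infinitely many of the polynomials $p_n$. Then $$\partial\Sigma_1\cap G_1\subset\mathcal{Z}.$$
   Context: $L_1$ is an analytic Jordan curve in $\mathbb{C}$; $G_1$ is the bounded component of $\mathbb{C}\setminus L_1$ and $\Omega_1$ the unbounded component of $\overline{\mathbb{C}}\setminus L_1$. For $n\ge0$, $p_n$ is the polynomial of degree $n$ with positive leading coefficient such that $\frac1\pi\int_{G_1}p_n\overline{p_m}\,dx\,dy=\delta_{nm}$ for all $n,m\ge 0$. For $r\ge 0$: $\Delta_r=\{w: r<|w|\le\infty\}$, $\mathbb{D}_r=\{w:|w|<r\}$. $\psi$ is the conformal map of $\Delta_1$ onto $\Omega_1$ with $\psi(\infty)=\infty$, $\psi'(\infty)>0$. $\rho\in[0,1)$ is the smallest number such that $\psi$ has an analytic and univalent continuation to $\rho<|w|<\infty$ (still denoted $\psi$). For $\rho\le r<\infty$: $\Omega_r=\psi(\Delta_r)$, $G_r=\mathbb{C}\setminus\overline{\Omega_r}$. (Convention: $1/0=\infty$, $G_\infty=\mathbb{C}$.) $\varphi$ is a conformal map of $G_1$ onto the unit disk $\mathbb{D}_1$; it has a one-to-one meromorphic continuation (still denoted $\varphi$) to $G_{1/\rho}$, so $\varphi(\psi(w))$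 is a one-to-one meromorphic function on $\rho<|w|<1/\rho$, analytic on $\rho<|w|\le1$. $\mu\ge0$ is the smallest number such that $\varphi(\psi(w))$ has a meromorphic continuation, denoted $h_\varphi(w)$, to $\mu<|w|<1/\rho$. $\Sigma$ is the set of $z\in G_1$ for which the equation $h_\varphi(w)=\varphi(z)$ has at least one solution $w$ in $\mu<|w|<1$. A solution $\omega$ is simple if $h_\varphi'(\omega)\neq0$. For $z\in\Sigma$ there are finitely many solutions of largest modulus in $\mu<|w|<1$. $\Sigma_1$ is the set of $z\in\Sigma$ for which there is exactly one solution of largest modulus and it is simple. $\Sigma_1$ is independent of the choice of $\varphi$. $\partial\Sigma_1$ denotes the boundary of $\Sigma_1$ in $\overline{\mathbb{C}}$. *)

theory Defs
  imports "HOL-Complex_Analysis.Complex_Analysis"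
begin

section \<open>The Riemann sphere\<close>

abbreviation riemann_sphere :: "complex option topology" where
  "riemann_sphere \<equiv> Alexandroff_compactification euclidean"

text \<open>
  Poles are sent to \<^const>\<open>None\<close>. For nicely meromorphic functions, which are continuous off
  their poles and carry the dummy value 0 at them, this is the associated map into the sphere.
\<close>
definition sphere_val :: "(complex \<Rightarrow> complex) \<Rightarrow> complex \<Rightarrow> complex option" where
  "sphere_val f z = (if is_pole f z then None else Some (f z))"


section \<open>Curves and conformal maps\<close>

definition analytic_jordan_curve :: "complex set \<Rightarrow> bool" where
  "analytic_jordan_curve L \<longleftrightarrow>
     (\<exists>U f. open U \<and> sphere 0 1 \<subseteq> U \<and> f holomorphic_on U \<and> inj_on f U \<and> L = f ` sphere 0 1)"

definition conformal_map :: "(complex \<Rightarrow> complex) \<Rightarrow> complex set \<Rightarrow> complex set \<Rightarrow> bool" where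
  "conformal_map f S T \<longleftrightarrow> f holomorphic_on S \<and> bij_betw f S T"

text \<open>
  Extended real radii make the conventions \<open>1/0 = \<infinity>\<close> and \<open>G\<^sub>\<infinity> = \<complex>\<close> hold definitionally:
  \<open>1 / (0::ereal) = \<infinity>\<close>, and no complex number has modulus exceeding \<open>\<infinity>\<close>.
\<close>
definition annulus :: "ereal \<Rightarrow> ereal \<Rightarrow> complex set" where
  "annulus a b = {w. a < ereal (norm w) \<and> ereal (norm w) < b}"

definition G_region :: "(complex \<Rightarrow> complex) \<Rightarrow> ereal \<Rightarrow> complex set" where
  "G_region \<psi> r = - closure (\<psi> ` {w. r < ereal (norm w)})"

text \<open>
  The normalised conformal map from the exterior of the unit disk onto the exterior of \<open>L\<close>, on its
  finite part; the last two conjuncts say \<open>\<psi>(\<infinity>) = \<infinity>\<close> and \<open>\<psi>'(\<infinity>) > 0\<close>.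
\<close>
definition exterior_map :: "complex set \<Rightarrow> (complex \<Rightarrow> complex) \<Rightarrow> bool" where
  "exterior_map L \<psi> \<longleftrightarrow>
     conformal_map \<psi> {w. 1 < norm w} (outside L) \<and>
     filterlim \<psi> at_infinity at_infinity \<and>
     (\<exists>c::real. c > 0 \<and> ((\<lambda>w. \<psi> w / w) \<longlongrightarrow> complex_of_real c) at_infinity)"

definition univalent_continuation ::
    "(complex \<Rightarrow> complex) \<Rightarrow> real \<Rightarrow> (complex \<Rightarrow> complex) \<Rightarrow> bool" where
  "univalent_continuation \<psi> r g \<longleftrightarrow>
     g holomorphic_on {w. r < norm w} \<and> inj_on g {w. r < norm w} \<and>
     (\<forall>w. 1 < norm w \<longrightarrow> g w = \<psi> w)"

text \<open>As \<open>\<psi>\<close> also denotes its own continuation, it is required to continue itself.\<close>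
definition is_rho :: "(complex \<Rightarrow> complex) \<Rightarrow> real \<Rightarrow> bool" where
  "is_rho \<psi> \<rho> \<longleftrightarrow>
     0 \<le> \<rho> \<and> \<rho> < 1 \<and> univalent_continuation \<psi> \<rho> \<psi> \<and>
     (\<forall>r. 0 \<le> r \<and> r < \<rho> \<longrightarrow> (\<nexists>g. univalent_continuation \<psi> r g))"

text \<open>
  A conformal map of the interior of \<open>L\<close> onto the unit disk, together with its one-to-one
  meromorphic continuation to \<open>G\<^bsub>1/\<rho>\<^esub>\<close>; both are denoted \<open>\<phi>\<close>.
\<close>
definition interior_map ::
    "complex set \<Rightarrow> (complex \<Rightarrow> complex) \<Rightarrow> real \<Rightarrow> (complex \<Rightarrow> complex) \<Rightarrow> bool" where
  "interior_map L \<psi> \<rho> \<phi> \<longleftrightarrow>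
     conformal_map \<phi> (inside L) (ball 0 1) \<and>
     \<phi> nicely_meromorphic_on G_region \<psi> (1 / ereal \<rho>) \<and>
     inj_on (sphere_val \<phi>) (G_region \<psi> (1 / ereal \<rho>))"

text \<open>
  Both sides of the equation below take the dummy value 0 at common poles, so it can be imposed on
  the whole annulus.
\<close>
definition meromorphic_continuation ::
    "(complex \<Rightarrow> complex) \<Rightarrow> (complex \<Rightarrow> complex) \<Rightarrow> real \<Rightarrow> real \<Rightarrow> (complex \<Rightarrow> complex) \<Rightarrow> bool" where
  "meromorphic_continuation \<psi> \<phi> \<rho> m g \<longleftrightarrow>
     g nicely_meromorphic_on annulus (ereal m) (1 / ereal \<rho>) \<and>
     (\<forall>w \<in> annulus (ereal \<rho>) (1 / ereal \<rho>). g w = \<phi> (\<psi> w))"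

definition is_mu ::
    "(complex \<Rightarrow> complex) \<Rightarrow> (complex \<Rightarrow> complex) \<Rightarrow> real \<Rightarrow> real \<Rightarrow> (complex \<Rightarrow> complex) \<Rightarrow> bool" where
  "is_mu \<psi> \<phi> \<rho> \<mu> h \<longleftrightarrow>
     0 \<le> \<mu> \<and> meromorphic_continuation \<psi> \<phi> \<rho> \<mu> h \<and>
     (\<forall>m. 0 \<le> m \<and> m < \<mu> \<longrightarrow> (\<nexists>g. meromorphic_continuation \<psi> \<phi> \<rho> m g))"


section \<open>The sets \<open>\<Sigma>\<close> and \<open>\<Sigma>\<^sub>1\<close>\<close>

text \<open>Using \<^const>\<open>sphere_val\<close> keeps the poles of \<open>h\<close> from counting as solutions.\<close>
definition solutions ::
    "(complex \<Rightarrow> complex) \<Rightarrow> (complex \<Rightarrow> complex) \<Rightarrow> real \<Rightarrow> complex \<Rightarrow> complex set" where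
  "solutions \<phi> h \<mu> z = {w \<in> annulus (ereal \<mu>) 1. sphere_val h w = Some (\<phi> z)}"

definition largest_solutions ::
    "(complex \<Rightarrow> complex) \<Rightarrow> (complex \<Rightarrow> complex) \<Rightarrow> real \<Rightarrow> complex \<Rightarrow> complex set" where
  "largest_solutions \<phi> h \<mu> z =
     {\<omega> \<in> solutions \<phi> h \<mu> z. \<forall>w \<in> solutions \<phi> h \<mu> z. norm w \<le> norm \<omega>}"

definition Sigma_set ::
    "complex set \<Rightarrow> (complex \<Rightarrow> complex) \<Rightarrow> (complex \<Rightarrow> complex) \<Rightarrow> real \<Rightarrow> complex set" where
  "Sigma_set L \<phi> h \<mu> = {z \<in> inside L. solutions \<phi> h \<mu> z \<noteq> {}}"

definition Sigma1_set ::
    "complex set \<Rightarrow> (complex \<Rightarrow> complex) \<Rightarrow> (complex \<Rightarrow> complex) \<Rightarrow> real \<Rightarrow> complex set" where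
  "Sigma1_set L \<phi> h \<mu> =
     {z \<in> Sigma_set L \<phi> h \<mu>. \<exists>\<omega>. largest_solutions \<phi> h \<mu> z = {\<omega>} \<and> deriv h \<omega> \<noteq> 0}"


section \<open>Bergman orthonormal polynomials and the accumulation set of their zeros\<close>

definition bergman_orthonormal :: "complex set \<Rightarrow> (nat \<Rightarrow> complex poly) \<Rightarrow> bool" where
  "bergman_orthonormal G p \<longleftrightarrow>
     (\<forall>n. degree (p n) = n \<and> lead_coeff (p n) \<in> \<real> \<and> Re (lead_coeff (p n)) > 0) \<and>
     (\<forall>n m. complex_of_real (1 / pi) *
              set_lebesgue_integral lborel G (\<lambda>z. poly (p n) z * cnj (poly (p m) z))
            = (if n = m then 1 else 0))"

definition zero_accumulation :: "(nat \<Rightarrow> complex poly) \<Rightarrow> complex option set" where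
  "zero_accumulation p =
     {t. \<forall>U. openin riemann_sphere U \<and> t \<in> U \<longrightarrow>
           infinite {n. \<exists>z. poly (p n) z = 0 \<and> Some z \<in> U}}"

end

theory Submission
  imports Defs
begin

text \<open>Cauchy's formula in the coordinate of \<open>\<psi>\<close> and orthogonality give, for \<open>z\<close> inside \<open>L\<close>,
  \<open>p\<^sub>n(z) = \<phi>'(z) / (2 \<pi> \<i>) \<cdot> \<integral> v\<^sup>n Y\<^sub>n(v) / (h(v) - \<phi>(z)) dv\<close> over a circle just inside the unit circle,
  where \<open>Y\<^sub>n - a\<^sub>n\<close> is geometrically small on the disc for constants \<open>a\<^sub>n\<close> bounded below and of at
  most linear growth. Consequently \<open>\<bar>p\<^sub>n(z)\<bar>\<^bsup>1/n\<^esup>\<close> tends to the modulus of the dominant solution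
  when that solution is unique and simple. Conversely, decay \<open>p\<^sub>n(z) = O(\<tau>\<^sup>n)\<close> continues
  \<open>1 / (h - \<phi>(z))\<close> holomorphically to \<open>\<tau> < \<bar>v\<bar>\<close>, which forces \<open>\<mu> \<le> \<tau>\<close> and confines
  all solutions to \<open>\<bar>v\<bar> \<le> \<tau>\<close>.

  If almost all \<open>p\<^sub>n\<close> are zero-free in a disc meeting \<open>\<Sigma>\<^sub>1\<close>, the branches \<open>p\<^sub>n\<^bsup>1/n\<^esup>\<close> form a
  normal family there, whose limits have the modulus of a nonvanishing \<open>g\<close> with \<open>h(g(z)) = \<phi>(z)\<close>.
  By the decay statement \<open>g\<close> dominates every solution on the whole disc, so the disc lies in
  \<open>\<Sigma>\<^sub>1\<close>. A disc around a boundary point of \<open>\<Sigma>\<^sub>1\<close> is therefore never zero-free in this sense.\<close>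

section \<open>Area integrals over the disc\<close>

text \<open>Orthogonality enters through Green's formula. On the unit circle the conjugate of \<psi>
  equals the Schwarz reflection \<open>Psi v = cnj (\<psi> (1 / cnj v))\<close>, which is
  holomorphic near the closed disc except for a simple pole at 0. Area integrals against conjugate
  powers of z thus become moments against powers of \<open>Psi\<close>; those of order at most n
  vanish, and a Cauchy transform in the variable \<open>Psi\<close> with vanishing moments has a
  zero of high order at 0. This is the origin of the factor v^n. The constants a_n are the leading
  coefficients of p_n(\<psi>) \<psi>' at infinity, and comparing them with Y_n(0) = (n + 1) / a_n
  bounds them on both sides. The obstacle is that root asymptotics are known only where the dominant
  solution is unique and simple. Elsewhere only normality is available, and different subsequences
  might have different limits. Their moduli agree near a point of \<Sigma>_1, so by the maximum
  principle they agree on the whole disc; this upgrades a limit along a subsequence to decay of the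
  full sequence, which the converse statement requires.\<close>

definition complex_of_vec :: "real^2 \<Rightarrow> complex" where
  "complex_of_vec v = Complex (v $ 1) (v $ 2)"

definition vec_of_complex :: "complex \<Rightarrow> real^2" where
  "vec_of_complex z = vector [Re z, Im z]"

lemma vec_of_complex_inverse [simp]: "complex_of_vec (vec_of_complex z) = z"
  by (simp add: complex_of_vec_def vec_of_complex_def complex_eq_iff)

lemma complex_of_vec_inverse [simp]: "vec_of_complex (complex_of_vec v) = v"
  by (simp add: complex_of_vec_def vec_of_complex_def vec_eq_iff forall_2)

lemma linear_complex_of_vec: "linear complex_of_vec"
  by (rule linearI) (auto simp: complex_of_vec_def complex_eq_iff)

lemma linear_vec_of_complex: "linear vec_of_complex"
  by (rule linearI) (auto simp: vec_of_complex_def vec_eq_iff forall_2)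

lemma bounded_linear_complex_of_vec: "bounded_linear complex_of_vec"
  using linear_complex_of_vec by (simp add: linear_conv_bounded_linear)

lemma bounded_linear_vec_of_complex: "bounded_linear vec_of_complex"
  using linear_vec_of_complex by (simp add: linear_conv_bounded_linear)

lemma complex_of_vec_measurable [measurable]: "complex_of_vec \<in> borel_measurable borel"
  by (intro borel_measurable_continuous_onI linear_continuous_on bounded_linear_complex_of_vec)

lemma lborel_complex_eq_distr: "(lborel :: complex measure) = distr lborel borel complex_of_vec"
proof (rule lborel_eqI)
  fix l u :: complex
  assume le: "\<And>b. b \<in> Basis \<Longrightarrow> l \<bullet> b \<le> u \<bullet> b"
  have "complex_of_vec -` box l u = box (vec_of_complex l) (vec_of_complex u)"
    by (auto simp: complex_of_vec_def vec_of_complex_def box_def Basis_complex_def Basis_vec_def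
        inner_axis inner_axis' exhaust_2 forall_2 inner_complex_def UNIV_2)
  then show "emeasure (distr lborel borel complex_of_vec) (box l u) = ennreal (\<Prod>b\<in>Basis. (u - l) \<bullet> b)"
    using le[of 1] le[of \<i>]
    apply (simp add: emeasure_distr emeasure_lborel_box_eq)
    apply (auto simp: Basis_complex_def Basis_vec_def inner_axis inner_axis' vec_of_complex_def forall_2 inner_complex_def UNIV_2 axis_eq_axis prod.insert_if)
    done
qed simp

lemma matrix_complex_mult_det:
  "det (matrix (\<lambda>v. vec_of_complex (c * complex_of_vec v))) = (cmod c)\<^sup>2"
  unfolding cmod_power2 by (simp add: det_2 matrix_def vec_of_complex_def complex_of_vec_def axis_def power2_eq_square)

text \<open>The bridge to \<open>has_absolute_integral_change_of_variables\<close>, which speaks of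
  gauge integrals of vector-valued functions on \<open>real^2\<close>: both the argument and the
  value have to be transported. Continuity on an open set supplies the measurability by which the
  integrals for \<open>lborel\<close> and its completion agree.\<close>

lemma set_integral_lborel_complex:
  fixes g :: "complex \<Rightarrow> complex"
  assumes A: "open A" and g: "continuous_on A g"
  shows "set_integrable lborel A g \<longleftrightarrow>
      (\<lambda>v. vec_of_complex (g (complex_of_vec v))) absolutely_integrable_on (complex_of_vec -` A)" (is ?thesis1)
    and "set_integrable lborel A g \<Longrightarrow> set_lebesgue_integral lborel A g =
      complex_of_vec (integral (complex_of_vec -` A) (\<lambda>v. vec_of_complex (g (complex_of_vec v))))"
proof -
  define B where "B = complex_of_vec -` A"
  define k where "k = (\<lambda>v. g (complex_of_vec v))"
  have [measurable]: "(\<lambda>z. indicator A z *\<^sub>R g z) \<in> borel_measurable borel"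
    using borel_measurable_continuous_on_indicator[OF _ g] A by simp
  have kk: "(\<lambda>v. indicator B v *\<^sub>R k v) = (\<lambda>v. indicator A (complex_of_vec v) *\<^sub>R g (complex_of_vec v))"
    by (auto simp: B_def k_def indicator_def)
  have meas: "(\<lambda>v. indicator B v *\<^sub>R k v) \<in> borel_measurable lborel"
    unfolding kk by measurable
  have 1: "set_integrable lborel A g \<longleftrightarrow> integrable lborel (\<lambda>v. indicator B v *\<^sub>R k v)"
    unfolding set_integrable_def by (subst lborel_complex_eq_distr, subst integrable_distr_eq) (auto simp: kk)
  also have "\<dots> \<longleftrightarrow> set_integrable lebesgue B k"
    unfolding set_integrable_def using meas by (simp add: integrable_completion)
  finally have 2: "set_integrable lborel A g \<longleftrightarrow> set_integrable lebesgue B k" .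
  have 3: "set_integrable lebesgue B (\<lambda>v. vec_of_complex (k v))" if "set_integrable lebesgue B k"
    using absolutely_integrable_linear[OF that bounded_linear_vec_of_complex] by (simp add: o_def)
  have 4: "set_integrable lebesgue B k" if "set_integrable lebesgue B (\<lambda>v. vec_of_complex (k v))"
    using absolutely_integrable_linear[OF that bounded_linear_complex_of_vec] by (simp add: o_def)
  show ?thesis1
    using 2 3 4 unfolding B_def k_def by blast
  assume l: "set_integrable lborel A g"
  have "set_lebesgue_integral lborel A g = (\<integral>v. indicator B v *\<^sub>R k v \<partial>lborel)"
    unfolding set_lebesgue_integral_def by (subst lborel_complex_eq_distr, subst integral_distr) (auto simp: kk)
  also have "\<dots> = (LINT v:B|lebesgue. k v)"
    unfolding set_lebesgue_integral_def using meas by (simp add: integral_completion)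
  also have "\<dots> = integral B k"
    using 2 l by (intro set_lebesgue_integral_eq_integral) auto
  also have "k = complex_of_vec \<circ> (\<lambda>v. vec_of_complex (k v))"
    by auto
  also have "integral B \<dots> = complex_of_vec (integral B (\<lambda>v. vec_of_complex (k v)))"
    by (intro integral_linear bounded_linear_complex_of_vec)
      (use 2 3 l in \<open>auto intro: set_lebesgue_integral_eq_integral\<close>)
  finally show "set_lebesgue_integral lborel A g =
      complex_of_vec (integral (complex_of_vec -` A) (\<lambda>v. vec_of_complex (g (complex_of_vec v))))"
    unfolding B_def k_def .
qed

text \<open>To first order a holomorphic map is multiplication by its derivative, and as a real
  linear map this has determinant |f'|^2 (\<open>matrix_complex_mult_det\<close>). Integrability is
  assumed on the source and transferred to the image.\<close>

theorem integral_change_of_variables_holomorphic: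
  fixes f g :: "complex \<Rightarrow> complex"
  assumes S: "open S" and f: "f holomorphic_on S" "inj_on f S" and g: "continuous_on (f ` S) g"
    and int: "set_integrable lborel S (\<lambda>z. complex_of_real ((cmod (deriv f z))\<^sup>2) * g (f z))"
  shows "set_integrable lborel (f ` S) g"
    and "set_lebesgue_integral lborel (f ` S) g =
         set_lebesgue_integral lborel S (\<lambda>z. complex_of_real ((cmod (deriv f z))\<^sup>2) * g (f z))"
proof -
  define F where "F = (\<lambda>v. vec_of_complex (f (complex_of_vec v)))"
  define G where "G = (\<lambda>v. vec_of_complex (g (complex_of_vec v)))"
  define V where "V = complex_of_vec -` S"
  define D where "D = (\<lambda>v w. vec_of_complex (deriv f (complex_of_vec v) * complex_of_vec w))"
  have fS: "open (f ` S)"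
    using open_mapping_thm3 S f by blast
  have "open V"
    unfolding V_def using S
    by (intro open_vimage linear_continuous_on bounded_linear_complex_of_vec)
  have FV: "F ` V = complex_of_vec -` (f ` S)"
    unfolding F_def V_def by (auto intro!: image_eqI[of _ _ "vec_of_complex _"]) (metis complex_of_vec_inverse)
  have der: "(F has_derivative D v) (at v within V)" if "v \<in> V" for v
  proof -
    have "(f has_field_derivative deriv f (complex_of_vec v)) (at (complex_of_vec v))"
      using that f S holomorphic_derivI unfolding V_def by blast
    then have "(f has_derivative (\<lambda>w. deriv f (complex_of_vec v) * w)) (at (complex_of_vec v))"
      by (simp add: has_field_derivative_def)
    from has_derivative_compose[OF bounded_linear_imp_has_derivative[OF bounded_linear_complex_of_vec] this]
    have "((\<lambda>v. f (complex_of_vec v)) has_derivative (\<lambda>w. deriv f (complex_of_vec v) * complex_of_vec w)) (at v)"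
      by simp
    from bounded_linear.has_derivative[OF bounded_linear_vec_of_complex this]
    show ?thesis unfolding F_def D_def by (rule has_derivative_at_withinI)
  qed
  have inj: "inj_on F V"
    using f(2) unfolding F_def V_def inj_on_def by (metis vec_of_complex_inverse vimage_eq complex_of_vec_inverse)
  have V: "V \<in> sets lebesgue"
    using \<open>open V\<close> by (simp add: borel_open sets_completionI_sets)
  have eq: "\<bar>det (matrix (D v))\<bar> *\<^sub>R G (F v)
     = vec_of_complex (complex_of_real ((cmod (deriv f (complex_of_vec v)))\<^sup>2) * g (f (complex_of_vec v)))" for v
    unfolding D_def matrix_complex_mult_det G_def F_def
    by (metis linear_cmul[OF linear_vec_of_complex] scaleR_conv_of_real vec_of_complex_inverse abs_power2)
  have cont: "continuous_on S (\<lambda>z. complex_of_real ((cmod (deriv f z))\<^sup>2) * g (f z))"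
    using f g S by (intro continuous_intros holomorphic_on_imp_continuous_on holomorphic_deriv
       continuous_on_compose2[OF g]) auto
  note 1 = set_integral_lborel_complex[OF S cont, folded V_def, folded eq]
  note 2 = set_integral_lborel_complex[OF fS g, folded FV G_def]
  note 3 = has_absolute_integral_change_of_variables[OF V der inj, of G]
  show *: "set_integrable lborel (f ` S) g"
    using 1(1) 2(1) 3 int by blast
  show "set_lebesgue_integral lborel (f ` S) g =
         set_lebesgue_integral lborel S (\<lambda>z. complex_of_real ((cmod (deriv f z))\<^sup>2) * g (f z))"
  proof -
    have "integral (F ` V) G = integral V (\<lambda>v. \<bar>det (matrix (D v))\<bar> *\<^sub>R G (F v))"
      using 1(1) 3 int by blast
    then show ?thesis
      unfolding 1(2)[OF int] 2(2)[OF *] by simp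
  qed
qed

lemma set_integrable_lborel_compact_superset:
  fixes g :: "complex \<Rightarrow> 'a::{banach, second_countable_topology}"
  assumes "compact K" "continuous_on K g" "A \<subseteq> K" "A \<in> sets borel"
  shows "set_integrable lborel A g"
  by (rule set_integrable_subset[of _ K])
    (use assms borel_integrable_compact[of K g] in \<open>auto simp: set_integrable_def\<close>)

section \<open>Orthogonality of monomials on the disc\<close>

abbreviation disc_integral where
  "disc_integral \<equiv> set_lebesgue_integral lborel (ball (0::complex) 1)"

text \<open>Multiplication by c serves two ends: a dilation makes the diagonal integrals homogeneous
  in the radius, and a rotation forces the off-diagonal ones to vanish.\<close>

lemma integral_ball_0_monom_scale:
  fixes c :: complex
  assumes "c \<noteq> 0"
  shows "set_lebesgue_integral lborel (ball 0 (cmod c)) (\<lambda>u. u ^ j * cnj (u ^ k)) =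
    complex_of_real ((cmod c)\<^sup>2) * (c ^ j * cnj (c ^ k)) *
      disc_integral (\<lambda>u. u ^ j * cnj (u ^ k))"
proof -
  have img: "(\<lambda>z. c * z) ` ball 0 1 = ball 0 (cmod c)"
  proof (intro equalityI subsetI)
    fix y :: complex assume "y \<in> ball 0 (cmod c)"
    then show "y \<in> (\<lambda>z. c * z) ` ball 0 1"
      using assms by (intro image_eqI[of _ _ "y / c"]) (auto simp: norm_divide)
  qed (use assms in \<open>auto simp: norm_mult\<close>)
  have "set_lebesgue_integral lborel ((\<lambda>z. c * z) ` ball 0 1) (\<lambda>u. u ^ j * cnj (u ^ k)) =
    disc_integral
      (\<lambda>z. complex_of_real ((cmod (deriv (\<lambda>z. c * z) z))\<^sup>2) * ((c * z) ^ j * cnj ((c * z) ^ k)))"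
    by (rule integral_change_of_variables_holomorphic)
      (use assms in \<open>auto intro!: holomorphic_intros continuous_intros inj_onI
         set_integrable_lborel_compact_superset[of "cball 0 1"]\<close>)
  also have "\<dots> = disc_integral
      (\<lambda>z. (complex_of_real ((cmod c)\<^sup>2) * (c ^ j * cnj (c ^ k))) * (z ^ j * cnj (z ^ k)))"
    by (intro set_lebesgue_integral_cong) (auto simp: power_mult_distrib)
  finally show ?thesis
    unfolding img by simp
qed

lemma complex_norm_square_pow: "complex_of_real (cmod u) ^ (2 * j) = u ^ j * cnj u ^ j"
  by (metis complex_norm_square of_real_power power_mult power_mult_distrib)

text \<open>Polar coordinates are replaced by a squeeze. By homogeneity the disc of radius sqrt q
  contributes q^(j+1) M, so the ring around it contributes M (1 - q^(j+1)). That ring has area pi (1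
  - q), and the integrand lies between q^j and 1 on it. Dividing by 1 - q and letting q tend to 1
  yields M (j + 1) = pi.\<close>

lemma integral_disc_monom_diag:
  "disc_integral (\<lambda>u::complex. (cmod u) ^ (2 * j)) = pi / (j + 1)"
proof -
  let ?I = "\<lambda>r. set_lebesgue_integral lborel (ball 0 r) (\<lambda>u::complex. (cmod u) ^ (2 * j))"
  define M where "M = ?I 1"
  have int: "set_integrable lborel A (\<lambda>u::complex. (cmod u) ^ (2 * j))" if "A \<subseteq> cball 0 1" "A \<in> sets borel" for A
    using that by (intro set_integrable_lborel_compact_superset[of "cball 0 1"]) (auto intro!: continuous_intros)
  have scale: "?I r = r ^ (2 * j + 2) * M" if "0 < r" for r
  proof -
    have mono: "complex_of_real (?I s) = set_lebesgue_integral lborel (ball 0 s) (\<lambda>u::complex. u ^ j * cnj (u ^ j))" for s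
      unfolding set_integral_complex_of_real [symmetric]
      by (intro set_lebesgue_integral_cong)
        (simp_all add: complex_norm_square_pow)
    have "complex_of_real (?I r) = complex_of_real (r ^ (2 * j + 2) * M)"
      using integral_ball_0_monom_scale[of "of_real r" j j] that unfolding of_real_mult mono M_def
      by (simp add: power_mult_distrib mult_2 power_add power2_eq_square)
    then show ?thesis by (simp only: of_real_eq_iff)
  qed
  have area: "measure lborel (ball (0::complex) r) = pi * r\<^sup>2" if "0 \<le> r" for r
    using that content_ball[of r "0::complex"] by (simp add: unit_ball_vol_2)
  have bounds: "q ^ j * pi \<le> M * (\<Sum>i<Suc j. q ^ i) \<and> M * (\<Sum>i<Suc j. q ^ i) \<le> pi" if q: "0 < q" "q < 1" for q :: real
  proof -
    define r where "r = sqrt q"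
    have r: "0 < r" "r < 1" "r\<^sup>2 = q"
      using q by (auto simp: r_def)
    let ?R = "ball (0::complex) 1 - ball 0 r"
    have R: "measure lborel ?R = pi * (1 - q)"
      using r area[of 1] area[of r] emeasure_lborel_ball_finite[of "0::complex" 1]
      by (subst measure_Diff) (auto simp: algebra_simps)
    have "ball (0::complex) 1 = ball 0 r \<union> ?R"
      using r by auto
    then have "M = set_lebesgue_integral lborel (ball 0 r \<union> ?R) (\<lambda>u::complex. (cmod u) ^ (2 * j))"
      unfolding M_def by simp
    also have "\<dots> = ?I r + set_lebesgue_integral lborel ?R (\<lambda>u::complex. (cmod u) ^ (2 * j))"
      using r by (intro set_integral_Un int) auto
    finally have eq: "set_lebesgue_integral lborel ?R (\<lambda>u::complex. (cmod u) ^ (2 * j)) = M * (1 - q ^ Suc j)"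
      using scale[OF r(1)] r(3) by (simp add: algebra_simps power_mult power2_eq_square power_mult_distrib flip: r(3))
    have geo: "M * (1 - q ^ Suc j) = (1 - q) * (M * (\<Sum>i<Suc j. q ^ i))"
      using one_diff_power_eq[of q "Suc j"] by (simp add: ac_simps)
    have const: "set_lebesgue_integral lborel ?R (\<lambda>_. c) = pi * (1 - q) * c" "set_integrable lborel ?R (\<lambda>_. c)" for c :: real
      using R by (auto simp: set_lebesgue_integral_def intro!: set_integrable_lborel_compact_superset[of "cball 0 1"])
    have "set_lebesgue_integral lborel ?R (\<lambda>_. q ^ j) \<le> M * (1 - q ^ Suc j)"
      unfolding eq [symmetric] using r
      by (intro set_integral_mono const int) (auto simp: power_mult intro!: power_mono simp flip: r(3))
    moreover have "M * (1 - q ^ Suc j) \<le> set_lebesgue_integral lborel ?R (\<lambda>_. 1)"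
      unfolding eq [symmetric] using r
      by (intro set_integral_mono const int) (auto intro!: power_le_one)
    ultimately have "(1 - q) * (q ^ j * pi) \<le> (1 - q) * (M * (\<Sum>i<Suc j. q ^ i))"
        "(1 - q) * (M * (\<Sum>i<Suc j. q ^ i)) \<le> (1 - q) * pi"
      unfolding geo const by (auto simp: algebra_simps)
    then show ?thesis using q by auto
  qed
  have lim: "((\<lambda>q. M * (\<Sum>i<Suc j. q ^ i)) \<longlongrightarrow> M * (\<Sum>i<Suc j. 1 ^ i)) (at_left 1)"
    by (intro tendsto_intros)
  have ev: "eventually (\<lambda>q::real. 0 < q \<and> q < 1) (at_left 1)"
    by (auto intro!: eventually_at_leftI[of 0])
  have "((\<lambda>q. M * (\<Sum>i<Suc j. q ^ i)) \<longlongrightarrow> 1 ^ j * pi) (at_left 1)"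
  proof (rule tendsto_sandwich[of "\<lambda>q. q ^ j * pi" _ _ "\<lambda>_. pi"])
    show "((\<lambda>q. q ^ j * pi) \<longlongrightarrow> 1 ^ j * pi) (at_left 1)"
      by (intro tendsto_intros)
  qed (use bounds ev in \<open>auto elim: eventually_mono\<close>)
  with lim have "M * (j + 1) = pi"
    using tendsto_unique[OF _ lim] by (fastforce simp: trivial_limit_at_left_real)
  then show ?thesis
    unfolding M_def by (simp add: field_simps)
qed

lemma integral_disc_monom:
  "disc_integral (\<lambda>u::complex. u ^ j * cnj (u ^ k)) =
     (if j = k then of_real (pi / (j + 1)) else 0)"
proof (cases "j = k")
  case True
  have "disc_integral (\<lambda>u::complex. u ^ j * cnj (u ^ j))
      = complex_of_real (disc_integral (\<lambda>u::complex. (cmod u) ^ (2 * j)))"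
    unfolding set_integral_complex_of_real [symmetric]
    by (intro set_lebesgue_integral_cong)
      (simp_all add: complex_norm_square_pow)
  then show ?thesis
    unfolding integral_disc_monom_diag using True by simp
next
  case False
  \<comment> \<open>The angle of \<open>c\<close> is chosen so that the rotation multiplies the
    integral by \<open>cis x\<close> with 0 < |x| < 1, a factor different from 1.\<close>
  define x where "x = (real j - real k) / (real j + real k + 1)"
  define c where "c = cis (1 / (real j + real k + 1))"
  have x: "x \<noteq> 0" "-1 < x" "x < 1"
    using False by (auto simp: x_def field_simps)
  have "c ^ j * cnj (c ^ k) = cis x"
    unfolding c_def x_def complex_cnj_power cis_cnj Complex.DeMoivre cis_mult by (simp add: diff_divide_distrib)
  moreover have "cis x \<noteq> 1"
    using x sin_eq_0_pi[of x] pi_gt3 by (auto simp: complex_eq_iff)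
  moreover have "cmod c = 1" "c \<noteq> 0"
    by (auto simp: c_def)
  ultimately show ?thesis
    using integral_ball_0_monom_scale[of c j k] False by (auto simp: algebra_simps)
qed

section \<open>Circle integrals\<close>

definition circ :: "real \<Rightarrow> (complex \<Rightarrow> complex) \<Rightarrow> complex" where
  "circ r f = contour_integral (circlepath 0 r) f / (2 * of_real pi * \<i>)"

lemma contour_integrable_circlepath:
  assumes "continuous_on (sphere 0 r) f" "0 < r"
  shows "f contour_integrable_on circlepath 0 r"
  using assms by (intro contour_integrable_continuous_circlepath) simp

lemma contour_integral_divide_const: "contour_integral g (\<lambda>w. f w / c) = contour_integral g f / c"
proof (cases "c = 0 \<or> f contour_integrable_on g")
  case True
  then show ?thesis by (auto intro: contour_integral_div)
next
  case False
  then have "\<not> (\<lambda>w. f w / c) contour_integrable_on g"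
    by (auto simp: contour_integrable_div_iff)
  with False show ?thesis
    by (simp add: not_integrable_contour_integral)
qed

lemma circ_cong:
  assumes "\<And>w. cmod w = r \<Longrightarrow> f w = g w" "0 < r"
  shows "circ r f = circ r g"
  unfolding circ_def using assms
  by (intro arg_cong2[where f="(/)"] contour_integral_cong) auto

lemma circ_add:
  assumes "continuous_on (sphere 0 r) f" "continuous_on (sphere 0 r) g" "0 < r"
  shows "circ r (\<lambda>w. f w + g w) = circ r f + circ r g"
  unfolding circ_def using assms
  by (subst contour_integral_add) (auto intro!: contour_integrable_circlepath simp: add_divide_distrib)

lemma circ_diff:
  assumes "continuous_on (sphere 0 r) f" "continuous_on (sphere 0 r) g" "0 < r"
  shows "circ r (\<lambda>w. f w - g w) = circ r f - circ r g"
  unfolding circ_def using assms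
  by (subst contour_integral_diff) (auto intro!: contour_integrable_circlepath simp: diff_divide_distrib)

lemma circ_cmult:
  assumes "continuous_on (sphere 0 r) f" "0 < r"
  shows "circ r (\<lambda>w. c * f w) = c * circ r f"
  unfolding circ_def using assms
  by (subst contour_integral_lmul) (auto intro!: contour_integrable_circlepath)

lemma circ_sum:
  assumes "\<And>i. i \<in> I \<Longrightarrow> continuous_on (sphere 0 r) (f i)" "0 < r" "finite I"
  shows "circ r (\<lambda>w. \<Sum>i\<in>I. f i w) = (\<Sum>i\<in>I. circ r (f i))"
  unfolding circ_def using assms
  by (subst contour_integral_sum) (auto intro!: contour_integrable_circlepath simp: sum_divide_distrib)

lemma circ_bound:
  assumes "continuous_on (sphere 0 r) f" "0 < r" "\<And>w. cmod w = r \<Longrightarrow> cmod (f w) \<le> B"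
  shows "cmod (circ r f) \<le> r * B"
proof -
  have "0 \<le> B"
    using assms(2) assms(3)[of "of_real r"] order_trans[OF norm_ge_zero] by simp
  then have "cmod (contour_integral (circlepath 0 r) f) \<le> B * (2 * pi * r)"
    using assms by (intro has_contour_integral_bound_circlepath[OF has_contour_integral_integral]
       contour_integrable_circlepath) auto
  then show ?thesis
    unfolding circ_def by (simp add: norm_divide norm_mult field_simps)
qed

lemma circ_uniform_limit:
  assumes "\<And>n. continuous_on (sphere 0 r) (f n)" "uniform_limit (sphere 0 r) f g sequentially" "0 < r"
  shows "(\<lambda>n. circ r (f n)) \<longlonglongrightarrow> circ r g"
  unfolding circ_def using assms
  by (intro tendsto_divide contour_integral_uniform_limit_circlepath(2) always_eventually allI
      contour_integrable_circlepath tendsto_const) auto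

lemma circ_shift:
  assumes "open S" "f holomorphic_on S" "\<And>w. r \<le> cmod w \<Longrightarrow> cmod w \<le> R \<Longrightarrow> w \<in> S" "0 < r" "r \<le> R"
  shows "circ r f = circ R f"
proof -
  have "homotopic_loops S (circlepath 0 r) (circlepath 0 R)"
  proof (rule homotopic_loops_linear)
    fix t :: real
    show "closed_segment (circlepath 0 r t) (circlepath 0 R t) \<subseteq> S"
    proof
      fix x assume "x \<in> closed_segment (circlepath 0 r t) (circlepath 0 R t)"
      then obtain u where u: "0 \<le> u" "u \<le> 1" "x = (1 - u) *\<^sub>R circlepath 0 r t + u *\<^sub>R circlepath 0 R t"
        by (auto simp: closed_segment_def)
      then have x: "x = of_real ((1 - u) * r + u * R) * exp (of_real (2 * pi * t) * \<i>)"
        by (simp add: circlepath algebra_simps scaleR_conv_of_real exp_of_real)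
      have "(1 - u) * r + u * R \<ge> (1 - u) * r + u * r" "(1 - u) * r + u * R \<le> (1 - u) * R + u * R"
        using u assms by (intro add_mono mult_left_mono order_refl; simp)+
      then have "r \<le> (1 - u) * r + u * R" "(1 - u) * r + u * R \<le> R"
        by (simp_all add: algebra_simps)
      moreover have "cmod x = (1 - u) * r + u * R"
        unfolding x norm_mult norm_of_real using calculation \<open>0 < r\<close> by simp
      ultimately show "x \<in> S"
        by (intro assms(3)) auto
    qed
  qed auto
  then have "contour_integral (circlepath 0 r) f = contour_integral (circlepath 0 R) f"
    using assms by (intro Cauchy_theorem_homotopic_loops[of S]) auto
  then show ?thesis by (simp add: circ_def)
qed

lemma circ_Cauchy:
  assumes "open S" "f holomorphic_on S" "cball 0 r \<subseteq> S" "cmod v < r"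
  shows "circ r (\<lambda>w. f w / (w - v)) = f v"
proof -
  have "contour_integral (circlepath 0 r) (\<lambda>w. f w / (w - v)) = 2 * of_real pi * \<i> * f v"
    using assms by (intro contour_integral_unique Cauchy_integral_circlepath_simple)
      (auto intro: holomorphic_on_subset)
  then show ?thesis by (simp add: circ_def)
qed

lemma circ_holomorphic_0:
  assumes "open S" "f holomorphic_on S" "cball 0 r \<subseteq> S" "0 < r"
  shows "circ r f = 0"
proof -
  have "circ r f = circ r (\<lambda>w. f w * w / (w - 0))"
    using assms by (intro circ_cong) auto
  also have "\<dots> = f 0 * 0"
    using assms by (intro circ_Cauchy[of S]) (auto intro!: holomorphic_intros)
  finally show ?thesis by simp
qed

text \<open>The residue at infinity: the circle can be moved outward freely, and f - a/w is
  o(1/|w|), so its integral over a circle of radius R tends to 0 as R grows.\<close>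

lemma circ_exterior:
  assumes "f holomorphic_on {w. r0 < cmod w}" "((\<lambda>w. w * f w) \<longlongrightarrow> a) at_infinity" "0 \<le> r0" "r0 < r"
  shows "circ r f = a"
proof (rule ccontr)
  assume ne: "circ r f \<noteq> a"
  have cont: "continuous_on (sphere 0 R) f" if "r \<le> R" for R
    by (rule continuous_on_subset[OF holomorphic_on_imp_continuous_on[OF assms(1)]])
      (use that assms in auto)
  define e where "e = cmod (circ r f - a) / 2"
  have "e > 0" using ne by (simp add: e_def)
  then have "\<forall>\<^sub>F w in at_infinity. cmod (w * f w - a) < e"
    using assms(2) by (auto simp: tendsto_iff dist_norm)
  then obtain B where B: "\<And>w. B \<le> cmod w \<Longrightarrow> cmod (w * f w - a) < e"
    by (auto simp: eventually_at_infinity)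
  define R where "R = max B r"
  have R: "0 < R" "r \<le> R" "B \<le> R"
    using assms by (auto simp: R_def)
  have "circ r f = circ R f"
    using assms R
    by (intro circ_shift[of "{w. r0 < cmod w}"]) (auto intro!: open_Collect_less continuous_intros)
  also have "\<dots> = circ R (\<lambda>w. (f w - a / w) + a / (w - 0))"
    using R by (intro circ_cong) auto
  also have "\<dots> = circ R (\<lambda>w. f w - a / w) + circ R (\<lambda>w. a / (w - 0))"
    using R cont[of R] by (intro circ_add continuous_intros) auto
  also have "circ R (\<lambda>w. a / (w - 0)) = a"
    using R by (intro circ_Cauchy[of UNIV]) auto
  finally have eq: "circ r f - a = circ R (\<lambda>w. f w - a / w)"
    by simp
  have "cmod (circ R (\<lambda>w. f w - a / w)) \<le> R * (e / R)"
  proof (rule circ_bound)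
    fix w assume w: "cmod w = R"
    then have "f w - a / w = (w * f w - a) / w"
      using R by (auto simp: field_simps)
    then show "cmod (f w - a / w) \<le> e / R"
      using B[of w] w R by (simp add: norm_divide divide_right_mono)
  qed (use R cont[of R] in \<open>auto intro!: continuous_intros\<close>)
  then show False
    using R \<open>e > 0\<close> unfolding eq[symmetric] by (simp add: e_def)
qed

text \<open>Removing a singularity twice splits f into c / (w - v) and a function M holomorphic
  across v; only the first part distinguishes the two circles. A removable singularity is covered by
  c = 0.\<close>

lemma circ_pole:
  assumes "open S" "f holomorphic_on (S - {v})" "\<And>w. r \<le> cmod w \<Longrightarrow> cmod w \<le> R \<Longrightarrow> w \<in> S"
    and r: "0 < r" "r < cmod v" "cmod v < R" and lim: "((\<lambda>w. (w - v) * f w) \<longlongrightarrow> c) (at v)"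
  shows "circ R f - circ r f = c"
proof -
  define N where "N = (\<lambda>w. if w = v then c else (w - v) * f w)"
  have N: "N holomorphic_on S"
    unfolding N_def
    by (rule removable_singularity[OF holomorphic_on_mult[OF _ assms(2)] assms(1) lim])
      (intro holomorphic_intros)
  define M where "M = (\<lambda>w. if w = v then deriv N v else (N w - N v) / (w - v))"
  have M: "M holomorphic_on S"
    unfolding M_def using N \<open>open S\<close> by (rule pole_lemma_open)
  have *: "circ s f = circ s M + circ s (\<lambda>w. c / (w - v))" if s: "s = r \<or> s = R" for s
  proof -
    have sv: "w \<noteq> v" if "cmod w = s" for w
      using that s r by auto
    have "circ s f = circ s (\<lambda>w. M w + c / (w - v))"
      using s r sv by (intro circ_cong) (auto simp: M_def N_def diff_divide_distrib)
    also have "\<dots> = circ s M + circ s (\<lambda>w. c / (w - v))"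
    proof (rule circ_add)
      show "continuous_on (sphere 0 s) M"
        by (rule continuous_on_subset[OF holomorphic_on_imp_continuous_on[OF M]])
          (use assms(3) s r in auto)
    qed (use s r sv in \<open>auto intro!: continuous_intros\<close>)
    finally show ?thesis .
  qed
  have "circ r M = circ R M"
    using assms by (intro circ_shift[OF \<open>open S\<close> M]) auto
  moreover have "circ R (\<lambda>w. c / (w - v)) = c"
    using r by (intro circ_Cauchy[of UNIV]) auto
  moreover have "circ r (\<lambda>w. c / (w - v)) = 0"
    using r by (intro circ_holomorphic_0[of "ball 0 (cmod v)"]) (auto intro!: holomorphic_intros)
  ultimately show ?thesis
    using *[of r] *[of R] by simp
qed

lemma circ_swap:
  assumes "continuous_on (sphere 0 r \<times> sphere 0 s) (\<lambda>(w, v). f w v)" "0 < r" "0 < s"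
  shows "circ r (\<lambda>w. circ s (f w)) = circ s (\<lambda>v. circ r (\<lambda>w. f w v))"
proof -
  have vd: "continuous_on {0..1} (\<lambda>t. vector_derivative (circlepath 0 x) (at t))" for x
    by (auto simp: vector_derivative_circlepath intro!: continuous_intros)
  have "contour_integral (circlepath 0 r) (\<lambda>w. contour_integral (circlepath 0 s) (f w)) =
    contour_integral (circlepath 0 s) (\<lambda>v. contour_integral (circlepath 0 r) (\<lambda>w. f w v))"
    using assms by (intro contour_integral_swap vd) simp_all
  then show ?thesis
    unfolding circ_def contour_integral_divide_const by simp
qed

text \<open>Both sides change sign because conjugation reverses the orientation of the unit circle.\<close>
lemma circ_1_cnj:
  assumes f: "continuous_on (sphere 0 1) f"
  shows "circ 1 (\<lambda>w. cnj (f w) / w\<^sup>2) = cnj (circ 1 f)"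
proof -
  have "contour_integral (circlepath 0 1) (\<lambda>w. cnj (f w) / w\<^sup>2) = - cnj (contour_integral (circlepath 0 1) f)"
  proof -
    have *: "cnj (f (circlepath 0 1 t)) / (circlepath 0 1 t)\<^sup>2 * vector_derivative (circlepath 0 1) (at t)
       = - cnj (f (circlepath 0 1 t) * vector_derivative (circlepath 0 1) (at t))" for t
    proof -
      define e where "e = exp (2 * of_real pi * \<i> * of_real t)"
      have e: "cnj e = 1 / e" "e \<noteq> 0"
        by (auto simp: e_def exp_cnj field_simps simp flip: exp_add)
      have cp: "circlepath 0 1 t = e"
        by (simp add: circlepath e_def)
      have vd: "vector_derivative (circlepath 0 1) (at t) = 2 * of_real pi * \<i> * e"
        by (simp add: vector_derivative_circlepath e_def)
      show ?thesis
        unfolding cp vd by (simp add: e power2_eq_square)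
    qed
    have "(f has_contour_integral contour_integral (circlepath 0 1) f) (circlepath 0 1)"
      using f by (intro has_contour_integral_integral contour_integrable_circlepath) auto
    then have "((\<lambda>t. f (circlepath 0 1 t) * vector_derivative (circlepath 0 1) (at t)) has_integral
        contour_integral (circlepath 0 1) f) {0..1}"
      by (simp add: has_contour_integral)
    then have "((\<lambda>t. - cnj (f (circlepath 0 1 t) * vector_derivative (circlepath 0 1) (at t))) has_integral
        - cnj (contour_integral (circlepath 0 1) f)) {0..1}"
      by (intro has_integral_neg) (simp only: has_integral_cnj[unfolded o_def])
    then show ?thesis
      by (intro contour_integral_unique) (simp only: has_contour_integral *)
  qed
  then show ?thesis
    by (simp add: circ_def)
qed

lemma has_field_derivative_pole_kernel:
  fixes a b c x :: complex
  assumes "b \<noteq> x"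
  shows "((\<lambda>x. a / (b - x) * c) has_field_derivative a / (b - x)\<^sup>2 * c) (at x within X)"
proof -
  have "((\<lambda>x. a / (b - x) * c) has_field_derivative
      (0 * (b - x) - a * (0 - 1)) / ((b - x) * (b - x)) * c) (at x within X)"
    using assms by (intro DERIV_cmult_right DERIV_divide DERIV_diff DERIV_const DERIV_ident) simp
  then show ?thesis by (simp add: power2_eq_square)
qed

text \<open>Differentiation under the integral sign. The Leibniz rule is applied on balls because it
  asks for a convex domain; analyticity, being local, puts them together.\<close>

lemma circ_transform_holomorphic:
  assumes a: "continuous_on (sphere 0 r) a" and b: "continuous_on (sphere 0 r) b" and r: "0 < r"
  shows "(\<lambda>y. circ r (\<lambda>w. a w / (b w - y))) holomorphic_on - b ` sphere 0 r"
proof -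
  define T where "T = (\<lambda>w. of_real r * exp (2 * of_real pi * \<i> * of_real w) :: complex)"
  define K where "K = (\<lambda>y t. a (T t) / (b (T t) - y) * (2 * of_real pi * \<i> * of_real r * exp (2 * of_real pi * \<i> * of_real t)))"
  have T: "T t \<in> sphere 0 r" for t
    using r by (simp add: T_def norm_mult)
  have contT: "continuous_on A (\<lambda>x. T (g x))" if "continuous_on A g" for A :: "'z::topological_space set" and g
    unfolding T_def using that by (intro continuous_intros)
  have opn: "open (- b ` sphere 0 r)"
    using b by (intro open_Compl compact_imp_closed compact_continuous_image) auto
  have eq: "circ r (\<lambda>w. a w / (b w - y)) = integral (cbox 0 1) (K y) / (2 * of_real pi * \<i>)" for y
    unfolding circ_def contour_integral_integral K_def T_def
    unfolding vector_derivative_circlepath by (simp add: circlepath cbox_interval)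
  have loc: "(\<lambda>y. integral (cbox 0 1) (K y)) holomorphic_on ball y e" if ye: "ball y e \<subseteq> - b ` sphere 0 r" for y e
  proof (rule leibniz_rule_holomorphic)
    let ?K' = "\<lambda>y t. a (T t) / (b (T t) - y)\<^sup>2 * (2 * of_real pi * \<i> * of_real r * exp (2 * of_real pi * \<i> * of_real t))"
    have ne: "b (T t) \<noteq> x" if "x \<in> ball y e" for x t
      using that ye T[of t] by blast
    show "((\<lambda>x. K x t) has_field_derivative ?K' x t) (at x within ball y e)" if "x \<in> ball y e" for x t
      unfolding K_def using ne[OF that, of t] by (rule has_field_derivative_pole_kernel)
    show "K x integrable_on cbox 0 1" if "x \<in> ball y e" for x
      unfolding K_def using ne[OF that] T
      by (intro integrable_continuous continuous_intros continuous_on_compose2[OF a contT]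
         continuous_on_compose2[OF b contT]) auto
    show "continuous_on (ball y e \<times> cbox 0 1) (\<lambda>(x, t). ?K' x t)"
      unfolding split_beta using ne T
      by (intro continuous_intros continuous_on_compose2[OF a contT]
         continuous_on_compose2[OF b contT]) auto
  qed auto
  have "(\<lambda>y. integral (cbox 0 1) (K y)) analytic_on - b ` sphere 0 r"
    unfolding analytic_on_def
  proof
    fix y assume "y \<in> - b ` sphere 0 r"
    then obtain e where "e > 0" "ball y e \<subseteq> - b ` sphere 0 r"
      using opn open_contains_ball by blast
    with loc[OF this(2)] show "\<exists>e>0. (\<lambda>y. integral (cbox 0 1) (K y)) holomorphic_on ball y e"
      by blast
  qed
  then have hol: "(\<lambda>y. integral (cbox 0 1) (K y)) holomorphic_on - b ` sphere 0 r"
    by (rule analytic_imp_holomorphic)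
  show ?thesis
    unfolding eq by (rule holomorphic_on_divide[OF hol holomorphic_on_const]) simp
qed

section \<open>Taylor coefficients and integrals over the disc\<close>

definition taylor_coeff :: "(complex \<Rightarrow> complex) \<Rightarrow> nat \<Rightarrow> complex" where
  "taylor_coeff F i = (deriv ^^ i) F 0 / fact i"

lemma taylor_coeff_deriv: "taylor_coeff (deriv G) i = of_nat (Suc i) * taylor_coeff G (Suc i)"
  by (simp add: taylor_coeff_def funpow_Suc_right del: funpow.simps of_nat_Suc)

lemma taylor_sums:
  assumes "F holomorphic_on ball 0 R" "cmod u < R"
  shows "(\<lambda>i. taylor_coeff F i * u ^ i) sums F u"
  using holomorphic_power_series[OF assms(1), of u] assms(2) by (simp add: taylor_coeff_def)

lemma taylor_uniform_limit:
  assumes F: "F holomorphic_on ball 0 R" and r: "r < R"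
  shows "uniform_limit (cball 0 r) (\<lambda>n u. \<Sum>i<n. taylor_coeff F i * u ^ i) F sequentially"
proof (cases "r \<ge> 0")
  case True
  define s where "s = (r + R) / 2"
  have s: "r < s" "s < R" "0 \<le> s"
    using r True by (auto simp: s_def)
  have "summable (\<lambda>i. taylor_coeff F i * of_real s ^ i)"
    using taylor_sums[OF F, of "of_real s"] s by (auto simp: sums_iff)
  then have "ereal s \<le> conv_radius (taylor_coeff F)"
    using conv_radius_geI[of "taylor_coeff F" "of_real s"] s by simp
  moreover have "ereal r < ereal s"
    using s by simp
  ultimately have "ereal r < conv_radius (taylor_coeff F)"
    by (rule less_le_trans[rotated])
  from powser_uniform_limit[OF this, of 0]
  have "uniform_limit (cball 0 r) (\<lambda>n u. \<Sum>i<n. taylor_coeff F i * u ^ i)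
      (\<lambda>u. \<Sum>i. taylor_coeff F i * u ^ i) sequentially" by simp
  then show ?thesis
    by (rule uniform_limit_cong'[THEN iffD1, rotated -1])
      (use taylor_sums[OF F] r in \<open>auto simp: sums_iff\<close>)
qed auto

lemma set_lebesgue_integral_sum:
  fixes f :: "'i \<Rightarrow> 'a \<Rightarrow> 'b::{banach, second_countable_topology}"
  assumes "\<And>i. i \<in> I \<Longrightarrow> set_integrable M A (f i)"
  shows "set_lebesgue_integral M A (\<lambda>x. \<Sum>i\<in>I. f i x) = (\<Sum>i\<in>I. set_lebesgue_integral M A (f i))"
  using assms unfolding set_lebesgue_integral_def set_integrable_def scaleR_sum_right by simp

lemma disc_integral_bound:
  assumes h: "continuous_on (cball 0 1) (h :: complex \<Rightarrow> complex)" and e: "\<And>u. cmod u < 1 \<Longrightarrow> cmod (h u) \<le> e"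
  shows "cmod (disc_integral h) \<le> e * pi"
proof -
  have int: "set_integrable lborel (ball 0 1) h"
    using h by (intro set_integrable_lborel_compact_superset[of "cball 0 1"]) auto
  have "cmod (disc_integral h) \<le> disc_integral (\<lambda>u. cmod (h u))"
    using int by (rule set_integral_norm_bound)
  also have "\<dots> \<le> set_lebesgue_integral lborel (ball (0::complex) 1) (\<lambda>_. e)"
    by (intro set_integral_mono set_integrable_norm int)
      (use e in \<open>auto intro!: set_integrable_lborel_compact_superset[of "cball 0 1"]\<close>)
  also have "\<dots> = e * pi"
    using content_ball[of 1 "0::complex"] by (simp add: set_lebesgue_integral_def unit_ball_vol_2)
  finally show ?thesis .
qed

lemma disc_integral_uniform_limit:
  fixes f :: "nat \<Rightarrow> complex \<Rightarrow> complex"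
  assumes f: "\<And>n. continuous_on (cball 0 1) (f n)" and g: "continuous_on (cball 0 1) g"
    and lim: "uniform_limit (cball 0 1) f g sequentially"
  shows "(\<lambda>n. disc_integral (f n)) \<longlonglongrightarrow> disc_integral g"
proof (rule LIMSEQ_I)
  fix e :: real assume "e > 0"
  then have "e / (2 * pi) > 0" by simp
  then have "\<forall>\<^sub>F n in sequentially. \<forall>u\<in>cball 0 1. dist (f n u) (g u) < e / (2 * pi)"
    using lim by (auto simp: uniform_limit_iff)
  then obtain N where N: "\<And>n u. n \<ge> N \<Longrightarrow> u \<in> cball 0 1 \<Longrightarrow> cmod (f n u - g u) < e / (2 * pi)"
    unfolding eventually_sequentially dist_norm by blast
  have int: "set_integrable lborel (ball 0 1) h" if "continuous_on (cball 0 1) h" for h :: "complex \<Rightarrow> complex"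
    using that by (intro set_integrable_lborel_compact_superset[of "cball 0 1"]) auto
  show "\<exists>no. \<forall>n\<ge>no. cmod (disc_integral (f n) - disc_integral g) < e"
  proof (intro exI allI impI)
    fix n assume n: "n \<ge> N"
    have "disc_integral (f n) - disc_integral g
      = disc_integral (\<lambda>u. f n u - g u)"
      by (intro set_integral_diff(2)[symmetric] int f g)
    also have "cmod \<dots> \<le> e / (2 * pi) * pi"
      by (intro disc_integral_bound continuous_intros f g) (use N[OF n] in \<open>auto intro: less_imp_le\<close>)
    finally show "cmod (disc_integral (f n) - disc_integral g) < e"
      using \<open>e > 0\<close> by simp
  qed
qed

lemma disc_integral_coeff:
  assumes F: "F holomorphic_on ball 0 R" and R: "R > 1"
  shows "disc_integral (\<lambda>u. F u * cnj (u ^ k)) = of_real pi / of_nat (Suc k) * taylor_coeff F k"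
proof -
  have contF: "continuous_on (cball 0 1) F"
    using R by (intro continuous_on_subset[OF holomorphic_on_imp_continuous_on[OF F]]) auto
  let ?S = "\<lambda>n u. \<Sum>i<n. taylor_coeff F i * u ^ i"
  let ?I = "\<lambda>n. disc_integral (\<lambda>u. ?S n u * cnj (u ^ k))"
  have lim: "?I \<longlonglongrightarrow> disc_integral (\<lambda>u. F u * cnj (u ^ k))"
  proof (intro disc_integral_uniform_limit continuous_intros contF)
    have b: "bounded ((\<lambda>u. cnj (u ^ k)) ` cball 0 1)"
      by (intro compact_imp_bounded compact_continuous_image continuous_intros) auto
    have "bounded (F ` cball 0 1)"
      by (intro compact_imp_bounded compact_continuous_image contF) auto
    then show "uniform_limit (cball 0 1) (\<lambda>n u. ?S n u * cnj (u ^ k)) (\<lambda>u. F u * cnj (u ^ k)) sequentially"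
      using b R by (intro uniform_lim_mult taylor_uniform_limit[OF F] uniform_limit_const) auto
  qed
  have ev: "\<forall>\<^sub>F n in sequentially. ?I n = of_real pi / of_nat (Suc k) * taylor_coeff F k"
    using eventually_gt_at_top[of k]
  proof eventually_elim
    case (elim n)
    have "?I n = disc_integral (\<lambda>u. \<Sum>i<n. taylor_coeff F i * (u ^ i * cnj (u ^ k)))"
      by (simp add: sum_distrib_right mult.assoc)
    also have "\<dots> = (\<Sum>i<n. disc_integral (\<lambda>u. taylor_coeff F i * (u ^ i * cnj (u ^ k))))"
      by (intro set_lebesgue_integral_sum set_integrable_lborel_compact_superset[of "cball 0 1"] continuous_intros) auto
    also have "\<dots> = (\<Sum>i<n. if i = k then of_real pi / of_nat (Suc k) * taylor_coeff F k else 0)"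
      by (intro sum.cong refl) (simp add: integral_disc_monom add_ac del: complex_cnj_power)
    finally show ?case using elim by simp
  qed
  show ?thesis
    by (rule LIMSEQ_unique[OF lim tendsto_eventually[OF ev]])
qed

text \<open>The weight pi / (i + 1) of the ith monomial cancels the factor i + 1 that
  differentiation puts on \<open>taylor_coeff G (Suc i)\<close>. The resulting series has no weights
  and is met again on the unit circle in \<open>circ_h_sums\<close>.\<close>

lemma disc_integral_deriv:
  assumes F: "F holomorphic_on ball 0 R" and G: "G holomorphic_on ball 0 R" and R: "R > 1"
  shows "(\<lambda>i. taylor_coeff F i * cnj (taylor_coeff G (Suc i))) sums
     (disc_integral (\<lambda>u. F u * cnj (deriv G u)) / of_real pi)"
proof -
  have G': "deriv G holomorphic_on ball 0 R"
    using G by (intro holomorphic_deriv) auto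
  have cont: "continuous_on (cball 0 1) F" "continuous_on (cball 0 1) (deriv G)"
    using R by (intro continuous_on_subset[OF holomorphic_on_imp_continuous_on[OF F]]
        continuous_on_subset[OF holomorphic_on_imp_continuous_on[OF G']]; force)+
  let ?S = "\<lambda>n u. \<Sum>i<n. taylor_coeff (deriv G) i * u ^ i"
  have "(\<lambda>n. disc_integral (\<lambda>u. F u * cnj (?S n u))) \<longlonglongrightarrow>
      disc_integral (\<lambda>u. F u * cnj (deriv G u))"
  proof (intro disc_integral_uniform_limit continuous_intros cont)
    have "bounded (F ` cball 0 1)" "bounded ((\<lambda>u. cnj (deriv G u)) ` cball 0 1)"
      by (intro compact_imp_bounded compact_continuous_image continuous_intros cont; simp)+
    moreover have "uniform_limit (cball 0 1) (\<lambda>n u. cnj (?S n u)) (\<lambda>u. cnj (deriv G u)) sequentially"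
      using taylor_uniform_limit[OF G' R] unfolding uniform_limit_iff dist_norm
      by (simp only: complex_cnj_diff[symmetric] complex_mod_cnj)
    ultimately show "uniform_limit (cball 0 1) (\<lambda>n u. F u * cnj (?S n u)) (\<lambda>u. F u * cnj (deriv G u)) sequentially"
      by (intro uniform_lim_mult uniform_limit_const) auto
  qed
  moreover have "disc_integral (\<lambda>u. F u * cnj (?S n u))
     = of_real pi * (\<Sum>i<n. taylor_coeff F i * cnj (taylor_coeff G (Suc i)))" for n
  proof -
    have "disc_integral (\<lambda>u. F u * cnj (?S n u))
      = disc_integral (\<lambda>u. \<Sum>i<n. cnj (taylor_coeff (deriv G) i) * (F u * cnj (u ^ i)))"
      by (simp only: cnj_sum complex_cnj_mult sum_distrib_left mult.left_commute)
    also have "\<dots> = (\<Sum>i<n. disc_integral (\<lambda>u. cnj (taylor_coeff (deriv G) i) * (F u * cnj (u ^ i))))"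
      by (intro set_lebesgue_integral_sum set_integrable_lborel_compact_superset[of "cball 0 1"] continuous_intros cont) auto
    also have "\<dots> = (\<Sum>i<n. of_real pi * (taylor_coeff F i * cnj (taylor_coeff G (Suc i))))"
    proof (intro sum.cong refl)
      fix i
      have alg: "cnj (of_nat n * g) * (of_real pi / of_nat n * f) = of_real pi * (f * cnj g)" if "n > 0" for n f g
        using that by (simp add: field_simps)
      show "disc_integral (\<lambda>u. cnj (taylor_coeff (deriv G) i) * (F u * cnj (u ^ i)))
          = of_real pi * (taylor_coeff F i * cnj (taylor_coeff G (Suc i)))"
        unfolding set_integral_mult_right disc_integral_coeff[OF F R] taylor_coeff_deriv
        by (rule alg) simp
    qed
    finally show ?thesis by (simp only: sum_distrib_left)
  qed
  ultimately have "(\<lambda>n. of_real pi * (\<Sum>i<n. taylor_coeff F i * cnj (taylor_coeff G (Suc i)))) \<longlonglongrightarrow>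
      disc_integral (\<lambda>u. F u * cnj (deriv G u))"
    by simp
  from tendsto_divide[OF this tendsto_const[of "of_real pi"]] show ?thesis
    unfolding sums_def by simp
qed

text \<open>The kth coefficient is (k + 1) / pi times an integral of F against a monomial of modulus
  at most 1, and |F| <= (1 + |F|^2) / 2 has integral pi. The coefficients are therefore at most k +
  1, and summing (k + 1) |u|^k gives the bound.\<close>

lemma disc_norm_pointwise_bound:
  assumes F: "F holomorphic_on ball 0 R" and R: "R > 1"
    and norm: "disc_integral (\<lambda>u. F u * cnj (F u)) = of_real pi"
    and u: "cmod u < 1"
  shows "cmod (F u) \<le> 1 / (1 - cmod u)\<^sup>2"
proof -
  have contF: "continuous_on (cball 0 1) F"
    using R by (intro continuous_on_subset[OF holomorphic_on_imp_continuous_on[OF F]]) auto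
  have int: "set_integrable lborel (ball 0 1) h" if "continuous_on (cball 0 1) h" for h :: "complex \<Rightarrow> real"
    using that by (intro set_integrable_lborel_compact_superset[of "cball 0 1"]) auto
  have F2: "disc_integral (\<lambda>u. (cmod (F u))\<^sup>2) = pi"
  proof -
    have "complex_of_real (disc_integral (\<lambda>u. (cmod (F u))\<^sup>2)) = of_real pi"
      unfolding set_integral_complex_of_real [symmetric] norm [symmetric]
      by (simp only: complex_norm_square)
    then show ?thesis by (simp only: of_real_eq_iff)
  qed
  have coeff: "cmod (taylor_coeff F k) \<le> real (Suc k)" for k
  proof -
    have "pi / real (Suc k) * cmod (taylor_coeff F k) = cmod (disc_integral (\<lambda>u. F u * cnj (u ^ k)))"
      unfolding disc_integral_coeff[OF F R] by (simp add: norm_mult norm_divide del: of_nat_Suc)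
    also have "\<dots> \<le> disc_integral (\<lambda>u. cmod (F u * cnj (u ^ k)))"
      by (intro set_integral_norm_bound set_integrable_lborel_compact_superset[of "cball 0 1"] continuous_intros contF) auto
    also have "\<dots> \<le> disc_integral (\<lambda>u. 1 / 2 + (1 / 2) * (cmod (F u))\<^sup>2)"
    proof (intro set_integral_mono int continuous_intros contF)
      fix u :: complex assume "u \<in> ball 0 1"
      then have "cmod (F u * cnj (u ^ k)) \<le> cmod (F u) * 1"
        unfolding norm_mult by (intro mult_left_mono) (auto simp: norm_power intro!: power_le_one)
      also have "\<dots> \<le> 1 / 2 + (1 / 2) * (cmod (F u))\<^sup>2"
        using sum_power2_ge_zero[of "cmod (F u) - 1" 0] by (simp add: power2_eq_square algebra_simps)
      finally show "cmod (F u * cnj (u ^ k)) \<le> 1 / 2 + (1 / 2) * (cmod (F u))\<^sup>2" .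
    qed
    also have "\<dots> = set_lebesgue_integral lborel (ball (0::complex) 1) (\<lambda>u. 1 / 2)
       + disc_integral (\<lambda>u. (1 / 2) * (cmod (F u))\<^sup>2)"
      by (intro set_integral_add int continuous_intros contF)
    also have "\<dots> = pi"
      using content_ball[of 1 "0::complex"]
      by (simp add: F2) (simp add: set_lebesgue_integral_def unit_ball_vol_2)
    finally show ?thesis by (simp add: field_simps del: of_nat_Suc)
  qed
  have "(\<lambda>k. taylor_coeff F k * u ^ k) sums F u"
    using taylor_sums[OF F, of u] u R by simp
  then have eq: "F u = (\<Sum>k. taylor_coeff F k * u ^ k)"
    by (rule sums_unique)
  have *: "(\<lambda>k. real (Suc k) * cmod u ^ k) sums (1 / (1 - cmod u)\<^sup>2)"
    using geometric_deriv_sums[of "cmod u"] u by simp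
  have "cmod (F u) = cmod (\<Sum>k. taylor_coeff F k * u ^ k)"
    by (simp only: eq)
  also have "\<dots> \<le> (\<Sum>k. real (Suc k) * cmod u ^ k)"
  proof (rule norm_suminf_le)
    show "cmod (taylor_coeff F k * u ^ k) \<le> real (Suc k) * cmod u ^ k" for k
      using mult_right_mono[OF coeff[of k], of "cmod u ^ k"] by (simp add: norm_mult norm_power)
    show "summable (\<lambda>k. real (Suc k) * cmod u ^ k)"
      using * by (rule sums_summable)
  qed
  finally show ?thesis unfolding sums_unique[OF *, symmetric] .
qed

section \<open>Geometry of the curve\<close>

lemma open_analytic_points: "open {z. f analytic_on {z}}"
proof (subst open_subopen, safe)
  fix z assume "f analytic_on {z}"
  then obtain s where s: "open s" "z \<in> s" "f holomorphic_on s" by (auto simp: analytic_at)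
  then have "s \<subseteq> {z. f analytic_on {z}}"
    by (auto simp: analytic_at)
  then show "\<exists>T. open T \<and> z \<in> T \<and> T \<subseteq> {z. f analytic_on {z}}"
    using s by blast
qed

locale carleman_setting =
  fixes L :: "complex set" and p :: "nat \<Rightarrow> complex poly"
    and \<psi> \<phi> h :: "complex \<Rightarrow> complex" and \<rho> \<mu> :: real
  assumes curve: "analytic_jordan_curve L"
    and orthonormal: "bergman_orthonormal (inside L) p"
    and exterior: "exterior_map L \<psi>"
    and is_rho: "is_rho \<psi> \<rho>"
    and interior: "interior_map L \<psi> \<rho> \<phi>"
    and is_mu: "is_mu \<psi> \<phi> \<rho> \<mu> h"
begin

definition GR :: "complex set" where "GR = G_region \<psi> (1 / ereal \<rho>)"

text \<open>Dropping the poles of \<phi> from G_{1/\<rho>} leaves an open neighbourhood of L and its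
  interior on which \<phi> is univalent in the ordinary sense.\<close>

definition N :: "complex set" where "N = {z \<in> GR. \<phi> analytic_on {z}}"

text \<open>The coordinates of points of \<open>N\<close>: an open set containing the half-open
  annulus \<rho> < |w| <= 1 (\<open>W_I\<close>), on which h is holomorphic and injective.\<close>

definition W :: "complex set" where "W = {w. \<rho> < cmod w \<and> \<rho> * cmod w < 1 \<and> \<psi> w \<in> N}"

lemma rho_nonneg: "0 \<le> \<rho>" and rho_less_1: "\<rho> < 1"
  and psi_hol: "\<psi> holomorphic_on {w. \<rho> < cmod w}"
  and psi_inj: "inj_on \<psi> {w. \<rho> < cmod w}"
  using is_rho unfolding is_rho_def univalent_continuation_def by blast+

lemma psi_bij: "bij_betw \<psi> {w. 1 < cmod w} (outside L)"
  and psi_at_infinity: "filterlim \<psi> at_infinity at_infinity"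
  using exterior unfolding exterior_map_def conformal_map_def by blast+

text \<open>The product form treats \<rho> = 0 along with the rest: 1/0 is infinite on the left, and
  the product vanishes on the right.\<close>

lemma less_inverse_rho_iff:
  assumes "0 \<le> x"
  shows "ereal x < 1 / ereal \<rho> \<longleftrightarrow> \<rho> * x < 1" "1 / ereal \<rho> < ereal x \<longleftrightarrow> 1 < \<rho> * x"
proof -
  consider "\<rho> = 0" | "\<rho> > 0" using rho_nonneg by linarith
  then show "ereal x < 1 / ereal \<rho> \<longleftrightarrow> \<rho> * x < 1" "1 / ereal \<rho> < ereal x \<longleftrightarrow> 1 < \<rho> * x"
    by (cases; simp add: one_ereal_def field_simps)+
qed

lemma open_region: "open {w::complex. r < cmod w}"
  by (intro open_Collect_less continuous_intros)

lemma psi_open_map: "open X \<Longrightarrow> X \<subseteq> {w. \<rho> < cmod w} \<Longrightarrow> open (\<psi> ` X)"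
  by (rule open_mapping_thm3) (auto intro: holomorphic_on_subset[OF psi_hol] inj_on_subset[OF psi_inj])

lemma curve_topology:
  "compact L" "open (inside L)" "connected (inside L)" "bounded (inside L)" "simply_connected (inside L)"
  "inside L \<noteq> {}" "open (outside L)" "frontier (inside L) = L" "frontier (outside L) = L"
  "inside L \<inter> outside L = {}" "inside L \<union> outside L = - L"
proof -
  obtain U f where U: "open U" "sphere 0 1 \<subseteq> U" "f holomorphic_on U" "inj_on f U" "L = f ` sphere 0 1"
    using curve by (auto simp: analytic_jordan_curve_def)
  have path: "path_image (f \<circ> circlepath 0 1) = L"
    using U(5) by (simp add: path_image_compose)
  have sp: "simple_path (f \<circ> circlepath 0 1)"
    using U by (intro simple_path_continuous_image)
      (auto simp: simple_path_circlepath intro: continuous_on_subset[OF holomorphic_on_imp_continuous_on[OF U(3)]] inj_on_subset)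
  have fin: "pathfinish (f \<circ> circlepath 0 1) = pathstart (f \<circ> circlepath 0 1)"
    by (simp add: pathfinish_compose pathstart_compose)
  note J = Jordan_inside_outside[OF sp fin, unfolded path]
  show "open (inside L)" "connected (inside L)" "bounded (inside L)" "inside L \<noteq> {}"
    "open (outside L)" "frontier (inside L) = L" "frontier (outside L) = L"
    "inside L \<inter> outside L = {}" "inside L \<union> outside L = - L"
    using J by blast+
  show "simply_connected (inside L)"
    using simply_connected_inside_simple_path[OF sp] unfolding path .
  show "compact L"
    unfolding U(5) by (intro compact_continuous_image continuous_on_subset[OF holomorphic_on_imp_continuous_on[OF U(3)]] U(2)) auto
qed

lemma psi_outside: "1 < cmod w \<Longrightarrow> \<psi> w \<in> outside L"
  using psi_bij by (auto simp: bij_betw_def)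

lemma psi_isCont: "\<rho> < cmod w \<Longrightarrow> isCont \<psi> w"
  using psi_hol open_region[of \<rho>] by (metis mem_Collect_eq analytic_at_imp_isCont holomorphic_on_imp_analytic_at)

lemma psi_eq_iff: "\<rho> < cmod v \<Longrightarrow> \<rho> < cmod w \<Longrightarrow> \<psi> v = \<psi> w \<longleftrightarrow> v = w"
  using psi_inj by (auto simp: inj_on_def)

lemma psi_outside_iff: "\<rho> < cmod w \<Longrightarrow> \<psi> w \<in> outside L \<longleftrightarrow> 1 < cmod w"
proof
  assume w: "\<rho> < cmod w" and "\<psi> w \<in> outside L"
  then have "\<psi> w \<in> \<psi> ` {w. 1 < cmod w}"
    using psi_bij by (simp add: bij_betw_def)
  then obtain v where v: "1 < cmod v" "\<psi> w = \<psi> v" by auto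
  then show "1 < cmod w"
    using psi_eq_iff[of v w] w rho_less_1 by auto
qed (rule psi_outside)

text \<open>As \<psi> is continuous and univalent across the circle, the boundaries correspond by
  compactness. A point of L is a limit of values \<psi>(w_n) with |w_n| > 1. The w_n are bounded
  because \<psi> tends to infinity, and a limit point of them cannot lie outside the circle, where
  its value would be in the exterior of L.\<close>

lemma psi_circle: "\<psi> ` sphere 0 1 = L"
proof (intro equalityI subsetI)
  fix z assume "z \<in> \<psi> ` sphere 0 1"
  then obtain w where w: "cmod w = 1" "z = \<psi> w" by auto
  define s where "s = (\<lambda>n. of_real (1 + 1 / real (Suc n)) * w)"
  have "s \<longlonglongrightarrow> of_real (1 + 0) * w"
    unfolding s_def by (intro tendsto_intros LIMSEQ_Suc lim_1_over_n)
  then have sw: "s \<longlonglongrightarrow> w" by simp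
  have "isCont \<psi> w"
    using psi_isCont[of w] w rho_less_1 by simp
  then have lim: "(\<lambda>n. \<psi> (s n)) \<longlonglongrightarrow> z"
    unfolding w(2) by (rule isCont_tendsto_compose[OF _ sw])
  have "\<psi> (s n) \<in> outside L" for n
  proof (rule psi_outside)
    have "cmod (s n) = 1 + 1 / real (Suc n)"
      unfolding s_def norm_mult norm_of_real w(1) by simp
    then show "1 < cmod (s n)" by simp
  qed
  then have "z \<in> closure (outside L)"
    using lim unfolding closure_sequential by (intro exI[of _ "\<lambda>n. \<psi> (s n)"]) auto
  moreover have "z \<notin> outside L"
    using psi_outside_iff[of w] w rho_less_1 by auto
  ultimately show "z \<in> L"
    using curve_topology(7,9) by (auto simp: frontier_def interior_open)
next
  fix z assume "z \<in> L"
  then have "z \<in> closure (outside L)" and zno: "z \<notin> outside L"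
    using curve_topology(7,9) by (auto simp: frontier_def interior_open)
  then obtain s where s: "\<And>n. s n \<in> outside L" "s \<longlonglongrightarrow> z"
    by (auto simp: closure_sequential)
  have "\<exists>w. 1 < cmod w \<and> \<psi> w = s n" for n
  proof -
    have "s n \<in> \<psi> ` {w. 1 < cmod w}"
      using s(1)[of n] psi_bij by (simp add: bij_betw_def)
    then show ?thesis by auto
  qed
  then obtain w where w: "\<And>n. 1 < cmod (w n)" "\<And>n. \<psi> (w n) = s n" by metis
  obtain B where B: "\<And>n. cmod (s n) < B"
    using convergent_imp_bounded[OF s(2)] unfolding bounded_pos_less by auto
  obtain b where b: "\<And>v. b \<le> cmod v \<Longrightarrow> B \<le> cmod (\<psi> v)"
    using psi_at_infinity unfolding filterlim_at_infinity_conv_norm_at_top filterlim_at_top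
    by (auto simp: eventually_at_infinity)
  have "cmod (w n) \<le> b" for n
    using b[of "w n"] B[of n] w(2)[of n] by force
  then have "\<forall>n. w n \<in> cball 0 b" by simp
  then obtain l r where l: "strict_mono (r :: nat \<Rightarrow> nat)" "(w \<circ> r) \<longlonglongrightarrow> l"
    using compact_cball[of 0 b] unfolding compact_def by metis
  have "1 \<le> cmod l"
    by (rule tendsto_lowerbound[OF tendsto_norm[OF l(2)]]) (use w(1) in \<open>auto intro!: always_eventually less_imp_le\<close>)
  then have "isCont \<psi> l"
    using rho_less_1 psi_isCont[of l] by simp
  then have "(\<lambda>n. \<psi> ((w \<circ> r) n)) \<longlonglongrightarrow> \<psi> l"
    by (rule isCont_tendsto_compose[OF _ l(2)])
  moreover have "(\<lambda>n. \<psi> ((w \<circ> r) n)) \<longlonglongrightarrow> z"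
    using LIMSEQ_subseq_LIMSEQ[OF s(2) l(1)] w(2) by (simp add: o_def)
  ultimately have "\<psi> l = z" by (rule LIMSEQ_unique)
  moreover have "\<not> 1 < cmod l"
    using psi_outside zno \<open>\<psi> l = z\<close> by auto
  ultimately show "z \<in> \<psi> ` sphere 0 1"
    using \<open>1 \<le> cmod l\<close> by (intro image_eqI[of _ _ l]) auto
qed

lemma psi_inside_iff: "\<rho> < cmod w \<Longrightarrow> \<psi> w \<in> inside L \<longleftrightarrow> cmod w < 1"
proof -
  assume w: "\<rho> < cmod w"
  have L: "\<psi> w \<in> L \<longleftrightarrow> cmod w = 1"
  proof
    assume "\<psi> w \<in> L"
    then obtain v where "cmod v = 1" "\<psi> w = \<psi> v"
      using psi_circle by auto
    then show "cmod w = 1"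
      using psi_eq_iff[of w v] w rho_less_1 by auto
  qed (use psi_circle in auto)
  have "\<psi> w \<in> inside L \<longleftrightarrow> \<psi> w \<notin> L \<and> \<psi> w \<notin> outside L"
    using curve_topology(10,11) by blast
  then show ?thesis
    using L psi_outside_iff[OF w] by auto
qed

lemma GR_eq: "GR = - closure (\<psi> ` {w. 1 < \<rho> * cmod w})"
  by (simp add: GR_def G_region_def less_inverse_rho_iff)

lemma open_GR: "open GR"
  unfolding GR_eq by (intro open_Compl closed_closure)

lemma rho_mult_gt_1: "1 < \<rho> * cmod w \<Longrightarrow> 1 < cmod w"
  using mult_right_mono[of \<rho> 1 "cmod w"] rho_less_1 by simp

lemma psi_in_GR: "\<rho> < cmod w \<Longrightarrow> \<rho> * cmod w < 1 \<Longrightarrow> \<psi> w \<in> GR"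
proof -
  assume w: "\<rho> < cmod w" "\<rho> * cmod w < 1"
  define X where "X = {w. \<rho> < cmod w} \<inter> {w::complex. \<rho> * cmod w < 1}"
  have "open X"
    unfolding X_def by (intro open_Int open_Collect_less continuous_intros)
  then have "open (\<psi> ` X)"
    by (rule psi_open_map) (auto simp: X_def)
  moreover have "\<psi> ` X \<inter> \<psi> ` {w. 1 < \<rho> * cmod w} = {}"
  proof -
    have "\<psi> a \<noteq> \<psi> b" if "a \<in> X" "1 < \<rho> * cmod b" for a b
      using that psi_eq_iff[of a b] rho_mult_gt_1[of b] rho_less_1 by (auto simp: X_def)
    then show ?thesis by blast
  qed
  ultimately have "\<psi> ` X \<inter> closure (\<psi> ` {w. 1 < \<rho> * cmod w}) = {}"
    using open_Int_closure_eq_empty by blast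
  moreover have "\<psi> w \<in> \<psi> ` X"
    using w by (auto simp: X_def)
  ultimately show ?thesis
    unfolding GR_eq by blast
qed

lemma inside_subset_GR: "inside L \<subseteq> GR"
proof -
  have "\<psi> ` {w. 1 < \<rho> * cmod w} \<subseteq> outside L"
    using psi_outside rho_mult_gt_1 by blast
  then have "inside L \<inter> \<psi> ` {w. 1 < \<rho> * cmod w} = {}"
    using curve_topology(10) by blast
  then have "inside L \<inter> closure (\<psi> ` {w. 1 < \<rho> * cmod w}) = {}"
    using open_Int_closure_eq_empty[OF curve_topology(2)] by blast
  then show ?thesis unfolding GR_eq by blast
qed

lemma curve_subset_GR: "L \<subseteq> GR"
  using psi_in_GR rho_less_1 unfolding psi_circle[symmetric] by auto

section \<open>The interior map and its composition with the exterior map\<close>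

lemma phi_hol_inside: "\<phi> holomorphic_on inside L"
  and phi_bij: "bij_betw \<phi> (inside L) (ball 0 1)"
  and phi_mero: "\<phi> nicely_meromorphic_on GR"
  and phi_sphere_inj: "inj_on (sphere_val \<phi>) GR"
  using interior unfolding interior_map_def conformal_map_def GR_def by blast+

lemma phi_less_1: "z \<in> inside L \<Longrightarrow> cmod (\<phi> z) < 1"
  using phi_bij by (auto simp: bij_betw_def)

lemma phi_no_pole_inside: "z \<in> inside L \<Longrightarrow> \<not> is_pole \<phi> z"
  using phi_hol_inside curve_topology(2) not_is_pole_holomorphic by blast

text \<open>Approaching from the interior, |\<phi>| < 1 excludes a pole and bounds the modulus by 1.
  A value of smaller modulus is already taken inside L, so injectivity forbids it.\<close>

lemma phi_curve:
  assumes "z \<in> L"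
  shows "\<not> is_pole \<phi> z" "cmod (\<phi> z) = 1"
proof -
  have "z \<in> closure (inside L)" "z \<notin> inside L"
    using assms curve_topology(8) by (auto simp: frontier_def interior_open[OF curve_topology(2)])
  then obtain s where s: "\<And>n. s n \<in> inside L" "s \<longlonglongrightarrow> z"
    by (auto simp: closure_sequential)
  have ne: "s n \<noteq> z" for n
    using s(1)[of n] \<open>z \<notin> inside L\<close> by auto
  have s': "filterlim s (at z) sequentially"
    using s(2) ne by (auto simp: filterlim_at intro!: always_eventually)
  show np: "\<not> is_pole \<phi> z"
  proof
    assume "is_pole \<phi> z"
    then have "filterlim (\<lambda>n. \<phi> (s n)) at_infinity sequentially"
      unfolding is_pole_def using s' by (rule filterlim_compose)
    then have "\<forall>\<^sub>F n in sequentially. 1 \<le> cmod (\<phi> (s n))"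
      unfolding filterlim_at_infinity_conv_norm_at_top filterlim_at_top by blast
    then have "\<exists>n. 1 \<le> cmod (\<phi> (s n))"
      using eventually_happens'[OF sequentially_bot] by blast
    then show False
      using phi_less_1[OF s(1)] by (meson not_le)
  qed
  have zGR: "z \<in> GR"
    using assms curve_subset_GR by blast
  have "\<phi> analytic_on {z}"
    using phi_mero zGR np by (rule nicely_meromorphic_on_imp_analytic_at)
  then have lim: "(\<lambda>n. \<phi> (s n)) \<longlonglongrightarrow> \<phi> z"
    by (rule isCont_tendsto_compose[OF analytic_at_imp_isCont s(2)])
  have "cmod (\<phi> z) \<le> 1"
    by (rule tendsto_upperbound[OF tendsto_norm[OF lim]])
      (use phi_less_1[OF s(1)] in \<open>auto intro!: always_eventually less_imp_le\<close>)
  moreover have "\<not> cmod (\<phi> z) < 1"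
  proof
    assume "cmod (\<phi> z) < 1"
    then have "\<phi> z \<in> \<phi> ` inside L"
      using phi_bij by (simp add: bij_betw_def)
    then obtain z' where z': "z' \<in> inside L" "\<phi> z = \<phi> z'" by auto
    then have "sphere_val \<phi> z = sphere_val \<phi> z'"
      using np phi_no_pole_inside by (simp add: sphere_val_def)
    then have "z = z'"
      using phi_sphere_inj zGR z' inside_subset_GR by (auto simp: inj_on_def)
    then show False using z' \<open>z \<notin> inside L\<close> by simp
  qed
  ultimately show "cmod (\<phi> z) = 1" by simp
qed

lemma open_N: "open N"
  using open_Int[OF open_GR open_analytic_points[of \<phi>]] by (simp add: N_def Collect_conj_eq)

lemma phi_hol: "\<phi> holomorphic_on N"
  by (rule analytic_imp_holomorphic) (subst analytic_on_analytic_at, simp add: N_def)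

lemma phi_inj: "inj_on \<phi> N"
proof (rule inj_onI)
  fix x y assume xy: "x \<in> N" "y \<in> N" "\<phi> x = \<phi> y"
  then have "sphere_val \<phi> x = sphere_val \<phi> y"
    using analytic_at_imp_no_pole by (auto simp: N_def sphere_val_def)
  then show "x = y"
    using phi_sphere_inj xy by (auto simp: inj_on_def N_def)
qed

lemma inside_subset_N: "inside L \<subseteq> N"
  using inside_subset_GR phi_mero phi_no_pole_inside
  by (auto simp: N_def intro!: nicely_meromorphic_on_imp_analytic_at)

lemma curve_subset_N: "L \<subseteq> N"
  using curve_subset_GR phi_mero phi_curve(1)
  by (auto simp: N_def intro!: nicely_meromorphic_on_imp_analytic_at)

lemma phi_deriv_nonzero: "z \<in> N \<Longrightarrow> deriv \<phi> z \<noteq> 0"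
  using holomorphic_injective_imp_regular[OF phi_hol open_N phi_inj] .

lemma cball_subset_phi_N: "cball 0 1 \<subseteq> \<phi> ` N"
proof -
  have "compact (inside L \<union> L)"
  proof -
    have "inside L \<union> L = closure (inside L)"
      using curve_topology(2,8) by (simp add: frontier_def interior_open) (use closure_subset in blast)
    then show ?thesis
      using curve_topology(4) by (simp add: compact_eq_bounded_closed bounded_closure)
  qed
  then have "closed (\<phi> ` (inside L \<union> L))"
    using inside_subset_N curve_subset_N
    by (intro compact_imp_closed compact_continuous_image continuous_on_subset[OF holomorphic_on_imp_continuous_on[OF phi_hol]]) auto
  moreover have "ball 0 1 \<subseteq> \<phi> ` (inside L \<union> L)"
    using phi_bij by (auto simp: bij_betw_def)
  ultimately have "closure (ball 0 1) \<subseteq> \<phi> ` (inside L \<union> L)"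
    by (rule closure_minimal[rotated])
  moreover have "\<phi> ` (inside L \<union> L) \<subseteq> \<phi> ` N"
    using inside_subset_N curve_subset_N by (intro image_mono Un_least)
  ultimately show ?thesis by simp
qed

text \<open>The continuation of \<phi> beyond L is what allows R > 1. Taylor series of functions
  pulled back by \<open>\<Phi>\<close> then converge uniformly on the closed unit disc.\<close>

lemma phi_inverse_exists:
  obtains \<Phi> R where "R > 1" "ball 0 R \<subseteq> \<phi> ` N" "\<Phi> holomorphic_on \<phi> ` N" "\<And>z. z \<in> N \<Longrightarrow> \<Phi> (\<phi> z) = z"
    "\<And>z. z \<in> N \<Longrightarrow> deriv \<phi> z * deriv \<Phi> (\<phi> z) = 1"
proof -
  have opn: "open (\<phi> ` N)"
    using open_mapping_thm3[OF phi_hol open_N phi_inj] .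
  obtain e where e: "e > 0" "(\<Union>x\<in>cball 0 1. ball x e) \<subseteq> \<phi> ` N"
    using compact_subset_open_imp_ball_epsilon_subset[OF compact_cball opn cball_subset_phi_N] .
  have "ball 0 (1 + e) \<subseteq> \<phi> ` N"
  proof
    fix u :: complex assume u: "u \<in> ball 0 (1 + e)"
    show "u \<in> \<phi> ` N"
    proof (cases "cmod u \<le> 1")
      case True
      then show ?thesis using cball_subset_phi_N by auto
    next
      case False
      \<comment> \<open>Such a point lies within \<open>e\<close> of its radial projection to the
        unit circle.\<close>
      have "dist (u / of_real (cmod u)) u = cmod (u * of_real (1 / cmod u - 1))"
        by (simp add: dist_norm algebra_simps)
      also have "\<dots> = cmod u * \<bar>1 / cmod u - 1\<bar>"
        by (simp only: norm_mult norm_of_real)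
      also have "\<dots> = cmod u - 1"
        using False by (cases "u = 0") (simp_all add: abs_if field_simps)
      finally have "u \<in> ball (u / of_real (cmod u)) e"
        using u by simp
      moreover have "u / of_real (cmod u) \<in> cball 0 1"
        using False by (simp add: norm_divide)
      ultimately show ?thesis using e(2) by blast
    qed
  qed
  moreover obtain \<Phi> where "\<Phi> holomorphic_on \<phi> ` N" "\<And>z. z \<in> N \<Longrightarrow> \<Phi> (\<phi> z) = z"
    "\<And>z. z \<in> N \<Longrightarrow> deriv \<phi> z * deriv \<Phi> (\<phi> z) = 1"
    using holomorphic_has_inverse[OF phi_hol open_N phi_inj] by metis
  ultimately show ?thesis
    using that[of "1 + e"] e(1) by simp
qed

lemma h_mero: "h nicely_meromorphic_on annulus (ereal \<mu>) (1 / ereal \<rho>)"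
  and h_eq: "\<rho> < cmod w \<Longrightarrow> \<rho> * cmod w < 1 \<Longrightarrow> h w = \<phi> (\<psi> w)"
  and mu_nonneg: "0 \<le> \<mu>"
  and mu_minimal: "0 \<le> m \<Longrightarrow> m < \<mu> \<Longrightarrow> \<not> meromorphic_continuation \<psi> \<phi> \<rho> m g"
  using is_mu by (auto simp: is_mu_def meromorphic_continuation_def annulus_def less_inverse_rho_iff)

lemma W_I: "\<rho> < cmod w \<Longrightarrow> cmod w \<le> 1 \<Longrightarrow> w \<in> W"
proof -
  assume w: "\<rho> < cmod w" "cmod w \<le> 1"
  have "\<rho> * cmod w \<le> \<rho> * 1"
    using w rho_nonneg by (intro mult_left_mono) auto
  moreover have "\<psi> w \<in> inside L \<union> L"
    using psi_inside_iff[OF w(1)] psi_circle w by (cases "cmod w = 1") auto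
  ultimately show ?thesis
    using w inside_subset_N curve_subset_N rho_less_1 by (auto simp: W_def)
qed

lemma W_D: "w \<in> W \<Longrightarrow> \<rho> < cmod w" "w \<in> W \<Longrightarrow> \<rho> * cmod w < 1" "w \<in> W \<Longrightarrow> \<psi> w \<in> N"
  by (auto simp: W_def)

lemma open_W: "open W"
proof -
  have "W = ({w. \<rho> < cmod w} \<inter> \<psi> -` N) \<inter> {w. \<rho> * cmod w < 1}"
    by (auto simp: W_def)
  moreover have "open ({w. \<rho> < cmod w} \<inter> \<psi> -` N)"
    by (rule continuous_open_preimage[OF holomorphic_on_imp_continuous_on[OF psi_hol] open_region open_N])
  moreover have "open {w::complex. \<rho> * cmod w < 1}"
    by (intro open_Collect_less continuous_intros)
  ultimately show ?thesis by auto
qed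

lemma h_eq_W: "w \<in> W \<Longrightarrow> h w = \<phi> (\<psi> w)"
  by (intro h_eq W_D)

lemma h_hol: "h holomorphic_on W"
proof -
  have "(\<phi> \<circ> \<psi>) holomorphic_on W"
    by (intro holomorphic_on_compose holomorphic_on_subset[OF psi_hol] holomorphic_on_subset[OF phi_hol])
      (auto simp: W_def)
  then show ?thesis
    by (rule holomorphic_transform) (simp add: h_eq_W)
qed

lemma open_h_ne: "open {v \<in> W. h v \<noteq> c}"
proof -
  have "open (W \<inter> h -` (- {c}))"
    by (rule continuous_open_preimage[OF holomorphic_on_imp_continuous_on[OF h_hol] open_W]) auto
  moreover have "{v \<in> W. h v \<noteq> c} = W \<inter> h -` (- {c})" by auto
  ultimately show ?thesis by simp
qed

lemma h_inj: "inj_on h W"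
proof (rule inj_onI)
  fix x y assume xy: "x \<in> W" "y \<in> W" "h x = h y"
  then have "\<psi> x = \<psi> y"
    using phi_inj W_D(3) by (simp add: inj_on_def h_eq_W)
  then show "x = y"
    using psi_eq_iff[of x y] W_D(1) xy by simp
qed

lemma h_circle: "cmod w = 1 \<Longrightarrow> cmod (h w) = 1"
  using W_I[of w] rho_less_1 h_eq_W[of w] phi_curve(2)[of "\<psi> w"] psi_circle by auto

lemma h_less_1: "\<rho> < cmod w \<Longrightarrow> cmod w < 1 \<Longrightarrow> cmod (h w) < 1"
  using W_I[of w] h_eq_W[of w] phi_less_1[of "\<psi> w"] psi_inside_iff[of w] by auto

lemma h_eq_phi_iff: "\<rho> < cmod w \<Longrightarrow> cmod w \<le> 1 \<Longrightarrow> z \<in> inside L \<Longrightarrow> h w = \<phi> z \<longleftrightarrow> \<psi> w = z"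
  using W_I[of w] h_eq_W[of w] phi_inj W_D(3)[of w] inside_subset_N by (auto simp: inj_on_def)

end

lemma circ_primitive_0:
  assumes "\<And>w. cmod w = r \<Longrightarrow> (f has_field_derivative f' w) (at w)" "0 < r"
  shows "circ r f' = 0"
proof -
  have "(f' has_contour_integral (f (pathfinish (circlepath 0 r)) - f (pathstart (circlepath 0 r)))) (circlepath 0 r)"
    by (rule contour_integral_primitive[of "sphere 0 r"]) (use assms in \<open>auto intro: has_field_derivative_at_within\<close>)
  then show ?thesis
    by (simp add: circ_def contour_integral_unique)
qed

section \<open>The exterior map near infinity and Cauchy's formula in its coordinate\<close>

context carleman_setting
begin

text \<open>This is \<psi>'(\<infinity>), the logarithmic capacity of L, of which
  \<open>exterior_map\<close> only asserts the existence.\<close>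

definition cap :: real where
  "cap = (SOME c. c > 0 \<and> ((\<lambda>w. \<psi> w / w) \<longlongrightarrow> complex_of_real c) at_infinity)"

lemma cap_pos: "cap > 0" and psi_over_id: "((\<lambda>w. \<psi> w / w) \<longlongrightarrow> complex_of_real cap) at_infinity"
proof -
  have "\<exists>c::real. c > 0 \<and> ((\<lambda>w. \<psi> w / w) \<longlongrightarrow> complex_of_real c) at_infinity"
    using exterior unfolding exterior_map_def by blast
  from someI_ex[OF this] show "cap > 0" "((\<lambda>w. \<psi> w / w) \<longlongrightarrow> complex_of_real cap) at_infinity"
    unfolding cap_def by blast+
qed

text \<open>In the coordinate \<open>x = 1/w\<close> at infinity, \<open>\<psi>\<close> is \<open>\<eta>(x) / x\<close>.\<close>
definition eta :: "complex \<Rightarrow> complex" where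
  "eta x = (if x = 0 then of_real cap else x * \<psi> (1 / x))"

text \<open>The image of \<rho> < |w| under 1/w with 0 added; in the product form it is the whole
  plane when \<rho> = 0.\<close>

definition inner_disc :: "complex set" where "inner_disc = {x. \<rho> * cmod x < 1}"

lemma open_inner_disc: "open inner_disc"
  unfolding inner_disc_def by (intro open_Collect_less continuous_intros)

lemma rho_less_inverse: "x \<in> inner_disc \<Longrightarrow> x \<noteq> 0 \<Longrightarrow> \<rho> < cmod (1 / x)"
  by (simp add: inner_disc_def norm_divide field_simps)

lemma eta_hol: "eta holomorphic_on inner_disc"
proof -
  have 1: "(\<lambda>x. x * \<psi> (1 / x)) holomorphic_on inner_disc - {0}"
  proof -
    have "(\<psi> \<circ> (\<lambda>x. 1 / x)) holomorphic_on inner_disc - {0}"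
    proof (rule holomorphic_on_compose)
      show "(\<lambda>x. 1 / x) holomorphic_on inner_disc - {0}"
        by (intro holomorphic_intros) auto
      show "\<psi> holomorphic_on (\<lambda>x. 1 / x) ` (inner_disc - {0})"
        by (rule holomorphic_on_subset[OF psi_hol]) (use rho_less_inverse in auto)
    qed
    from holomorphic_on_mult[OF holomorphic_on_ident this] show ?thesis by (simp add: o_def)
  qed
  have "((\<lambda>w. \<psi> w / w) \<circ> inverse) \<midarrow>0\<rightarrow> of_real cap"
    using psi_over_id unfolding lim_at_infinity_0 .
  then have 2: "(\<lambda>x. x * \<psi> (1 / x)) \<midarrow>0\<rightarrow> of_real cap"
    by (simp add: o_def field_simps)
  show ?thesis
    using removable_singularity[OF 1 open_inner_disc 2] by (simp add: eta_def[abs_def])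
qed

lemma zero_in_inner_disc: "0 \<in> inner_disc"
  by (simp add: inner_disc_def)

lemma deriv_psi_inverse:
  assumes "x \<in> inner_disc" "x \<noteq> 0"
  shows "deriv \<psi> (1 / x) = eta x - x * deriv eta x"
proof -
  have d: "(\<psi> has_field_derivative deriv \<psi> (1 / x)) (at (1 / x))"
    using rho_less_inverse[OF assms] by (intro holomorphic_derivI[OF psi_hol open_region]) auto
  have "((\<lambda>x. x * \<psi> (1 / x)) has_field_derivative \<psi> (1 / x) + x * (deriv \<psi> (1 / x) * (- 1 / x\<^sup>2))) (at x)"
  proof -
    have "((\<lambda>x. 1 / x) has_field_derivative - 1 / x\<^sup>2) (at x)"
      using assms(2) by (auto intro!: derivative_eq_intros simp: power2_eq_square)
    from DERIV_mult[OF DERIV_ident DERIV_chain2[OF d this]] show ?thesis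
      by (simp add: mult.commute)
  qed
  then have "(eta has_field_derivative \<psi> (1 / x) + x * (deriv \<psi> (1 / x) * (- 1 / x\<^sup>2))) (at x)"
    by (rule has_field_derivative_transform_within_open[of _ _ _ "- {0}"]) (use assms in \<open>auto simp: eta_def\<close>)
  then have "deriv eta x = \<psi> (1 / x) + x * (deriv \<psi> (1 / x) * (- 1 / x\<^sup>2))"
    by (rule DERIV_imp_deriv)
  then show ?thesis
    using assms by (simp add: eta_def field_simps power2_eq_square)
qed

lemma deriv_psi_at_infinity: "(deriv \<psi> \<longlongrightarrow> of_real cap) at_infinity"
proof -
  have "isCont (\<lambda>x. eta x - x * deriv eta x) 0"
    using holomorphic_on_imp_continuous_on[OF eta_hol] holomorphic_on_imp_continuous_on[OF holomorphic_deriv[OF eta_hol open_inner_disc]]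
      open_inner_disc zero_in_inner_disc
    by (intro continuous_intros) (auto simp: continuous_on_eq_continuous_at)
  then have "(\<lambda>x. eta x - x * deriv eta x) \<midarrow>0\<rightarrow> of_real cap"
    unfolding isCont_def by (simp add: eta_def)
  moreover have "\<forall>\<^sub>F x in at 0. eta x - x * deriv eta x = (deriv \<psi> \<circ> inverse) x"
    using eventually_at_in_open[OF open_inner_disc zero_in_inner_disc]
    by eventually_elim (use deriv_psi_inverse in \<open>auto simp: field_simps\<close>)
  ultimately have "(deriv \<psi> \<circ> inverse) \<midarrow>0\<rightarrow> of_real cap"
    by (rule Lim_transform_eventually)
  then show ?thesis unfolding lim_at_infinity_0 .
qed

lemma deriv_psi_hol: "deriv \<psi> holomorphic_on {w. \<rho> < cmod w}"
  by (intro holomorphic_deriv psi_hol open_region)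

lemma psi_path:
  assumes "\<rho> < r" "r < 1"
  shows "valid_path (\<psi> \<circ> circlepath 0 r)" "path_image (\<psi> \<circ> circlepath 0 r) \<subseteq> inside L"
    "pathfinish (\<psi> \<circ> circlepath 0 r) = pathstart (\<psi> \<circ> circlepath 0 r)"
    "contour_integral (\<psi> \<circ> circlepath 0 r) F = 2 * of_real pi * \<i> * circ r (\<lambda>w. deriv \<psi> w * F (\<psi> w))"
proof -
  have r: "0 < r" "path_image (circlepath 0 r) \<subseteq> {w. \<rho> < cmod w}"
    using assms rho_nonneg by auto
  show "valid_path (\<psi> \<circ> circlepath 0 r)"
    by (rule valid_path_compose_holomorphic[OF _ psi_hol open_region r(2)]) simp
  show "path_image (\<psi> \<circ> circlepath 0 r) \<subseteq> inside L"
    using assms r psi_inside_iff by (auto simp: path_image_compose)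
  show "pathfinish (\<psi> \<circ> circlepath 0 r) = pathstart (\<psi> \<circ> circlepath 0 r)"
    by (simp add: pathfinish_compose pathstart_compose)
  have "\<psi> analytic_on {w. \<rho> < cmod w}"
    using psi_hol open_region by (simp add: analytic_on_open)
  then show "contour_integral (\<psi> \<circ> circlepath 0 r) F = 2 * of_real pi * \<i> * circ r (\<lambda>w. deriv \<psi> w * F (\<psi> w))"
    using contour_integral_comp_analyticW[OF _ _ r(2)] by (simp add: circ_def)
qed

lemma circ_psi_0:
  assumes "F holomorphic_on inside L" "\<rho> < r" "r < 1"
  shows "circ r (\<lambda>w. deriv \<psi> w * F (\<psi> w)) = 0"
proof -
  have "(F has_contour_integral 0) (\<psi> \<circ> circlepath 0 r)"
    by (intro Cauchy_theorem_simply_connected[OF curve_topology(2,5) assms(1)] psi_path assms)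
  then show ?thesis
    using psi_path(4)[OF assms(2,3), of F] contour_integral_unique by force
qed

text \<open>Univalence leaves at most one preimage of z; \<open>r0\<close> is its modulus, or \<rho>
  if there is none. On circles of radius between \<open>r0\<close> and 1 the kernel 1 / (h -
  \<phi>(z)) has no pole.\<close>

lemma critical_radius:
  assumes "z \<in> inside L"
  shows "\<exists>r0. \<rho> \<le> r0 \<and> r0 < 1 \<and> (\<forall>w. r0 < cmod w \<longrightarrow> \<psi> w \<noteq> z)"
proof (cases "\<exists>w. \<rho> < cmod w \<and> \<psi> w = z")
  case True
  then obtain w where w: "\<rho> < cmod w" "\<psi> w = z" by auto
  have "cmod w < 1" using psi_inside_iff[OF w(1)] assms w(2) by simp
  moreover have "\<psi> v \<noteq> z" if "cmod w < cmod v" for v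
    using psi_eq_iff[of v w] w that by auto
  ultimately show ?thesis
    using w by (intro exI[of _ "cmod w"]) auto
next
  case False
  then show ?thesis using rho_less_1 by (intro exI[of _ \<rho>]) auto
qed

text \<open>Pulled back by \<psi>, the winding number is an integral of \<psi>' / (\<psi> - z). Its
  residue at infinity is a quotient of equal limits, since \<psi>' and \<psi>/w both tend to
  \<open>cap\<close>.\<close>

lemma winding_number_psi_circle:
  assumes "\<rho> \<le> r0" "r0 < r" "r < 1" "\<And>w. r0 < cmod w \<Longrightarrow> \<psi> w \<noteq> z"
  shows "winding_number (\<psi> \<circ> circlepath 0 r) z = 1"
proof -
  have r: "\<rho> < r" "0 < r" using assms rho_nonneg by auto
  have "\<psi> w \<noteq> z" if "cmod w = r" for w
    using assms(2,4) that by auto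
  then have "z \<notin> \<psi> ` sphere 0 r"
    by (metis imageE mem_sphere_0)
  then have "z \<notin> path_image (\<psi> \<circ> circlepath 0 r)"
    using r by (simp add: path_image_compose)
  then have "winding_number (\<psi> \<circ> circlepath 0 r) z = circ r (\<lambda>w. deriv \<psi> w * (1 / (\<psi> w - z)))"
    using psi_path[OF r(1) assms(3)] by (simp add: winding_number_valid_path)
  also have "\<dots> = 1"
  proof (rule circ_exterior[of _ r0])
    have sub: "{w. r0 < cmod w} \<subseteq> {w. \<rho> < cmod w}" using assms(1) by auto
    show "(\<lambda>w. deriv \<psi> w * (1 / (\<psi> w - z))) holomorphic_on {w. r0 < cmod w}"
      using assms(4) by (intro holomorphic_intros holomorphic_on_subset[OF deriv_psi_hol sub] holomorphic_on_subset[OF psi_hol sub]) auto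
    have "((\<lambda>w. deriv \<psi> w * (1 / (\<psi> w / w - z / w))) \<longlongrightarrow> of_real cap * (1 / (of_real cap - 0))) at_infinity"
      using cap_pos by (intro tendsto_intros deriv_psi_at_infinity psi_over_id tendsto_divide_0[OF tendsto_const] filterlim_ident) auto
    moreover have "\<forall>\<^sub>F w in at_infinity. deriv \<psi> w * (1 / (\<psi> w / w - z / w)) = w * (deriv \<psi> w * (1 / (\<psi> w - z)))"
      using eventually_not_equal_at_infinity[of "0::complex"]
      by eventually_elim (auto simp: field_simps)
    ultimately show "((\<lambda>w. w * (deriv \<psi> w * (1 / (\<psi> w - z)))) \<longlongrightarrow> 1) at_infinity"
      using cap_pos by (auto elim: Lim_transform_eventually)
  qed (use assms rho_nonneg in auto)
  finally show ?thesis .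
qed

text \<open>Cauchy's kernel 1 / (\<zeta> - z) is traded for \<phi>'(z) / (\<phi>(\<zeta>) -
  \<phi>(z)), which has the same residue at z. In the coordinate w it involves only h(w) -
  \<phi>(z), and h continues meromorphically to \<mu> < |w|, possibly further than \<psi>.\<close>

lemma Cauchy_inside:
  assumes z: "z \<in> inside L" and f: "f holomorphic_on inside L"
    and r: "\<rho> \<le> r0" "r0 < r" "r < 1" "\<And>w. r0 < cmod w \<Longrightarrow> \<psi> w \<noteq> z"
  shows "f z = deriv \<phi> z * circ r (\<lambda>w. f (\<psi> w) * deriv \<psi> w / (h w - \<phi> z))"
proof -
  have zN: "z \<in> N" using z inside_subset_N by auto
  \<comment> \<open>The difference quotient of \<phi> at \<open>z\<close> has no zero because \<phi>
    is univalent, so Cauchy's formula may be applied to f / D.\<close>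
  define D where "D = (\<lambda>w. if w = z then deriv \<phi> z else (\<phi> w - \<phi> z) / (w - z))"
  have D: "D holomorphic_on inside L"
    unfolding D_def by (rule pole_lemma_open[OF phi_hol_inside curve_topology(2)])
  have D0: "D w \<noteq> 0" if "w \<in> inside L" for w
    using phi_inj inside_subset_N that z phi_deriv_nonzero[OF zN] by (auto simp: D_def inj_on_def subset_iff)
  have hol: "(\<lambda>w. f w / D w) holomorphic_on inside L"
    by (intro holomorphic_on_divide f D D0)
  have r': "\<rho> < r" "0 < r" using r rho_nonneg by auto
  have zim: "path_image (\<psi> \<circ> circlepath 0 r) \<subseteq> inside L - {z}"
  proof -
    have "\<psi> w \<noteq> z" if "cmod w = r" for w
      using r(2,4) that by auto
    then have "z \<notin> \<psi> ` sphere 0 r"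
      by (metis imageE mem_sphere_0)
    then have "z \<notin> path_image (\<psi> \<circ> circlepath 0 r)"
      using r' by (simp add: path_image_compose)
    then show ?thesis
      using psi_path(2)[OF r'(1) r(3)] by blast
  qed
  have wz: "winding_number (\<psi> \<circ> circlepath 0 r) w = 0" if "w \<notin> inside L" for w
    using that psi_path[OF r'(1) r(3)] curve_topology(5)
    by (intro simply_connected_imp_winding_number_zero[of "inside L"] valid_path_imp_path)
  note ciw = Cauchy_integral_formula_global[OF curve_topology(2) hol z psi_path(1)[OF r'(1) r(3)] zim psi_path(3)[OF r'(1) r(3)] wz]
  have wn: "winding_number (\<psi> \<circ> circlepath 0 r) z = 1"
    by (rule winding_number_psi_circle[OF r])
  have "f z / deriv \<phi> z = circ r (\<lambda>w. deriv \<psi> w * ((f (\<psi> w) / D (\<psi> w)) / (\<psi> w - z)))"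
  proof -
    have "2 * of_real pi * \<i> * circ r (\<lambda>w. deriv \<psi> w * (f (\<psi> w) / D (\<psi> w) / (\<psi> w - z))) = 2 * of_real pi * \<i> * (f z / D z)"
      using contour_integral_unique[OF ciw] psi_path(4)[OF r'(1) r(3), of "\<lambda>w. f w / D w / (w - z)"] wn by simp
    then have "circ r (\<lambda>w. deriv \<psi> w * (f (\<psi> w) / D (\<psi> w) / (\<psi> w - z))) = f z / D z"
      by (simp only: mult_cancel_left) simp
    moreover have "D z = deriv \<phi> z" by (simp add: D_def)
    ultimately show ?thesis by simp
  qed
  also have "\<dots> = circ r (\<lambda>w. f (\<psi> w) * deriv \<psi> w / (h w - \<phi> z))"
  proof (rule circ_cong)
    fix w assume w: "cmod w = r"
    have "h w = \<phi> (\<psi> w)" using W_I[of w] w r r' h_eq_W by auto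
    then show "deriv \<psi> w * ((f (\<psi> w) / D (\<psi> w)) / (\<psi> w - z)) = f (\<psi> w) * deriv \<psi> w / (h w - \<phi> z)"
    proof -
      have alg: "d * ((a / (b / c)) / c) = a * d / b" if "c \<noteq> 0" for a b c d :: complex
        using that by simp
      have "\<psi> w \<noteq> z" using r(4)[of w] w r(2) by simp
      then show ?thesis
        using alg[of "\<psi> w - z"] \<open>h w = \<phi> (\<psi> w)\<close> by (simp only: D_def if_False right_minus_eq not_False_eq_True)
    qed
  qed (rule r')
  finally show ?thesis
    using phi_deriv_nonzero[OF zN] by (simp add: field_simps)
qed

end

section \<open>Green's formula by comparison of power series\<close>

lemma of_real_cmod_square: "(complex_of_real (cmod z))\<^sup>2 = z * cnj z"
  using complex_norm_square[of z] by simp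

context carleman_setting
begin

lemma sphere_subset_W: "sphere 0 1 \<subseteq> W"
  using W_I rho_less_1 by auto

lemma cont_circle_h: "continuous_on (sphere 0 1) h" "continuous_on (sphere 0 1) (deriv h)"
  using holomorphic_on_imp_continuous_on[OF h_hol] holomorphic_on_imp_continuous_on[OF holomorphic_deriv[OF h_hol open_W]]
    continuous_on_subset[OF _ sphere_subset_W] by blast+

lemma h_deriv: "w \<in> W \<Longrightarrow> (h has_field_derivative deriv h w) (at w)"
  by (intro holomorphic_derivI[OF h_hol open_W])

lemma deriv_h_eq: "w \<in> W \<Longrightarrow> deriv h w = deriv \<phi> (\<psi> w) * deriv \<psi> w"
proof -
  assume w: "w \<in> W"
  have "((\<lambda>w. \<phi> (\<psi> w)) has_field_derivative deriv \<phi> (\<psi> w) * deriv \<psi> w) (at w)"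
    using w W_D[OF w]
    by (intro DERIV_chain2[OF holomorphic_derivI[OF phi_hol open_N] holomorphic_derivI[OF psi_hol open_region]]) auto
  then have "(h has_field_derivative deriv \<phi> (\<psi> w) * deriv \<psi> w) (at w)"
    by (rule has_field_derivative_transform_within_open[OF _ open_W w]) (simp add: h_eq_W)
  then show ?thesis by (rule DERIV_imp_deriv)
qed

text \<open>The argument principle for h on the unit circle. It is \<open>Cauchy_inside\<close> for
  the function \<phi>' at the zero of \<phi>: there \<phi>'(\<psi>) \<psi>' is h', and \<phi>'(z0)
  cancels on both sides.\<close>

lemma circ_log_deriv_h: "circ 1 (\<lambda>w. deriv h w / h w) = 1"
proof -
  have "0 \<in> \<phi> ` inside L"
    using phi_bij by (simp add: bij_betw_def)
  then obtain z0 where z0: "z0 \<in> inside L" "\<phi> z0 = 0" by auto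
  obtain r0 where r0: "\<rho> \<le> r0" "r0 < 1" "\<And>w. r0 < cmod w \<Longrightarrow> \<psi> w \<noteq> z0"
    using critical_radius[OF z0(1)] by auto
  define r where "r = (r0 + 1) / 2"
  have r: "r0 < r" "r < 1" "\<rho> < r" "0 < r"
    using r0 rho_nonneg by (auto simp: r_def)
  have z0N: "z0 \<in> N" using z0 inside_subset_N by auto
  have "deriv \<phi> holomorphic_on inside L"
    by (intro holomorphic_deriv phi_hol_inside curve_topology)
  from Cauchy_inside[OF z0(1) this r0(1) r(1,2) r0(3)]
  have 1: "circ r (\<lambda>w. deriv \<phi> (\<psi> w) * deriv \<psi> w / h w) = 1"
    using z0(2) phi_deriv_nonzero[OF z0N] by simp
  have "circ r (\<lambda>w. deriv h w / h w) = circ r (\<lambda>w. deriv \<phi> (\<psi> w) * deriv \<psi> w / h w)"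
    using r by (intro circ_cong) (auto simp: deriv_h_eq W_I)
  moreover have "circ r (\<lambda>w. deriv h w / h w) = circ 1 (\<lambda>w. deriv h w / h w)"
  proof (rule circ_shift[of "{w \<in> W. h w \<noteq> 0}"])
    show "open {w \<in> W. h w \<noteq> 0}" by (rule open_h_ne)
    show "(\<lambda>w. deriv h w / h w) holomorphic_on {w \<in> W. h w \<noteq> 0}"
      by (intro holomorphic_intros holomorphic_on_subset[OF h_hol] holomorphic_on_subset[OF holomorphic_deriv[OF h_hol open_W]]) auto
    fix w assume w: "r \<le> cmod w" "cmod w \<le> 1"
    then show "w \<in> {w \<in> W. h w \<noteq> 0}"
      using h_eq_phi_iff[of w z0] z0 r r0(3)[of w] by (auto intro!: W_I)
  qed (use r in auto)
  ultimately show ?thesis using 1 by simp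
qed

text \<open>On the unit circle |h| = 1, so the conjugate of h^k is h^(-k) and the integrand is
  h^(i-k) h'. This has a primitive unless i - k = -1.\<close>

lemma circ_h_monom:
  "circ 1 (\<lambda>w. h w ^ i * deriv h w * cnj (h w ^ k)) = (if k = Suc i then 1 else 0)"
proof -
  have h0: "h w \<noteq> 0" if "cmod w = 1" for w
    using h_circle[OF that] by auto
  have c: "cnj (h w ^ k) = 1 / h w ^ k" if "cmod w = 1" for w
  proof -
    have "cnj (h w) * h w = 1"
      using h_circle[OF that] complex_norm_square[of "h w"] by (simp add: mult.commute)
    then have "cnj (h w) = 1 / h w" using h0[OF that] by (simp add: field_simps)
    then show ?thesis by (simp add: power_divide)
  qed
  have wW: "w \<in> W" if "cmod w = 1" for w
    using W_I[of w] that rho_less_1 by simp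
  consider "k = Suc i" | "k \<le> i" | "k > Suc i" by linarith
  then show ?thesis
  proof cases
    case 1
    have "circ 1 (\<lambda>w. h w ^ i * deriv h w * cnj (h w ^ k)) = circ 1 (\<lambda>w. deriv h w / h w)"
    proof (rule circ_cong)
      fix w :: complex assume w: "cmod w = 1"
      show "h w ^ i * deriv h w * cnj (h w ^ k) = deriv h w / h w"
        unfolding c[OF w] using h0[OF w] by (simp add: 1)
    qed simp
    then show ?thesis using 1 circ_log_deriv_h by simp
  next
    case 2
    have "circ 1 (\<lambda>w. h w ^ i * deriv h w * cnj (h w ^ k)) = circ 1 (\<lambda>w. h w ^ (i - k) * deriv h w)"
      by (rule circ_cong) (simp_all add: c h0 2 power_diff del: complex_cnj_power)
    also have "\<dots> = 0"
    proof (rule circ_primitive_0)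
      fix w :: complex assume "cmod w = 1"
      have "((\<lambda>w. h w ^ Suc (i - k)) has_field_derivative of_nat (Suc (i - k)) * (deriv h w * h w ^ (i - k))) (at w)"
        using DERIV_power_Suc[OF h_deriv[OF wW[OF \<open>cmod w = 1\<close>]], of "i - k"] by (simp only: of_nat_Suc)
      from DERIV_cdivide[OF this, of "of_nat (Suc (i - k))"]
      show "((\<lambda>w. h w ^ Suc (i - k) / of_nat (Suc (i - k))) has_field_derivative h w ^ (i - k) * deriv h w) (at w)"
        by (simp add: mult.commute del: of_nat_Suc power_Suc)
    qed simp
    finally show ?thesis using 2 by simp
  next
    case 3
    define m where "m = k - i - 1"
    have m: "m > 0" "k = i + Suc m" using 3 by (auto simp: m_def)
    have "circ 1 (\<lambda>w. h w ^ i * deriv h w * cnj (h w ^ k)) = circ 1 (\<lambda>w. inverse (h w) ^ Suc m * deriv h w)"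
    proof (rule circ_cong)
      fix w :: complex assume w: "cmod w = 1"
      have "h w ^ k = h w ^ i * h w ^ Suc m" unfolding m(2) power_add ..
      then show "h w ^ i * deriv h w * cnj (h w ^ k) = inverse (h w) ^ Suc m * deriv h w"
        unfolding c[OF w] using h0[OF w] by (simp add: power_inverse divide_simps del: power_Suc)
    qed simp
    also have "\<dots> = 0"
    proof (rule circ_primitive_0)
      fix w :: complex assume w: "cmod w = 1"
      obtain m' where m': "m = Suc m'" using m(1) by (cases m) auto
      have "((\<lambda>w. inverse (h w)) has_field_derivative - (inverse (h w) * deriv h w * inverse (h w))) (at w)"
        by (rule DERIV_inverse'[OF h_deriv[OF wW[OF w]] h0[OF w]])
      from DERIV_power_Suc[OF this, of m']
      have "((\<lambda>w. inverse (h w) ^ m) has_field_derivative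
          of_nat m * (- (inverse (h w) * deriv h w * inverse (h w)) * inverse (h w) ^ m')) (at w)"
        by (simp only: m' of_nat_Suc)
      from DERIV_cdivide[OF this, of "- of_nat m"]
      show "((\<lambda>w. inverse (h w) ^ m / (- of_nat m)) has_field_derivative inverse (h w) ^ Suc m * deriv h w) (at w)"
        using m(1) by (simp add: m' ac_simps del: of_nat_Suc)
    qed simp
    finally show ?thesis using 3 by simp
  qed
qed

lemma circ_h_taylor:
  assumes F: "F holomorphic_on ball 0 R" and R: "R > 1"
  shows "circ 1 (\<lambda>w. F (h w) * deriv h w * cnj (h w ^ k)) = (case k of 0 \<Rightarrow> 0 | Suc i \<Rightarrow> taylor_coeff F i)"
proof -
  let ?S = "\<lambda>n u. \<Sum>i<n. taylor_coeff F i * u ^ i"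
  let ?I = "\<lambda>n. circ 1 (\<lambda>w. ?S n (h w) * (deriv h w * cnj (h w ^ k)))"
  have contF: "continuous_on (cball 0 1) F"
    using R by (intro continuous_on_subset[OF holomorphic_on_imp_continuous_on[OF F]]) auto
  have im: "h ` sphere 0 1 \<subseteq> cball 0 1"
    using h_circle by auto
  have contFh: "continuous_on (sphere 0 1) (\<lambda>w. F (h w))"
    by (rule continuous_on_compose2[OF contF cont_circle_h(1) im])
  have lim: "?I \<longlonglongrightarrow> circ 1 (\<lambda>w. F (h w) * (deriv h w * cnj (h w ^ k)))"
  proof (rule circ_uniform_limit)
    have "uniform_limit (cball 0 1) ?S F sequentially"
      by (rule taylor_uniform_limit[OF F R])
    then have "uniform_limit (sphere 0 1) (\<lambda>n w. ?S n (h w)) (\<lambda>w. F (h w)) sequentially"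
      unfolding uniform_limit_iff using im by (fastforce elim!: eventually_mono)
    moreover have "bounded ((\<lambda>w. F (h w)) ` sphere 0 1)"
      by (intro compact_imp_bounded compact_continuous_image contFh) auto
    moreover have "bounded ((\<lambda>w. deriv h w * cnj (h w ^ k)) ` sphere 0 1)"
      by (intro compact_imp_bounded compact_continuous_image continuous_intros cont_circle_h) auto
    ultimately show "uniform_limit (sphere 0 1) (\<lambda>n w. ?S n (h w) * (deriv h w * cnj (h w ^ k)))
        (\<lambda>w. F (h w) * (deriv h w * cnj (h w ^ k))) sequentially"
      by (intro uniform_lim_mult uniform_limit_const)
  qed (auto intro!: continuous_intros cont_circle_h)
  have In: "?I n = (\<Sum>i<n. taylor_coeff F i * (if k = Suc i then 1 else 0))" for n
  proof -
    have "?I n = circ 1 (\<lambda>w. \<Sum>i<n. taylor_coeff F i * (h w ^ i * deriv h w * cnj (h w ^ k)))"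
      by (simp only: sum_distrib_right mult.assoc)
    also have "\<dots> = (\<Sum>i<n. circ 1 (\<lambda>w. taylor_coeff F i * (h w ^ i * deriv h w * cnj (h w ^ k))))"
      by (intro circ_sum continuous_intros cont_circle_h) auto
    also have "\<dots> = (\<Sum>i<n. taylor_coeff F i * circ 1 (\<lambda>w. h w ^ i * deriv h w * cnj (h w ^ k)))"
      by (intro sum.cong refl circ_cmult continuous_intros cont_circle_h) auto
    finally show ?thesis by (simp only: circ_h_monom)
  qed
  have ev: "\<forall>\<^sub>F n in sequentially. ?I n = (case k of 0 \<Rightarrow> 0 | Suc i \<Rightarrow> taylor_coeff F i)"
    using eventually_gt_at_top[of k]
  proof eventually_elim
    case (elim n)
    show ?case unfolding In
    proof (cases k)
      case (Suc i)
      have "(\<Sum>j<n. taylor_coeff F j * (if k = Suc j then 1 else 0)) = (\<Sum>j<n. if j = i then taylor_coeff F i else 0)"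
        by (intro sum.cong) (auto simp: Suc)
      then show "(\<Sum>j<n. taylor_coeff F j * (if k = Suc j then 1 else 0)) = (case k of 0 \<Rightarrow> 0 | Suc i \<Rightarrow> taylor_coeff F i)"
        using elim Suc by simp
    qed simp
  qed
  have "circ 1 (\<lambda>w. F (h w) * (deriv h w * cnj (h w ^ k))) = (case k of 0 \<Rightarrow> 0 | Suc i \<Rightarrow> taylor_coeff F i)"
    by (rule LIMSEQ_unique[OF lim tendsto_eventually[OF ev]])
  then show ?thesis by (simp only: mult.assoc)
qed

text \<open>The same series as in \<open>disc_integral_deriv\<close>, now for an integral along the
  unit circle. The equality of the two sums is Green's formula.\<close>

lemma circ_h_sums:
  assumes F: "F holomorphic_on ball 0 R" and G: "G holomorphic_on ball 0 R" and R: "R > 1"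
  shows "(\<lambda>i. taylor_coeff F i * cnj (taylor_coeff G (Suc i))) sums
    circ 1 (\<lambda>w. F (h w) * deriv h w * cnj (G (h w)))"
proof -
  let ?S = "\<lambda>n u. \<Sum>i<n. taylor_coeff G i * u ^ i"
  have cont: "continuous_on (cball 0 1) F" "continuous_on (cball 0 1) G"
    using R by (intro continuous_on_subset[OF holomorphic_on_imp_continuous_on[OF F]]
      continuous_on_subset[OF holomorphic_on_imp_continuous_on[OF G]]; force)+
  have im: "h ` sphere 0 1 \<subseteq> cball 0 1"
    using h_circle by auto
  have contFh: "continuous_on (sphere 0 1) (\<lambda>w. F (h w))" "continuous_on (sphere 0 1) (\<lambda>w. G (h w))"
    by (rule continuous_on_compose2[OF cont(1) cont_circle_h(1) im], rule continuous_on_compose2[OF cont(2) cont_circle_h(1) im])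
  have lim: "(\<lambda>n. circ 1 (\<lambda>w. F (h w) * deriv h w * cnj (?S n (h w)))) \<longlonglongrightarrow> circ 1 (\<lambda>w. F (h w) * deriv h w * cnj (G (h w)))"
  proof (rule circ_uniform_limit)
    have "uniform_limit (cball 0 1) (\<lambda>n u. cnj (?S n u)) (\<lambda>u. cnj (G u)) sequentially"
      using taylor_uniform_limit[OF G R] unfolding uniform_limit_iff dist_norm
      by (simp only: complex_cnj_diff[symmetric] complex_mod_cnj)
    then have "uniform_limit (sphere 0 1) (\<lambda>n w. cnj (?S n (h w))) (\<lambda>w. cnj (G (h w))) sequentially"
      unfolding uniform_limit_iff using im by (fastforce elim!: eventually_mono)
    moreover have "bounded ((\<lambda>w. F (h w) * deriv h w) ` sphere 0 1)"
      by (intro compact_imp_bounded compact_continuous_image continuous_intros contFh cont_circle_h) auto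
    moreover have "bounded ((\<lambda>w. cnj (G (h w))) ` sphere 0 1)"
      by (intro compact_imp_bounded compact_continuous_image continuous_intros contFh) auto
    ultimately show "uniform_limit (sphere 0 1) (\<lambda>n w. F (h w) * deriv h w * cnj (?S n (h w)))
        (\<lambda>w. F (h w) * deriv h w * cnj (G (h w))) sequentially"
      by (intro uniform_lim_mult uniform_limit_const)
  qed (auto intro!: continuous_intros cont_circle_h contFh)
  have In: "circ 1 (\<lambda>w. F (h w) * deriv h w * cnj (?S n (h w)))
      = (\<Sum>k<n. cnj (taylor_coeff G k) * (case k of 0 \<Rightarrow> 0 | Suc i \<Rightarrow> taylor_coeff F i))" for n
  proof -
    have "circ 1 (\<lambda>w. F (h w) * deriv h w * cnj (?S n (h w)))
      = circ 1 (\<lambda>w. \<Sum>k<n. cnj (taylor_coeff G k) * (F (h w) * deriv h w * cnj (h w ^ k)))"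
      by (simp only: cnj_sum complex_cnj_mult sum_distrib_left mult.left_commute)
    also have "\<dots> = (\<Sum>k<n. circ 1 (\<lambda>w. cnj (taylor_coeff G k) * (F (h w) * deriv h w * cnj (h w ^ k))))"
      by (intro circ_sum continuous_intros cont_circle_h contFh) auto
    also have "\<dots> = (\<Sum>k<n. cnj (taylor_coeff G k) * circ 1 (\<lambda>w. F (h w) * deriv h w * cnj (h w ^ k)))"
      by (intro sum.cong refl circ_cmult continuous_intros cont_circle_h contFh) auto
    finally show ?thesis by (simp only: circ_h_taylor[OF F R])
  qed
  have "(\<lambda>n. \<Sum>i<n. taylor_coeff F i * cnj (taylor_coeff G (Suc i))) \<longlonglongrightarrow> circ 1 (\<lambda>w. F (h w) * deriv h w * cnj (G (h w)))"
  proof -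
    \<comment> \<open>The term k = 0 is zero; dropping it shifts the index by one.\<close>
    have "circ 1 (\<lambda>w. F (h w) * deriv h w * cnj (?S (Suc n) (h w))) = (\<Sum>i<n. taylor_coeff F i * cnj (taylor_coeff G (Suc i)))" for n
      unfolding In[of "Suc n"] unfolding sum.lessThan_Suc_shift by (simp add: mult.commute)
    then show ?thesis
      using LIMSEQ_Suc[OF lim] by simp
  qed
  then show ?thesis unfolding sums_def .
qed

text \<open>The differential p_n(z) dz in the coordinate w.\<close>

definition pn_psi :: "nat \<Rightarrow> complex \<Rightarrow> complex" where
  "pn_psi n w = poly (p n) (\<psi> w) * deriv \<psi> w"

lemma phi_inverse_disc:
  obtains \<Phi> R where "R > 1" "\<Phi> holomorphic_on ball 0 R" "deriv \<Phi> holomorphic_on ball 0 R"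
    "\<And>z. z \<in> N \<Longrightarrow> \<Phi> (\<phi> z) = z" "\<And>z. z \<in> N \<Longrightarrow> deriv \<phi> z * deriv \<Phi> (\<phi> z) = 1"
    "cball 0 1 \<subseteq> ball (0::complex) R" "\<Phi> ` ball 0 1 = inside L" "inj_on \<Phi> (ball 0 1)"
    "continuous_on (cball 0 1) \<Phi>" "continuous_on (cball 0 1) (deriv \<Phi>)"
proof -
  obtain \<Phi> R where Phi: "R > 1" "ball 0 R \<subseteq> \<phi> ` N" "\<Phi> holomorphic_on \<phi> ` N" "\<And>z. z \<in> N \<Longrightarrow> \<Phi> (\<phi> z) = z"
    "\<And>z. z \<in> N \<Longrightarrow> deriv \<phi> z * deriv \<Phi> (\<phi> z) = 1"
    using phi_inverse_exists by metis
  have PhiR: "\<Phi> holomorphic_on ball 0 R" "deriv \<Phi> holomorphic_on ball 0 R"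
    using holomorphic_on_subset[OF Phi(3,2)] by (auto intro: holomorphic_deriv)
  have sub: "cball 0 1 \<subseteq> ball (0::complex) R" using Phi(1) by auto
  have img: "\<Phi> ` ball 0 1 = inside L"
  proof -
    have "\<Phi> ` \<phi> ` inside L = (\<lambda>z. z) ` inside L"
      unfolding image_image using Phi(4) inside_subset_N by (intro image_cong) auto
    then show ?thesis using phi_bij by (simp add: bij_betw_def)
  qed
  have inj: "inj_on \<Phi> (ball 0 1)"
  proof (rule inj_onI)
    fix x y :: complex assume xy: "x \<in> ball 0 1" "y \<in> ball 0 1" "\<Phi> x = \<Phi> y"
    have "x \<in> \<phi> ` N" "y \<in> \<phi> ` N"
      by (rule subsetD[OF Phi(2)], use xy Phi(1) in simp)+
    then obtain a b where "a \<in> N" "b \<in> N" "x = \<phi> a" "y = \<phi> b" by blast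
    then show "x = y" using xy Phi(4) by auto
  qed
  have contR: "continuous_on (cball 0 1) \<Phi>" "continuous_on (cball 0 1) (deriv \<Phi>)"
    using holomorphic_on_imp_continuous_on[OF PhiR(1)] holomorphic_on_imp_continuous_on[OF PhiR(2)] sub
    by (blast intro: continuous_on_subset)+
  show ?thesis
    by (rule that[OF Phi(1) PhiR Phi(4,5) sub img inj contR])
qed

text \<open>With F = P(\<Phi>) \<Phi>' and G = Q(\<Phi>), for \<Phi> the inverse of \<phi>, the left
  side is a disc integral of F against the conjugate of G' and the right side an integral of F
  against the conjugate of G along h. Both have the same expansion in Taylor coefficients.\<close>

lemma Green_identity:
  "set_lebesgue_integral lborel (inside L) (\<lambda>z. poly P z * cnj (poly (pderiv Q) z)) / of_real pi =
   circ 1 (\<lambda>w. poly P (\<psi> w) * deriv \<psi> w * cnj (poly Q (\<psi> w)))"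
proof -
  obtain \<Phi> R where R: "R > 1" and PhiR: "\<Phi> holomorphic_on ball 0 R" "deriv \<Phi> holomorphic_on ball 0 R"
    and Phi: "\<And>z. z \<in> N \<Longrightarrow> \<Phi> (\<phi> z) = z" "\<And>z. z \<in> N \<Longrightarrow> deriv \<phi> z * deriv \<Phi> (\<phi> z) = 1"
    and sub: "cball 0 1 \<subseteq> ball (0::complex) R" and img: "\<Phi> ` ball 0 1 = inside L" and inj: "inj_on \<Phi> (ball 0 1)"
    and contR: "continuous_on (cball 0 1) \<Phi>" "continuous_on (cball 0 1) (deriv \<Phi>)"
    using phi_inverse_disc by metis
  define F where "F = (\<lambda>u. poly P (\<Phi> u) * deriv \<Phi> u)"
  define G where "G = (\<lambda>u. poly Q (\<Phi> u))"
  have F: "F holomorphic_on ball 0 R" and G: "G holomorphic_on ball 0 R"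
    unfolding F_def G_def by (intro holomorphic_intros PhiR)+
  have dG: "deriv G u = poly (pderiv Q) (\<Phi> u) * deriv \<Phi> u" if "u \<in> ball 0 R" for u
    unfolding G_def using holomorphic_derivI[OF PhiR(1) _ that]
    by (intro DERIV_imp_deriv DERIV_chain2[OF poly_DERIV]) auto
  have eq: "complex_of_real ((cmod (deriv \<Phi> u))\<^sup>2) * (poly P (\<Phi> u) * cnj (poly (pderiv Q) (\<Phi> u))) = F u * cnj (deriv G u)"
    if "u \<in> cball 0 1" for u
  proof -
    have "u \<in> ball 0 R" using sub that by blast
    then show ?thesis
      unfolding F_def by (simp add: dG of_real_cmod_square ac_simps)
  qed
  have "set_lebesgue_integral lborel (\<Phi> ` ball 0 1) (\<lambda>z. poly P z * cnj (poly (pderiv Q) z)) =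
    disc_integral (\<lambda>u. complex_of_real ((cmod (deriv \<Phi> u))\<^sup>2) * (poly P (\<Phi> u) * cnj (poly (pderiv Q) (\<Phi> u))))"
    by (rule integral_change_of_variables_holomorphic(2)[OF _ _ inj])
      (use sub in \<open>auto intro!: holomorphic_on_subset[OF PhiR(1)] continuous_intros contR
         set_integrable_lborel_compact_superset[of "cball 0 1"]\<close>)
  also have "\<dots> = disc_integral (\<lambda>u. F u * cnj (deriv G u))"
    using eq by (intro set_lebesgue_integral_cong) auto
  finally have area: "set_lebesgue_integral lborel (inside L) (\<lambda>z. poly P z * cnj (poly (pderiv Q) z)) =
      disc_integral (\<lambda>u. F u * cnj (deriv G u))"
    unfolding img .
  have "circ 1 (\<lambda>w. F (h w) * deriv h w * cnj (G (h w))) = circ 1 (\<lambda>w. poly P (\<psi> w) * deriv \<psi> w * cnj (poly Q (\<psi> w)))"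
  proof (rule circ_cong)
    fix w :: complex assume "cmod w = 1"
    then have w: "w \<in> W" using W_I[of w] rho_less_1 by simp
    have "\<Phi> (h w) = \<psi> w" "deriv \<phi> (\<psi> w) * deriv \<Phi> (h w) = 1"
      using Phi[OF W_D(3)[OF w]] h_eq_W[OF w] by auto
    moreover have "F (h w) * deriv h w = poly P (\<Phi> (h w)) * (deriv \<phi> (\<psi> w) * deriv \<Phi> (h w)) * deriv \<psi> w"
      unfolding F_def deriv_h_eq[OF w] by (simp only: ac_simps)
    ultimately show "F (h w) * deriv h w * cnj (G (h w)) = poly P (\<psi> w) * deriv \<psi> w * cnj (poly Q (\<psi> w))"
      by (simp add: G_def)
  qed simp
  then show ?thesis
    using sums_unique2[OF disc_integral_deriv[OF F G R] circ_h_sums[OF F G R]] area by simp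
qed

text \<open>Passing from p_n to p_n(\<Phi>) \<Phi>' preserves the norm, so the pointwise bound on
  the disc holds uniformly in n.\<close>

lemma pn_bounded_compact:
  assumes K: "compact K" "K \<subseteq> inside L"
  shows "\<exists>C\<ge>0. \<forall>n. \<forall>z\<in>K. cmod (poly (p n) z) \<le> C"
proof (cases "K = {}")
  case False
  obtain \<Phi> R where R: "R > 1" and PhiR: "\<Phi> holomorphic_on ball 0 R" "deriv \<Phi> holomorphic_on ball 0 R"
    and Phi: "\<And>z. z \<in> N \<Longrightarrow> \<Phi> (\<phi> z) = z" "\<And>z. z \<in> N \<Longrightarrow> deriv \<phi> z * deriv \<Phi> (\<phi> z) = 1"
    and sub: "cball 0 1 \<subseteq> ball (0::complex) R" and img: "\<Phi> ` ball 0 1 = inside L" and inj: "inj_on \<Phi> (ball 0 1)"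
    and contR: "continuous_on (cball 0 1) \<Phi>" "continuous_on (cball 0 1) (deriv \<Phi>)"
    using phi_inverse_disc by metis
  define F where "F = (\<lambda>n u. poly (p n) (\<Phi> u) * deriv \<Phi> u)"
  have F: "F n holomorphic_on ball 0 R" for n
    unfolding F_def by (intro holomorphic_intros PhiR)
  have norm: "disc_integral (\<lambda>u. F n u * cnj (F n u)) = of_real pi" for n
  proof -
    have "set_lebesgue_integral lborel (\<Phi> ` ball 0 1) (\<lambda>z. poly (p n) z * cnj (poly (p n) z)) =
      disc_integral (\<lambda>u. complex_of_real ((cmod (deriv \<Phi> u))\<^sup>2) * (poly (p n) (\<Phi> u) * cnj (poly (p n) (\<Phi> u))))"
      by (rule integral_change_of_variables_holomorphic(2)[OF _ _ inj])
        (use sub in \<open>auto intro!: holomorphic_on_subset[OF PhiR(1)] continuous_intros contR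
           set_integrable_lborel_compact_superset[of "cball 0 1"]\<close>)
    also have "\<dots> = disc_integral (\<lambda>u. F n u * cnj (F n u))"
      unfolding F_def by (intro set_lebesgue_integral_cong) (auto simp: of_real_cmod_square ac_simps)
    finally show ?thesis
      using orthonormal unfolding img bergman_orthonormal_def by (auto simp: field_simps)
  qed
  have bound: "cmod (poly (p n) z) \<le> 1 / (1 - cmod (\<phi> z))\<^sup>2 * cmod (deriv \<phi> z)" if "z \<in> inside L" for n z
  proof -
    have zN: "z \<in> N" using that inside_subset_N by auto
    have "poly (p n) z = poly (p n) z * (deriv \<phi> z * deriv \<Phi> (\<phi> z))"
      using Phi(2)[OF zN] by simp
    also have "\<dots> = F n (\<phi> z) * deriv \<phi> z"
      by (simp add: F_def Phi(1)[OF zN])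
    finally have eq: "poly (p n) z = F n (\<phi> z) * deriv \<phi> z" .
    show ?thesis
      unfolding eq norm_mult
      by (intro mult_right_mono disc_norm_pointwise_bound[OF F R norm] phi_less_1 that) simp
  qed
  have "continuous_on K (\<lambda>z. 1 / (1 - cmod (\<phi> z))\<^sup>2 * cmod (deriv \<phi> z))"
    using K phi_less_1
    by (intro continuous_intros continuous_on_subset[OF holomorphic_on_imp_continuous_on[OF phi_hol_inside] K(2)]
      continuous_on_subset[OF holomorphic_on_imp_continuous_on[OF holomorphic_deriv[OF phi_hol_inside curve_topology(2)]] K(2)]) force
  then obtain z1 where z1: "z1 \<in> K" "\<forall>z\<in>K. 1 / (1 - cmod (\<phi> z))\<^sup>2 * cmod (deriv \<phi> z) \<le> 1 / (1 - cmod (\<phi> z1))\<^sup>2 * cmod (deriv \<phi> z1)"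
    using continuous_attains_sup[OF K(1) False] by blast
  show ?thesis
  proof (intro exI[of _ "1 / (1 - cmod (\<phi> z1))\<^sup>2 * cmod (deriv \<phi> z1)"] conjI allI ballI)
    fix n z assume "z \<in> K"
    then show "cmod (poly (p n) z) \<le> 1 / (1 - cmod (\<phi> z1))\<^sup>2 * cmod (deriv \<phi> z1)"
      using bound[of z n] K(2) z1(2) by (meson order_trans subsetD)
  qed simp
qed auto

end

section \<open>Moments of the polynomials on the unit circle\<close>

lemma poly_over_power_at_infinity:
  fixes P :: "complex poly"
  shows "((\<lambda>z. poly P z / z ^ degree P) \<longlongrightarrow> lead_coeff P) at_infinity"
proof -
  let ?n = "degree P"
  have "((\<lambda>z. \<Sum>i\<le>?n. coeff P i * (1 / z) ^ (?n - i)) \<longlongrightarrow> (\<Sum>i\<le>?n. coeff P i * 0 ^ (?n - i))) at_infinity"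
    by (intro tendsto_intros tendsto_divide_0[OF tendsto_const] filterlim_ident)
  moreover have "(\<Sum>i\<le>?n. coeff P i * 0 ^ (?n - i)) = lead_coeff P"
  proof -
    have "(\<Sum>i\<le>?n. coeff P i * 0 ^ (?n - i)) = (\<Sum>i\<le>?n. if i = ?n then lead_coeff P else 0)"
      by (intro sum.cong) auto
    then show ?thesis by simp
  qed
  moreover have "\<forall>\<^sub>F z in at_infinity. (\<Sum>i\<le>?n. coeff P i * (1 / z) ^ (?n - i)) = poly P z / z ^ ?n"
    using eventually_not_equal_at_infinity[of "0::complex"]
  proof eventually_elim
    case (elim z)
    have "coeff P i * (1 / z) ^ (?n - i) = coeff P i * z ^ i / z ^ ?n" if "i \<le> ?n" for i
      using elim that by (simp add: power_diff power_divide)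
    then show ?case
      unfolding poly_altdef sum_divide_distrib by (intro sum.cong) auto
  qed
  ultimately show ?thesis
    by (auto intro: Lim_transform_eventually)
qed

text \<open>By 1 / (b - y) = (b / (b - y) - 1) / y every vanishing moment gains one factor
  1/y.\<close>

lemma circ_transform_moments:
  assumes a: "continuous_on (sphere 0 r) a" and b: "continuous_on (sphere 0 r) b" and r: "0 < r"
    and y: "y \<notin> b ` sphere 0 r" "y \<noteq> 0" and m: "\<And>k. k < n \<Longrightarrow> circ r (\<lambda>w. a w * b w ^ k) = 0"
  shows "circ r (\<lambda>w. a w / (b w - y)) = circ r (\<lambda>w. a w * b w ^ n / (b w - y)) / y ^ n"
  using a m
proof (induction n arbitrary: a)
  case (Suc n)
  have ne: "b w - y \<noteq> 0" if "cmod w = r" for w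
    using y(1) that by auto
  have 0: "circ r a = 0"
    using Suc.prems(2)[of 0] by simp
  have "circ r (\<lambda>w. a w / (b w - y)) = circ r (\<lambda>w. (1 / y) * (a w * b w / (b w - y) - a w))"
  proof (rule circ_cong)
    fix w :: complex assume "cmod w = r"
    then show "a w / (b w - y) = (1 / y) * (a w * b w / (b w - y) - a w)"
      using ne[of w] y(2) by (simp add: divide_simps) (simp add: algebra_simps)
  qed (rule r)
  also have "\<dots> = (1 / y) * (circ r (\<lambda>w. a w * b w / (b w - y)) - circ r a)"
    using Suc.prems(1) b r ne by (subst circ_cmult, (intro continuous_intros; force), simp, subst circ_diff) (auto intro!: continuous_intros)
  also have "\<dots> = circ r (\<lambda>w. (a w * b w) / (b w - y)) / y"
    by (simp add: 0)
  also have "circ r (\<lambda>w. (a w * b w) / (b w - y)) = circ r (\<lambda>w. (a w * b w) * b w ^ n / (b w - y)) / y ^ n"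
  proof (rule Suc.IH)
    show "continuous_on (sphere 0 r) (\<lambda>w. a w * b w)"
      using Suc.prems(1) b by (intro continuous_intros)
    show "circ r (\<lambda>w. a w * b w * b w ^ k) = 0" if "k < n" for k
      using Suc.prems(2)[of "Suc k"] that by (simp add: mult.assoc)
  qed
  finally show ?case by (simp add: ac_simps)
qed simp

text \<open>The sum y / (b - y) + 1 = b / (b - y) is O(1/|y|), so after multiplication by y only
  minus the zeroth moment survives.\<close>

lemma circ_transform_at_infinity:
  assumes a: "continuous_on (sphere 0 r) a" and b: "continuous_on (sphere 0 r) b" and r: "0 < r"
  shows "((\<lambda>y. y * circ r (\<lambda>w. a w / (b w - y))) \<longlongrightarrow> - circ r a) at_infinity"
proof -
  have "bounded ((\<lambda>w. a w * b w) ` sphere 0 r)" "bounded (b ` sphere 0 r)"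
    using a b by (intro compact_imp_bounded compact_continuous_image continuous_intros; simp)+
  then obtain A M where A: "A > 0" "\<And>w. cmod w = r \<Longrightarrow> cmod (a w * b w) \<le> A"
    and M: "M > 0" "\<And>w. cmod w = r \<Longrightarrow> cmod (b w) \<le> M"
    unfolding bounded_pos by fastforce
  have key: "cmod (y * circ r (\<lambda>w. a w / (b w - y)) + circ r a) \<le> r * (A / (cmod y - M))" if y: "cmod y > M" for y
  proof -
    have lb: "cmod y - M \<le> cmod (b w - y)" if "cmod w = r" for w
      using M(2)[OF that] norm_triangle_ineq2[of y "b w"] by (simp add: norm_minus_commute)
    have ne: "b w - y \<noteq> 0" if "cmod w = r" for w
      using lb[OF that] y by auto
    have c1: "continuous_on (sphere 0 r) (\<lambda>w. a w / (b w - y))"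
      using a b ne by (intro continuous_intros) auto
    have "y * circ r (\<lambda>w. a w / (b w - y)) + circ r a = circ r (\<lambda>w. y * (a w / (b w - y)) + a w)"
      using c1 a r by (subst circ_add) (auto intro!: continuous_intros simp: circ_cmult simp del: times_divide_eq_right)
    also have "\<dots> = circ r (\<lambda>w. a w * b w / (b w - y))"
    proof (rule circ_cong)
      fix w :: complex assume "cmod w = r"
      then show "y * (a w / (b w - y)) + a w = a w * b w / (b w - y)"
        using ne[of w] by (simp add: divide_simps) (simp add: algebra_simps)
    qed (rule r)
    also have "cmod \<dots> \<le> r * (A / (cmod y - M))"
    proof (rule circ_bound)
      show "continuous_on (sphere 0 r) (\<lambda>w. a w * b w / (b w - y))"
        using a b ne by (intro continuous_intros) auto
      fix w :: complex assume w: "cmod w = r"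
      show "cmod (a w * b w / (b w - y)) \<le> A / (cmod y - M)"
        unfolding norm_divide using A lb[OF w] w y by (intro frac_le) auto
    qed (rule r)
    finally show ?thesis .
  qed
  have lim: "((\<lambda>y::complex. r * (A / (cmod y - M))) \<longlongrightarrow> r * 0) at_infinity"
  proof (intro tendsto_intros)
    have "filterlim (\<lambda>y::complex. cmod y - M) at_top at_infinity"
      using filterlim_tendsto_add_at_top[OF tendsto_const filterlim_norm_at_top, of "- M"] by simp
    then show "((\<lambda>y::complex. A / (cmod y - M)) \<longlongrightarrow> 0) at_infinity"
      by (intro tendsto_divide_0[OF tendsto_const] filterlim_at_top_imp_at_infinity)
  qed
  have "((\<lambda>y. y * circ r (\<lambda>w. a w / (b w - y)) - (- circ r a)) \<longlongrightarrow> 0) at_infinity"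
  proof (rule Lim_null_comparison)
    show "\<forall>\<^sub>F y in at_infinity. cmod (y * circ r (\<lambda>w. a w / (b w - y)) - (- circ r a)) \<le> r * (A / (cmod y - M))"
      unfolding eventually_at_infinity using key by (intro exI[of _ "M + 1"]) auto
    show "((\<lambda>y::complex. r * (A / (cmod y - M))) \<longlongrightarrow> 0) at_infinity"
      using lim by simp
  qed
  then show ?thesis by (simp only: LIM_zero_cancel)
qed

lemma circ_kernel_residue:
  assumes S: "open S" "\<And>w. r \<le> cmod w \<Longrightarrow> cmod w \<le> R \<Longrightarrow> w \<in> S"
    and hol: "f holomorphic_on S" "b holomorphic_on S" and inj: "inj_on b S"
    and r: "0 < r" "r < cmod v" "cmod v < R"
  shows "circ R (\<lambda>w. f w / (b w - b v)) - circ r (\<lambda>w. f w / (b w - b v)) = f v / deriv b v"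
proof (rule circ_pole[OF S(1) _ S(2) r])
  have v: "v \<in> S" using S(2) r by auto
  show "(\<lambda>w. f w / (b w - b v)) holomorphic_on S - {v}"
    using inj v by (intro holomorphic_on_divide holomorphic_on_diff holomorphic_on_const
      holomorphic_on_subset[OF hol(1)] holomorphic_on_subset[OF hol(2)]) (auto simp: inj_on_def)
  have b': "(b has_field_derivative deriv b v) (at v)"
    by (rule holomorphic_derivI[OF hol(2) S(1) v])
  have nz: "deriv b v \<noteq> 0"
    by (rule holomorphic_injective_imp_regular[OF hol(2) S(1) inj v])
  have "(\<lambda>w. f w / ((b w - b v) / (w - v))) \<midarrow>v\<rightarrow> f v / deriv b v"
  proof (intro tendsto_divide nz)
    show "f \<midarrow>v\<rightarrow> f v"
      using holomorphic_on_imp_continuous_on[OF hol(1)] S(1) v by (simp add: continuous_on_eq_continuous_at isCont_def)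
    show "(\<lambda>w. (b w - b v) / (w - v)) \<midarrow>v\<rightarrow> deriv b v"
      using b' by (simp add: has_field_derivative_iff)
  qed
  then show "(\<lambda>w. (w - v) * (f w / (b w - b v))) \<midarrow>v\<rightarrow> f v / deriv b v"
    by (simp add: mult.commute)
qed

section \<open>Orthogonality as vanishing moments against the reflected exterior map\<close>

context carleman_setting
begin

definition kappa :: "nat \<Rightarrow> real" where "kappa n = Re (lead_coeff (p n))"

lemma kappa: "kappa n > 0" "lead_coeff (p n) = of_real (kappa n)" "degree (p n) = n"
proof -
  have *: "degree (p n) = n" "lead_coeff (p n) \<in> \<real>" "Re (lead_coeff (p n)) > 0"
    using orthonormal unfolding bergman_orthonormal_def by blast+
  show "kappa n > 0" "lead_coeff (p n) = of_real (kappa n)" "degree (p n) = n"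
    using * unfolding kappa_def by simp_all
qed

definition inner_pn :: "nat \<Rightarrow> complex poly \<Rightarrow> complex" where
  "inner_pn n q = set_lebesgue_integral lborel (inside L) (\<lambda>z. poly (p n) z * cnj (poly q z)) / of_real pi"

lemma set_integrable_inside:
  assumes "continuous_on UNIV f"
  shows "set_integrable lborel (inside L) (f :: complex \<Rightarrow> complex)"
proof (rule set_integrable_lborel_compact_superset[of "closure (inside L)"])
  show "compact (closure (inside L))"
    using curve_topology(4) by (simp add: compact_eq_bounded_closed bounded_closure)
  show "continuous_on (closure (inside L)) f"
    using assms continuous_on_subset by blast
qed (use curve_topology(2) closure_subset in auto)

lemma inner_pn_linear: "inner_pn n (smult c q + q') = cnj c * inner_pn n q + inner_pn n q'"
proof -
  have "set_lebesgue_integral lborel (inside L) (\<lambda>z. poly (p n) z * cnj (poly (smult c q + q') z))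
    = set_lebesgue_integral lborel (inside L) (\<lambda>z. cnj c * (poly (p n) z * cnj (poly q z)) + poly (p n) z * cnj (poly q' z))"
    by (simp add: algebra_simps)
  also have "\<dots> = cnj c * set_lebesgue_integral lborel (inside L) (\<lambda>z. poly (p n) z * cnj (poly q z))
     + set_lebesgue_integral lborel (inside L) (\<lambda>z. poly (p n) z * cnj (poly q' z))"
    by (subst set_integral_add) (auto intro!: set_integrable_inside continuous_intros)
  finally show ?thesis by (simp add: inner_pn_def add_divide_distrib)
qed

lemma inner_pn_pm: "inner_pn n (p m) = (if n = m then 1 else 0)"
  using orthonormal by (auto simp: bergman_orthonormal_def inner_pn_def field_simps)

text \<open>Induction on the degree, cancelling the leading term with a multiple of
  \<open>p d\<close>. The alternative \<open>q = 0\<close> is there for the remainder, whose degree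
  does not drop when d = 0.\<close>

lemma inner_pn_low_degree: "degree q < n \<or> q = 0 \<Longrightarrow> inner_pn n q = 0"
proof (induction "degree q" arbitrary: q rule: less_induct)
  case less
  show ?case
  proof (cases "q = 0")
    case True
    then show ?thesis by (simp add: inner_pn_def)
  next
    case False
    define d where "d = degree q"
    define c where "c = coeff q d / coeff (p d) d"
    have pd: "coeff (p d) d \<noteq> 0" "degree (p d) = d" "d < n"
      using kappa(1,2)[of d] kappa(3)[of d] less.prems False by (auto simp: d_def)
    define q' where "q' = q - smult c (p d)"
    have q: "q = smult c (p d) + q'" by (simp add: q'_def)
    have co: "coeff q' d = 0" "degree q' \<le> d"
      using pd by (auto simp: q'_def c_def d_def intro!: degree_diff_le degree_smult_le[THEN order_trans])
    have "degree q' < d \<or> q' = 0"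
      using co by (metis leading_coeff_0_iff le_neq_implies_less)
    then have "inner_pn n q' = 0"
      using less.hyps[of q'] pd(3) by (auto simp: d_def) (simp add: inner_pn_def)
    then show ?thesis
      unfolding q inner_pn_linear using pd(3) by (simp add: inner_pn_pm)
  qed
qed

lemma inner_pn_monom: "inner_pn n (monom 1 n) = 1 / of_real (kappa n)"
proof -
  define q' where "q' = monom 1 n - smult (1 / of_real (kappa n)) (p n)"
  have q: "monom 1 n = smult (1 / of_real (kappa n)) (p n) + q'" by (simp add: q'_def)
  have k0: "kappa n \<noteq> 0" using kappa(1)[of n] by simp
  have pn: "coeff (p n) n = of_real (kappa n)"
    using kappa(2,3)[of n] by simp
  have co: "coeff q' n = 0" "degree q' \<le> n"
    using pn k0 kappa(3)[of n]
    by (auto simp: q'_def intro!: degree_diff_le degree_smult_le[THEN order_trans] degree_monom_le)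
  have "degree q' < n \<or> q' = 0"
    using co by (metis leading_coeff_0_iff le_neq_implies_less)
  then have "inner_pn n q' = 0" by (rule inner_pn_low_degree)
  then show ?thesis
    unfolding q inner_pn_linear by (simp add: inner_pn_pm)
qed

text \<open>The Schwarz reflection of \<psi>: it is the conjugate of \<psi> on the unit circle
  (\<open>Psi_circle\<close>), but holomorphic for 0 < |v| < 1/\<rho>, with a simple pole of residue
  \<open>cap\<close> at 0.\<close>

definition Psi :: "complex \<Rightarrow> complex" where "Psi v = cnj (\<psi> (1 / cnj v))"

definition PD :: "complex set" where "PD = inner_disc - {0}"

lemma open_PD: "open PD"
  unfolding PD_def using open_inner_disc by auto

lemma PD_I: "v \<noteq> 0 \<Longrightarrow> \<rho> * cmod v < 1 \<Longrightarrow> v \<in> PD"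
  by (simp add: PD_def inner_disc_def)

lemma W_subset_PD: "W \<subseteq> PD"
proof
  fix w assume w: "w \<in> W"
  then have "w \<noteq> 0" using W_D(1)[OF w] rho_nonneg by auto
  then show "w \<in> PD" using W_D(2)[OF w] by (rule PD_I)
qed

lemma cnj_inner_disc: "cnj v \<in> inner_disc \<longleftrightarrow> v \<in> inner_disc"
  by (simp add: inner_disc_def)

lemma Psi_deriv:
  assumes "v \<in> PD"
  shows "(Psi has_field_derivative - cnj (deriv \<psi> (1 / cnj v)) / v\<^sup>2) (at v)"
proof -
  have v: "cnj v \<in> inner_disc" "cnj v \<noteq> 0"
    using assms by (auto simp: PD_def cnj_inner_disc)
  have d: "(\<psi> has_field_derivative deriv \<psi> (1 / cnj v)) (at (1 / cnj v))"
    using rho_less_inverse[OF v] by (intro holomorphic_derivI[OF psi_hol open_region]) auto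
  have "((\<lambda>x. 1 / x) has_field_derivative - 1 / (cnj v)\<^sup>2) (at (cnj v))"
    using v(2) by (auto intro!: derivative_eq_intros simp: power2_eq_square)
  from has_field_derivative_cnj_cnj[OF DERIV_chain2[OF d this]]
  show ?thesis by (simp add: o_def Psi_def[abs_def])
qed

lemma Psi_hol: "Psi holomorphic_on PD"
  unfolding holomorphic_on_open[OF open_PD] using Psi_deriv by blast

lemma deriv_Psi: "v \<in> PD \<Longrightarrow> deriv Psi v = - cnj (deriv \<psi> (1 / cnj v)) / v\<^sup>2"
  using Psi_deriv DERIV_imp_deriv by blast

lemma deriv_Psi_hol: "deriv Psi holomorphic_on PD"
  by (intro holomorphic_deriv Psi_hol open_PD)

lemma Psi_inj: "inj_on Psi PD"
proof (rule inj_onI)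
  fix x y assume xy: "x \<in> PD" "y \<in> PD" "Psi x = Psi y"
  have "\<rho> < cmod (1 / cnj x)" "\<rho> < cmod (1 / cnj y)"
    using xy rho_less_inverse[of "cnj x"] rho_less_inverse[of "cnj y"] by (auto simp: PD_def cnj_inner_disc)
  then have "1 / cnj x = 1 / cnj y"
    using psi_eq_iff xy(3) by (simp add: Psi_def)
  then show "x = y" by simp
qed

lemma deriv_Psi_nonzero: "v \<in> PD \<Longrightarrow> deriv Psi v \<noteq> 0"
  using holomorphic_injective_imp_regular[OF Psi_hol open_PD Psi_inj] .

lemma Psi_circle: "cmod w = 1 \<Longrightarrow> Psi w = cnj (\<psi> w)"
proof -
  assume "cmod w = 1"
  then have "w * cnj w = 1" using complex_norm_square[of w] by simp
  then have "1 / cnj w = w"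
    by (metis nonzero_eq_divide_eq mult_zero_right zero_neq_one)
  then show ?thesis by (simp add: Psi_def)
qed

lemma Psi_eta: "v \<in> PD \<Longrightarrow> v * Psi v = cnj (eta (cnj v))"
  by (auto simp: Psi_def eta_def PD_def)

lemma eta_cnj_tendsto: "((\<lambda>v. cnj (eta (cnj v))) \<longlongrightarrow> of_real cap) (at 0)"
proof -
  have "isCont eta 0"
    using holomorphic_on_imp_continuous_on[OF eta_hol] open_inner_disc zero_in_inner_disc
    by (simp add: continuous_on_eq_continuous_at)
  then have "isCont (\<lambda>v. eta (cnj v)) 0"
    by (intro isCont_o2[where f = cnj and g = eta] continuous_intros) simp
  then have "isCont (\<lambda>v. cnj (eta (cnj v))) 0"
    by (intro continuous_intros)
  then show ?thesis by (simp add: isCont_def eta_def)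
qed

lemma eventually_PD: "\<forall>\<^sub>F v in at 0. v \<in> PD"
  unfolding PD_def using eventually_at_in_open[OF open_inner_disc zero_in_inner_disc] .

lemma Psi_tendsto_0: "((\<lambda>v. v * Psi v) \<longlongrightarrow> of_real cap) (at 0)"
  by (rule Lim_transform_eventually[OF eta_cnj_tendsto])
    (use eventually_PD in eventually_elim, simp add: Psi_eta)

lemma deriv_Psi_tendsto_0: "((\<lambda>v. v\<^sup>2 * deriv Psi v) \<longlongrightarrow> - of_real cap) (at 0)"
proof -
  have "filterlim (\<lambda>v. 1 / cnj v) at_infinity (at 0)"
  proof -
    have "((\<lambda>v. cnj v) \<longlongrightarrow> 0) (at 0)"
      using tendsto_cnj[OF tendsto_ident_at, of 0] by simp
    then have "filterlim (\<lambda>v. cnj v) (at 0) (at 0)"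
      by (auto simp: filterlim_at eventually_at_filter)
    from filterlim_compose[OF filterlim_inverse_at_infinity this]
    show ?thesis by (simp add: divide_inverse)
  qed
  from filterlim_compose[OF deriv_psi_at_infinity this]
  have "((\<lambda>v. - cnj (deriv \<psi> (1 / cnj v))) \<longlongrightarrow> - cnj (of_real cap)) (at 0)"
    by (intro tendsto_intros)
  then have lim: "((\<lambda>v. - cnj (deriv \<psi> (1 / cnj v))) \<longlongrightarrow> - of_real cap) (at 0)"
    by simp
  show ?thesis
    by (rule Lim_transform_eventually[OF lim])
      (use eventually_PD in eventually_elim, simp add: deriv_Psi, simp add: PD_def)
qed

lemma Psi_at_infinity_0: "filterlim Psi at_infinity (at 0)"
proof -
  have "filterlim (\<lambda>v. (v * Psi v) / v) at_infinity (at 0)"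
    by (rule filterlim_divide_at_infinity[OF Psi_tendsto_0]) (use cap_pos in \<open>auto simp: filterlim_ident\<close>)
  moreover have "\<forall>\<^sub>F v in at 0. (v * Psi v) / v = Psi v"
    by (simp add: eventually_at_filter)
  ultimately show ?thesis
    using filterlim_cong[OF refl refl] by force
qed

lemma pn_psi_hol: "pn_psi n holomorphic_on {w. \<rho> < cmod w}"
  unfolding pn_psi_def by (intro holomorphic_intros psi_hol deriv_psi_hol)

text \<open>The leading coefficient of \<open>pn_psi n\<close> at infinity
  (\<open>pn_psi_at_infinity\<close>): n factors \<open>cap\<close> come from \<psi>^n and one from
  \<psi>'.\<close>

definition an :: "nat \<Rightarrow> real" where "an n = kappa n * cap ^ Suc n"

lemma an_pos: "an n > 0"
  using kappa(1) cap_pos by (simp add: an_def)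

lemma pn_psi_at_infinity: "((\<lambda>w. pn_psi n w / w ^ n) \<longlongrightarrow> of_real (an n)) at_infinity"
proof -
  have "((\<lambda>w. poly (p n) (\<psi> w) / \<psi> w ^ n) \<longlongrightarrow> of_real (kappa n)) at_infinity"
    using filterlim_compose[OF poly_over_power_at_infinity psi_at_infinity, of "p n"] kappa(2,3)[of n] by simp
  then have "((\<lambda>w. (poly (p n) (\<psi> w) / \<psi> w ^ n) * (\<psi> w / w) ^ n * deriv \<psi> w) \<longlongrightarrow>
      of_real (kappa n) * of_real cap ^ n * of_real cap) at_infinity"
    by (intro tendsto_intros psi_over_id deriv_psi_at_infinity)
  moreover have "\<forall>\<^sub>F w in at_infinity. (poly (p n) (\<psi> w) / \<psi> w ^ n) * (\<psi> w / w) ^ n * deriv \<psi> w = pn_psi n w / w ^ n"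
  proof -
    have "\<forall>\<^sub>F w in at_infinity. \<psi> w \<noteq> 0"
      using psi_at_infinity eventually_not_equal_at_infinity[of "0::complex"] by (rule eventually_compose_filterlim[rotated])
    then show ?thesis
      by eventually_elim (simp add: pn_psi_def power_divide)
  qed
  ultimately have "((\<lambda>w. pn_psi n w / w ^ n) \<longlongrightarrow> of_real (kappa n) * of_real cap ^ n * of_real cap) at_infinity"
    by (rule Lim_transform_eventually)
  then show ?thesis by (simp add: an_def ac_simps)
qed

text \<open>On the unit circle Psi^k is the conjugate of \<psi>^k, so Green's formula with Q = z^k
  applies.\<close>

lemma circ_Psi_moment:
  "circ 1 (\<lambda>w. pn_psi n w * Psi w ^ k) = of_nat k * inner_pn n (monom 1 (k - 1))"
proof -
  have "circ 1 (\<lambda>w. pn_psi n w * Psi w ^ k) = circ 1 (\<lambda>w. poly (p n) (\<psi> w) * deriv \<psi> w * cnj (poly (monom 1 k) (\<psi> w)))"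
    by (rule circ_cong) (simp_all add: pn_psi_def Psi_circle poly_monom)
  also have "\<dots> = inner_pn n (pderiv (monom 1 k))"
    unfolding Green_identity[symmetric] inner_pn_def ..
  also have "pderiv (monom 1 k) = smult (of_nat k) (monom 1 (k - 1)) + (0 :: complex poly)"
    by (simp add: pderiv_monom smult_monom)
  also have "inner_pn n \<dots> = of_nat k * inner_pn n (monom 1 (k - 1))"
    unfolding inner_pn_linear by (simp add: inner_pn_def)
  finally show ?thesis .
qed

text \<open>Differentiating z^k lowers its degree below n even for k = n, so n + 1 moments vanish;
  the next one is known from \<open>inner_pn_monom\<close>.\<close>

lemma circ_Psi_moment_0: "k \<le> n \<Longrightarrow> circ 1 (\<lambda>w. pn_psi n w * Psi w ^ k) = 0"
  unfolding circ_Psi_moment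
  by (cases k) (auto simp: degree_monom_eq intro!: inner_pn_low_degree)

lemma circ_Psi_moment_Suc: "circ 1 (\<lambda>w. pn_psi n w * Psi w ^ Suc n) = of_nat (Suc n) / of_real (kappa n)"
  unfolding circ_Psi_moment by (simp add: inner_pn_monom)

end

section \<open>The integral representation\<close>

lemma divide_diff_swap: "(a::complex) / (x - y) = (-1) * (a / (y - x))"
  by (metis minus_diff_eq minus_divide_right mult_minus1)

context carleman_setting
begin

text \<open>The reciprocal of \<open>r1\<close>, so that the radii are ordered as \<rho> < r1 < 1 <
  S1 < S2 < 1/\<rho>.\<close>

definition S2 :: real where "S2 = 2 / (1 + \<rho>)"
definition S1 :: real where "S1 = (1 + S2) / 2"
definition r1 :: real where "r1 = (1 + \<rho>) / 2"

lemma radii: "1 < S1" "S1 < S2" "\<rho> * S2 < 1" "\<rho> < r1" "r1 < 1" "0 < r1" "1 < S2" "0 < S2" "0 < S1"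
proof -
  show "1 < S2" using rho_nonneg rho_less_1 by (simp add: S2_def field_simps)
  then show "1 < S1" "S1 < S2" "0 < S2" "0 < S1" by (auto simp: S1_def)
  show "\<rho> * S2 < 1" using rho_nonneg rho_less_1 by (simp add: S2_def field_simps)
  show "\<rho> < r1" "r1 < 1" "0 < r1" using rho_nonneg rho_less_1 by (auto simp: r1_def)
qed

lemma PD_le_S2: "v \<noteq> 0 \<Longrightarrow> cmod v \<le> S2 \<Longrightarrow> v \<in> PD"
  using radii(3) mult_left_mono[of "cmod v" S2 \<rho>] rho_nonneg by (intro PD_I) auto

lemma Psi_eq_iff: "v \<in> PD \<Longrightarrow> w \<in> PD \<Longrightarrow> Psi v = Psi w \<longleftrightarrow> v = w"
  using Psi_inj by (auto simp: inj_on_def)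

text \<open>The annulus \<rho> < |w| < 1/\<rho>, the common domain of \<open>pn_psi n\<close> and
  \<open>Psi\<close>.\<close>

definition AW :: "complex set" where "AW = {w. \<rho> < cmod w} \<inter> PD"

lemma open_AW: "open AW"
  unfolding AW_def by (intro open_Int open_region open_PD)

lemma AW_I: "\<rho> < cmod w \<Longrightarrow> cmod w \<le> S2 \<Longrightarrow> w \<in> AW"
proof -
  assume w: "\<rho> < cmod w" "cmod w \<le> S2"
  then have "w \<noteq> 0" using rho_nonneg by auto
  then show ?thesis using PD_le_S2[of w] w by (simp add: AW_def)
qed

lemma AW_hol: "pn_psi n holomorphic_on AW" "Psi holomorphic_on AW" "deriv Psi holomorphic_on AW"
  and AW_inj: "inj_on Psi AW"
  by (auto simp: AW_def intro: holomorphic_on_subset[OF pn_psi_hol] holomorphic_on_subset[OF Psi_hol]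
     holomorphic_on_subset[OF deriv_Psi_hol] inj_on_subset[OF Psi_inj])

lemma cont_sphere_AW:
  assumes "\<rho> < r" "r \<le> S2" "0 < r"
  shows "continuous_on (sphere 0 r) (pn_psi n)" "continuous_on (sphere 0 r) Psi" "continuous_on (sphere 0 r) (deriv Psi)"
proof -
  have "sphere 0 r \<subseteq> AW" using assms by (auto intro!: AW_I)
  then show "continuous_on (sphere 0 r) (pn_psi n)" "continuous_on (sphere 0 r) Psi" "continuous_on (sphere 0 r) (deriv Psi)"
    using AW_hol[THEN holomorphic_on_imp_continuous_on] by (blast intro: continuous_on_subset)+
qed

text \<open>The Cauchy transform of p_n(\<psi>) \<psi>' in the variable \<open>Psi\<close>, written
  as a differential in v. It differs from \<open>pn_psi n\<close> by a term bounded uniformly in n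
  on |v| = S1 (\<open>sn_decomposition\<close>, \<open>Jn_bounded\<close>), but in contrast to it
  continues to the whole punctured disc.\<close>

definition sn :: "nat \<Rightarrow> complex \<Rightarrow> complex" where
  "sn n v = deriv Psi v * circ S2 (\<lambda>w. pn_psi n w / (Psi w - Psi v))"

text \<open>The value at 0 is the limit in \<open>Yn_tendsto_0\<close>, so the singularity there is
  removed.\<close>

definition Yn :: "nat \<Rightarrow> complex \<Rightarrow> complex" where
  "Yn n v = (if v = 0 then of_nat (Suc n) / of_real (an n) else sn n v / v ^ n)"

lemma moments_S2:
  "circ S2 (\<lambda>w. pn_psi n w * Psi w ^ k) = circ 1 (\<lambda>w. pn_psi n w * Psi w ^ k)"
  using radii rho_less_1
  by (intro circ_shift[symmetric, OF open_AW] holomorphic_on_mult holomorphic_on_power AW_hol AW_I) auto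

lemma Psi_notin_sphere: "v \<in> PD \<Longrightarrow> cmod v < S2 \<Longrightarrow> Psi v \<notin> Psi ` sphere 0 S2"
proof
  assume v: "v \<in> PD" "cmod v < S2" and "Psi v \<in> Psi ` sphere 0 S2"
  then obtain w where w: "cmod w = S2" "Psi v = Psi w" by auto
  moreover have "w \<in> PD" using w(1) radii by (intro PD_le_S2) auto
  ultimately have "v = w" using Psi_eq_iff[of v w] v(1) by blast
  then show False using w(1) v(2) by auto
qed

lemma sn_hol: "sn n holomorphic_on ball 0 S2 - {0}"
proof -
  have sub: "ball 0 S2 - {0} \<subseteq> PD"
  proof
    fix v :: complex assume "v \<in> ball 0 S2 - {0}"
    then show "v \<in> PD" by (intro PD_le_S2) auto
  qed
  have notin: "Psi v \<notin> Psi ` sphere 0 S2" if v: "v \<in> ball 0 S2 - {0}" for v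
  proof (rule Psi_notin_sphere)
    show "v \<in> PD" by (rule subsetD[OF sub v])
    show "cmod v < S2" using v unfolding Diff_iff mem_ball_0 by blast
  qed
  have im: "Psi ` (ball 0 S2 - {0}) \<subseteq> - Psi ` sphere 0 S2"
    by (rule image_subsetI, subst Compl_iff, rule notin)
  have T: "(\<lambda>y. circ S2 (\<lambda>w. pn_psi n w / (Psi w - y))) holomorphic_on - Psi ` sphere 0 S2"
    using radii rho_less_1 by (intro circ_transform_holomorphic cont_sphere_AW) auto
  have "((\<lambda>y. circ S2 (\<lambda>w. pn_psi n w / (Psi w - y))) \<circ> Psi) holomorphic_on ball 0 S2 - {0}"
    by (rule holomorphic_on_compose_gen[OF holomorphic_on_subset[OF Psi_hol sub] T im])
  then show ?thesis
    unfolding sn_def[abs_def] o_def by (intro holomorphic_on_mult holomorphic_on_subset[OF deriv_Psi_hol sub])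
qed

text \<open>The n + 1 vanishing moments yield 1 / Psi^(n+1), and the following moment, (n + 1) /
  \<open>kappa n\<close>, is minus the limit of \<open>T\<close> at infinity. As Psi behaves like
  cap / v and Psi' like - cap / v^2, the powers of v add up to exactly v^n and those of
  \<open>cap\<close> to cap^(-n-1).\<close>

lemma Yn_tendsto_0: "((\<lambda>v. sn n v / v ^ n) \<longlongrightarrow> of_nat (Suc n) / of_real (an n)) (at 0)"
proof -
  have cont: "continuous_on (sphere 0 S2) (pn_psi n)" "continuous_on (sphere 0 S2) Psi"
    using radii rho_less_1 by (auto intro!: cont_sphere_AW)
  define a where "a = (\<lambda>w. pn_psi n w * Psi w ^ Suc n)"
  have conta: "continuous_on (sphere 0 S2) a"
    unfolding a_def by (intro continuous_intros cont)
  have circa: "circ S2 a = of_nat (Suc n) / of_real (kappa n)"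
    unfolding a_def moments_S2 circ_Psi_moment_Suc ..
  define T where "T = (\<lambda>y. y * circ S2 (\<lambda>w. a w / (Psi w - y)))"
  have "(T \<longlongrightarrow> - circ S2 a) at_infinity"
    unfolding T_def by (intro circ_transform_at_infinity conta cont radii)
  from filterlim_compose[OF this Psi_at_infinity_0]
  have lim: "((\<lambda>v. T (Psi v)) \<longlongrightarrow> - (of_nat (Suc n) / of_real (kappa n))) (at 0)"
    unfolding circa .
  have "((\<lambda>v. (v\<^sup>2 * deriv Psi v) / (v * Psi v) ^ (n + 2) * T (Psi v)) \<longlongrightarrow>
     (- of_real cap) / of_real cap ^ (n + 2) * - (of_nat (Suc n) / of_real (kappa n))) (at 0)"
    using cap_pos by (intro tendsto_intros lim deriv_Psi_tendsto_0 Psi_tendsto_0) auto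
  moreover have "(- of_real cap) / of_real cap ^ (n + 2) * - (of_nat (Suc n) / of_real (kappa n)) = (of_nat (Suc n) / of_real (an n) :: complex)"
    using cap_pos kappa(1)[of n] by (simp add: an_def)
  moreover have "\<forall>\<^sub>F v in at 0. (v\<^sup>2 * deriv Psi v) / (v * Psi v) ^ (n + 2) * T (Psi v) = sn n v / v ^ n"
  proof -
    have 1: "\<forall>\<^sub>F v in at (0::complex). v \<noteq> 0" by (simp add: eventually_at_filter)
    have 2: "\<forall>\<^sub>F v in at (0::complex). v \<in> ball 0 S2"
      using radii by (intro eventually_at_in_open') auto
    have 3: "\<forall>\<^sub>F v in at 0. Psi v \<noteq> 0"
      using filterlim_compose[OF filterlim_ident Psi_at_infinity_0] eventually_not_equal_at_infinity[of "0::complex"]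
      by (auto simp: filterlim_iff)
    show ?thesis
      using 1 2 3
    proof eventually_elim
      case (elim v)
      have vPD: "v \<in> PD" using elim by (intro PD_le_S2) auto
      have notin: "Psi v \<notin> Psi ` sphere 0 S2"
        using Psi_notin_sphere[OF vPD] elim by simp
      have "circ S2 (\<lambda>w. pn_psi n w / (Psi w - Psi v)) = circ S2 (\<lambda>w. a w / (Psi w - Psi v)) / Psi v ^ Suc n"
        unfolding a_def
        by (rule circ_transform_moments[OF cont radii(8) notin])
          (use elim in \<open>auto simp: moments_S2 circ_Psi_moment_0\<close>)
      then have sn: "sn n v = deriv Psi v * T (Psi v) / Psi v ^ (n + 2)"
        using elim by (simp add: sn_def T_def)
      show ?case
        unfolding sn using elim by (simp add: power_mult_distrib power_add power2_eq_square)
    qed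
  qed
  ultimately show ?thesis
    by (auto intro: Lim_transform_eventually)
qed

lemma Yn_hol: "Yn n holomorphic_on ball 0 S2"
proof -
  have "(\<lambda>v. sn n v / v ^ n) holomorphic_on ball 0 S2 - {0}"
    by (intro holomorphic_on_divide sn_hol holomorphic_on_power holomorphic_on_ident) auto
  from removable_singularity[OF this open_ball Yn_tendsto_0]
  show ?thesis by (simp only: Yn_def[abs_def])
qed

lemma sn_eq_Yn: "v \<noteq> 0 \<Longrightarrow> sn n v = v ^ n * Yn n v"
  by (simp add: Yn_def)

lemma sn_any_radius:
  assumes "\<rho> < r" "r \<le> S2" "0 < r" "v \<noteq> 0" "cmod v < r"
  shows "sn n v = deriv Psi v * circ r (\<lambda>w. pn_psi n w / (Psi w - Psi v))"
proof -
  have vPD: "v \<in> PD" using assms by (intro PD_le_S2) auto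
  have "circ r (\<lambda>w. pn_psi n w / (Psi w - Psi v)) = circ S2 (\<lambda>w. pn_psi n w / (Psi w - Psi v))"
  proof (rule circ_shift[of "AW - {v}"])
    have "Psi w - Psi v \<noteq> 0" if "w \<in> AW - {v}" for w
      using Psi_eq_iff[of w v] vPD that by (auto simp: AW_def)
    then show "(\<lambda>w. pn_psi n w / (Psi w - Psi v)) holomorphic_on AW - {v}"
      by (intro holomorphic_on_divide holomorphic_on_diff holomorphic_on_const holomorphic_on_subset[OF AW_hol(1)]
        holomorphic_on_subset[OF AW_hol(2)]) auto
    fix w assume "r \<le> cmod w" "cmod w \<le> S2"
    then show "w \<in> AW - {v}" using assms by (auto intro!: AW_I)
  qed (use assms open_AW in auto)
  then show ?thesis by (simp add: sn_def)
qed

definition Jn :: "nat \<Rightarrow> complex \<Rightarrow> complex" where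
  "Jn n v = deriv Psi v * circ r1 (\<lambda>w. pn_psi n w / (Psi w - Psi v))"

text \<open>Moving the circle from radius S2 to r1 crosses the pole at w = v, whose residue is
  \<open>pn_psi n v / deriv Psi v\<close>.\<close>

lemma sn_decomposition:
  assumes "r1 < cmod v" "cmod v < S2"
  shows "sn n v = Jn n v + pn_psi n v"
proof -
  have v: "v \<in> PD" using assms radii by (intro PD_le_S2) auto
  have "circ S2 (\<lambda>w. pn_psi n w / (Psi w - Psi v)) - circ r1 (\<lambda>w. pn_psi n w / (Psi w - Psi v)) = pn_psi n v / deriv Psi v"
    using assms radii by (intro circ_kernel_residue[OF open_AW] AW_hol AW_inj AW_I) auto
  then have "circ S2 (\<lambda>w. pn_psi n w / (Psi w - Psi v)) = circ r1 (\<lambda>w. pn_psi n w / (Psi w - Psi v)) + pn_psi n v / deriv Psi v"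
    by (simp add: algebra_simps)
  then show ?thesis
    using deriv_Psi_nonzero[OF v] by (simp add: sn_def Jn_def distrib_left)
qed

text \<open>\<psi> maps |w| = r1 onto a compact subset of the interior of L, where the p_n are
  bounded uniformly in n. The rest of the integrand is continuous on a compact product.\<close>

lemma Jn_bounded: "\<exists>C\<ge>0. \<forall>n v. cmod v = S1 \<longrightarrow> cmod (Jn n v) \<le> C"
proof -
  let ?K = "sphere (0::complex) r1 \<times> sphere (0::complex) S1"
  define k where "k = (\<lambda>(w, v). deriv Psi v * deriv \<psi> w / (Psi w - Psi v))"
  have inAW: "sphere 0 r1 \<subseteq> AW" "sphere 0 S1 \<subseteq> AW"
    using radii rho_less_1 by (auto intro!: AW_I)
  have ne: "Psi w - Psi v \<noteq> 0" if "cmod w = r1" "cmod v = S1" for v w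
  proof -
    have "w \<in> PD" "v \<in> PD" using that inAW by (auto simp: AW_def)
    moreover have "w \<noteq> v" using that radii by auto
    ultimately show ?thesis using Psi_eq_iff[of w v] by simp
  qed
  have cont: "continuous_on (sphere 0 S1) Psi" "continuous_on (sphere 0 S1) (deriv Psi)" "continuous_on (sphere 0 r1) Psi"
    using radii rho_less_1 by (auto intro!: cont_sphere_AW)
  have contd: "continuous_on (sphere 0 r1) (deriv \<psi>)"
    by (rule continuous_on_subset[OF holomorphic_on_imp_continuous_on[OF deriv_psi_hol]]) (use radii in auto)
  have "continuous_on ?K k"
    unfolding k_def split_beta
    by (intro continuous_intros continuous_on_compose2[OF cont(1) continuous_on_snd[OF continuous_on_id]]
        continuous_on_compose2[OF cont(2) continuous_on_snd[OF continuous_on_id]]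
        continuous_on_compose2[OF cont(3) continuous_on_fst[OF continuous_on_id]]
        continuous_on_compose2[OF contd continuous_on_fst[OF continuous_on_id]]) (use ne in auto)
  then have "bounded (k ` ?K)"
    by (intro compact_imp_bounded compact_continuous_image compact_Times) auto
  then obtain B where B: "B > 0" "\<And>x. x \<in> ?K \<Longrightarrow> cmod (k x) \<le> B"
    unfolding bounded_pos by blast
  have contpsi: "continuous_on (sphere 0 r1) \<psi>"
    by (rule continuous_on_subset[OF holomorphic_on_imp_continuous_on[OF psi_hol]]) (use radii in auto)
  have "compact (\<psi> ` sphere 0 r1)" "\<psi> ` sphere 0 r1 \<subseteq> inside L"
    using contpsi radii psi_inside_iff by (auto intro!: compact_continuous_image)
  from pn_bounded_compact[OF this] obtain C where C: "C \<ge> 0" "\<And>n w. cmod w = r1 \<Longrightarrow> cmod (poly (p n) (\<psi> w)) \<le> C"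
    by auto
  have "cmod (Jn n v) \<le> r1 * (C * B)" if v: "cmod v = S1" for n v
  proof -
    have nz: "\<And>w. w \<in> sphere 0 r1 \<Longrightarrow> Psi w - Psi v \<noteq> 0" using ne[OF _ v] by auto
    have c1: "continuous_on (sphere 0 r1) (\<lambda>w. pn_psi n w / (Psi w - Psi v))"
      unfolding pn_psi_def using nz by (intro continuous_intros contpsi contd cont) auto
    have "Jn n v = circ r1 (\<lambda>w. deriv Psi v * (pn_psi n w / (Psi w - Psi v)))"
      unfolding Jn_def by (rule circ_cmult[symmetric, OF c1 radii(6)])
    also have "cmod \<dots> \<le> r1 * (C * B)"
    proof (rule circ_bound[OF _ radii(6)])
      show "continuous_on (sphere 0 r1) (\<lambda>w. deriv Psi v * (pn_psi n w / (Psi w - Psi v)))"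
        by (intro continuous_intros c1)
      fix w :: complex assume w: "cmod w = r1"
      have "deriv Psi v * (pn_psi n w / (Psi w - Psi v)) = poly (p n) (\<psi> w) * k (w, v)"
        by (simp add: k_def pn_psi_def)
      also have "cmod \<dots> \<le> C * B"
        unfolding norm_mult using C w v B by (intro mult_mono) auto
      finally show "cmod (deriv Psi v * (pn_psi n w / (Psi w - Psi v))) \<le> C * B" .
    qed
    finally show ?thesis .
  qed
  then show ?thesis
    using C(1) B(1) radii by (intro exI[of _ "r1 * (C * B)"]) auto
qed

text \<open>On |x| = S1 the function Y_n is the sum of \<open>pn_psi n x / x ^ n\<close> and
  \<open>Jn n x / x ^ n\<close>. In Cauchy's formula for Y_n(v) the first summand is evaluated at
  infinity and contributes exactly a_n; the second is O(S1^(-n)).\<close>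

lemma Yn_estimate: "\<exists>C\<ge>0. \<forall>n v. cmod v \<le> 1 \<longrightarrow> cmod (Yn n v - of_real (an n)) \<le> C / S1 ^ n"
proof -
  obtain C where C: "C \<ge> 0" "\<And>n v. cmod v = S1 \<Longrightarrow> cmod (Jn n v) \<le> C"
    using Jn_bounded by blast
  have "cmod (Yn n v - of_real (an n)) \<le> (S1 * C / (S1 - 1)) / S1 ^ n" if v: "cmod v \<le> 1" for n v
  proof -
    have xv: "x - v \<noteq> 0" if "1 < cmod x" for x using that v by auto
    have S1AW: "sphere 0 S1 \<subseteq> AW" using radii rho_less_1 by (auto intro!: AW_I)
    have contY: "continuous_on (sphere 0 S1) (\<lambda>x. Yn n x)"
      by (rule continuous_on_subset[OF holomorphic_on_imp_continuous_on[OF Yn_hol]]) (use radii in auto)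
    have contA: "continuous_on (sphere 0 S1) (\<lambda>x. pn_psi n x / x ^ n)"
      using radii rho_less_1 by (intro continuous_intros cont_sphere_AW) auto
    have contAv: "continuous_on (sphere 0 S1) (\<lambda>x. (pn_psi n x / x ^ n) / (x - v))"
      using xv radii by (intro continuous_on_divide contA continuous_intros) auto
    have contYv: "continuous_on (sphere 0 S1) (\<lambda>x. (Yn n x - pn_psi n x / x ^ n) / (x - v))"
      using xv radii by (intro continuous_on_divide continuous_on_diff contA contY continuous_intros) auto
    have "Yn n v = circ S1 (\<lambda>x. Yn n x / (x - v))"
      using radii v by (intro circ_Cauchy[symmetric, OF open_ball Yn_hol]) auto
    also have "\<dots> = circ S1 (\<lambda>x. (Yn n x - pn_psi n x / x ^ n) / (x - v) + (pn_psi n x / x ^ n) / (x - v))"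
      by (rule circ_cong) (simp_all add: radii diff_divide_distrib)
    also have "\<dots> = circ S1 (\<lambda>x. (Yn n x - pn_psi n x / x ^ n) / (x - v)) + circ S1 (\<lambda>x. (pn_psi n x / x ^ n) / (x - v))"
      by (rule circ_add[OF contYv contAv radii(9)])
    also have "circ S1 (\<lambda>x. (pn_psi n x / x ^ n) / (x - v)) = of_real (an n)"
    proof (rule circ_exterior[of _ 1])
      have sub: "{x. 1 < cmod x} \<subseteq> {w. \<rho> < cmod w}" using rho_less_1 by auto
      show "(\<lambda>x. pn_psi n x / x ^ n / (x - v)) holomorphic_on {x. 1 < cmod x}"
        using xv by (intro holomorphic_on_divide holomorphic_on_subset[OF pn_psi_hol sub] holomorphic_intros) auto
      have "((\<lambda>x. (pn_psi n x / x ^ n) * (1 / (1 - v / x))) \<longlongrightarrow> of_real (an n) * (1 / (1 - 0))) at_infinity"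
        by (intro tendsto_intros pn_psi_at_infinity tendsto_divide_0[OF tendsto_const] filterlim_ident) auto
      moreover have "\<forall>\<^sub>F x in at_infinity. (pn_psi n x / x ^ n) * (1 / (1 - v / x)) = x * (pn_psi n x / x ^ n / (x - v))"
        using eventually_not_equal_at_infinity[of "0::complex"]
      proof eventually_elim
        case (elim x)
        have "1 - v / x = (x - v) / x" using elim by (simp add: diff_divide_distrib)
        then show ?case by simp
      qed
      ultimately show "((\<lambda>x. x * (pn_psi n x / x ^ n / (x - v))) \<longlongrightarrow> of_real (an n)) at_infinity"
        by (auto intro: Lim_transform_eventually)
    qed (use radii in auto)
    finally have "Yn n v - of_real (an n) = circ S1 (\<lambda>x. (Yn n x - pn_psi n x / x ^ n) / (x - v))"
      by simp
    also have "cmod \<dots> \<le> S1 * (C / S1 ^ n / (S1 - 1))"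
    proof (rule circ_bound[OF contYv radii(9)])
      fix x :: complex assume x: "cmod x = S1"
      then have x0: "x \<noteq> 0" using radii by auto
      have "Yn n x - pn_psi n x / x ^ n = Jn n x / x ^ n"
        using sn_decomposition[of x n] x radii x0 by (simp add: Yn_def add_divide_distrib)
      then have "cmod (Yn n x - pn_psi n x / x ^ n) \<le> C / S1 ^ n"
        using C(2)[OF x, of n] x radii by (simp add: norm_divide norm_power divide_right_mono)
      moreover have "S1 - 1 \<le> cmod (x - v)"
        using norm_triangle_ineq2[of x v] x v by simp
      ultimately show "cmod ((Yn n x - pn_psi n x / x ^ n) / (x - v)) \<le> C / S1 ^ n / (S1 - 1)"
        unfolding norm_divide using radii C(1) by (intro frac_le) auto
    qed
    finally show ?thesis by (simp add: mult.commute)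
  qed
  moreover have "0 \<le> S1 * C / (S1 - 1)" using radii C(1) by simp
  ultimately show ?thesis by blast
qed

text \<open>At v = 0 the estimate of Y_n reads |(n + 1) / a_n - a_n| <= C. Distinguishing a_n >= 1
  from a_n < 1 gives either bound.\<close>

lemma an_bounds: "\<exists>c C. c > 0 \<and> C \<ge> 0 \<and> (\<forall>n. c \<le> an n \<and> an n \<le> real n + C)"
proof -
  obtain C where C: "C \<ge> 0" "\<And>n v. cmod v \<le> 1 \<Longrightarrow> cmod (Yn n v - of_real (an n)) \<le> C / S1 ^ n"
    using Yn_estimate by blast
  have diff: "\<bar>real (Suc n) / an n - an n\<bar> \<le> C" for n
  proof -
    have "Yn n 0 - of_real (an n) = of_real (real (Suc n) / an n - an n)"
      by (simp add: Yn_def)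
    then have "\<bar>real (Suc n) / an n - an n\<bar> \<le> C / S1 ^ n"
      using C(2)[of 0 n] by (simp only: norm_of_real norm_zero zero_le_one simp_thms)
    also have "\<dots> \<le> C / 1"
      using C(1) radii by (intro divide_left_mono) auto
    finally show ?thesis by simp
  qed
  have lower: "1 / (1 + C) \<le> an n" for n
  proof (cases "an n \<ge> 1")
    case True
    have "1 / (1 + C) \<le> 1" using C(1) by simp
    then show ?thesis using True by linarith
  next
    case False
    have "real (Suc n) / an n \<le> an n + C" using diff[of n] by linarith
    then have "real (Suc n) \<le> (an n + C) * an n" using an_pos[of n] by (simp add: field_simps)
    also have "\<dots> \<le> (1 + C) * an n" using False an_pos[of n] by (intro mult_right_mono) auto
    finally have "1 \<le> (1 + C) * an n" by simp
    then show ?thesis using C(1) by (simp add: field_simps)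
  qed
  have upper: "an n \<le> real n + (1 + C)" for n
  proof (cases "an n \<ge> 1")
    case True
    then have "real (Suc n) / an n \<le> real (Suc n) / 1" by (intro divide_left_mono) auto
    then show ?thesis using diff[of n] by simp
  qed (use C(1) in auto)
  show ?thesis
    using lower upper C(1) by (intro exI[of _ "1 / (1 + C)"] exI[of _ "1 + C"]) auto
qed

text \<open>On the unit circle \<open>1 / (h - \<phi>(z))\<close> is conjugate to a function of \<open>\<psi>\<close> holomorphic inside \<open>L\<close>.\<close>
lemma kernel_circle_0:
  assumes z: "z \<in> inside L" and w: "\<rho> < cmod w" "cmod w < 1"
  shows "circ 1 (\<lambda>v. deriv Psi v / (h v - \<phi> z) / (Psi w - Psi v)) = 0"
proof -
  define ws where "ws = 1 / cnj w"
  have w0: "w \<noteq> 0" using w rho_nonneg by auto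
  have ws: "1 < cmod ws" using w w0 by (simp add: ws_def norm_divide)
  \<comment> \<open>\<open>ws\<close> lies outside the circle, so \<psi>(ws) is not in the interior
    of L. The first quotient is chosen because |h| = 1 on the unit circle turns its conjugate into 1
    / (h - \<phi>(z)).\<close>
  define Q where "Q = (\<lambda>\<zeta>. \<phi> \<zeta> / (1 - cnj (\<phi> z) * \<phi> \<zeta>) / (\<psi> ws - \<zeta>))"
  define f1 where "f1 = (\<lambda>v. deriv \<psi> v * Q (\<psi> v))"
  have a1: "cmod (\<phi> z) < 1" by (rule phi_less_1[OF z])
  have den: "1 - cnj (\<phi> z) * u \<noteq> 0" if "cmod u \<le> 1" for u
  proof
    assume "1 - cnj (\<phi> z) * u = 0"
    then have "cmod (cnj (\<phi> z) * u) = 1" by (metis eq_iff_diff_eq_0 norm_one)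
    then have "cmod (\<phi> z) * cmod u = 1" by (simp add: norm_mult)
    moreover have "cmod (\<phi> z) * cmod u \<le> cmod (\<phi> z) * 1" using that by (intro mult_left_mono) auto
    ultimately show False using a1 by simp
  qed
  have psiws: "\<psi> ws \<notin> inside L \<union> L"
    using psi_outside[OF ws] curve_topology(10,11) by blast
  have Qhol: "Q holomorphic_on inside L"
    unfolding Q_def using den phi_less_1 psiws
    by (intro holomorphic_on_divide holomorphic_on_diff holomorphic_on_mult holomorphic_on_const holomorphic_on_ident phi_hol_inside)
      (auto intro: less_imp_le)
  define X where "X = {v \<in> W. (1 - cnj (\<phi> z) * h v) * (\<psi> ws - \<psi> v) \<noteq> 0}"
  have subW: "W \<subseteq> {w. \<rho> < cmod w}" using W_D by auto
  note hs = h_hol holomorphic_on_subset[OF psi_hol subW] holomorphic_on_subset[OF deriv_psi_hol subW]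
  have "open X"
  proof -
    have "continuous_on W (\<lambda>v. (1 - cnj (\<phi> z) * h v) * (\<psi> ws - \<psi> v))"
      by (intro continuous_intros holomorphic_on_imp_continuous_on[OF hs(1)] holomorphic_on_imp_continuous_on[OF hs(2)])
    from continuous_open_preimage[OF this open_W, of "- {0}"]
    have "open (W \<inter> (\<lambda>v. (1 - cnj (\<phi> z) * h v) * (\<psi> ws - \<psi> v)) -` (- {0}))" by auto
    moreover have "X = W \<inter> (\<lambda>v. (1 - cnj (\<phi> z) * h v) * (\<psi> ws - \<psi> v)) -` (- {0})"
      by (auto simp: X_def)
    ultimately show ?thesis by simp
  qed
  have XW: "X \<subseteq> W" by (auto simp: X_def)
  have "(\<lambda>v. deriv \<psi> v * (h v / (1 - cnj (\<phi> z) * h v) / (\<psi> ws - \<psi> v))) holomorphic_on X"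
    using hs[THEN holomorphic_on_subset[OF _ XW]]
    by (intro holomorphic_on_mult holomorphic_on_divide holomorphic_on_diff holomorphic_on_const) (auto simp: X_def)
  then have f1hol: "f1 holomorphic_on X"
    by (rule holomorphic_transform) (use XW in \<open>auto simp: f1_def Q_def h_eq_W subset_iff\<close>)
  have XI: "v \<in> X" if v: "\<rho> < cmod v" "cmod v \<le> 1" for v
  proof -
    have "cmod (h v) \<le> 1" using h_circle[of v] h_less_1[of v] v by (cases "cmod v = 1") auto
    moreover have "\<psi> v \<in> inside L \<union> L"
      using psi_inside_iff[OF v(1)] psi_circle v by (cases "cmod v = 1") auto
    ultimately show ?thesis
      using den psiws W_I[OF v] by (auto simp: X_def)
  qed
  have "circ r1 f1 = circ 1 f1"
    using radii by (intro circ_shift[OF \<open>open X\<close> f1hol] XI) auto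
  moreover have "circ r1 f1 = 0"
    unfolding f1_def using radii by (intro circ_psi_0[OF Qhol]) auto
  ultimately have f10: "circ 1 f1 = 0" by simp
  have contf1: "continuous_on (sphere 0 1) f1"
    using XI rho_less_1 by (intro continuous_on_subset[OF holomorphic_on_imp_continuous_on[OF f1hol]]) auto
  have "circ 1 (\<lambda>v. deriv Psi v / (h v - \<phi> z) / (Psi w - Psi v)) = circ 1 (\<lambda>v. (-1) * (cnj (f1 v) / v\<^sup>2))"
  proof (rule circ_cong)
    fix v :: complex assume v: "cmod v = 1"
    have vv: "v * cnj v = 1" using complex_norm_square[of v] v by simp
    then have v1: "1 / cnj v = v"
      by (metis nonzero_eq_divide_eq mult_zero_right zero_neq_one)
    have vW: "v \<in> W" using W_I[of v] v rho_less_1 by simp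
    have hv: "h v * cnj (h v) = 1" using complex_norm_square[of "h v"] h_circle[OF v] by simp
    have d: "deriv Psi v = - cnj (deriv \<psi> v) / v\<^sup>2"
      using deriv_Psi[of v] vW W_subset_PD v1 by auto
    have Psw: "Psi w = cnj (\<psi> ws)" by (simp add: Psi_def ws_def)
    have e: "cnj (h v) / (1 - \<phi> z * cnj (h v)) = 1 / (h v - \<phi> z)"
    proof -
      have "h v \<noteq> 0" using hv by auto
      then have "cnj (h v) = 1 / h v" using hv by (simp add: field_simps)
      moreover have "1 - \<phi> z * (1 / h v) = (h v - \<phi> z) / h v"
        using \<open>h v \<noteq> 0\<close> by (simp add: diff_divide_distrib)
      ultimately show ?thesis using \<open>h v \<noteq> 0\<close> by simp
    qed
    have "cnj (f1 v) = cnj (deriv \<psi> v) * (cnj (h v) / (1 - \<phi> z * cnj (h v)) / (Psi w - Psi v))"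
      unfolding f1_def Q_def Psw Psi_circle[OF v] h_eq_W[OF vW] by simp
    then have "cnj (f1 v) = cnj (deriv \<psi> v) * (1 / (h v - \<phi> z) / (Psi w - Psi v))"
      unfolding e .
    then show "deriv Psi v / (h v - \<phi> z) / (Psi w - Psi v) = (-1) * (cnj (f1 v) / v\<^sup>2)"
      unfolding d by simp
  qed simp
  also have "\<dots> = - circ 1 (\<lambda>v. cnj (f1 v) / v\<^sup>2)"
    using contf1 by (subst circ_cmult) (auto intro!: continuous_intros)
  also have "\<dots> = 0"
    by (simp add: circ_1_cnj[OF contf1] f10)
  finally show ?thesis .
qed

text \<open>Between the circle of radius r and the unit circle there is just the pole at v = w, and
  the integral over the unit circle vanishes by \<open>kernel_circle_0\<close>. Thus 1 / (h -
  \<phi>(z)) is reproduced by the Cauchy kernel in \<open>Psi\<close>.\<close>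

lemma kernel_formula:
  assumes z: "z \<in> inside L" and r0: "\<rho> \<le> r0" "\<And>w. r0 < cmod w \<Longrightarrow> \<psi> w \<noteq> z"
    and r: "r0 < r" "r < cmod w" "cmod w < 1"
  shows "circ r (\<lambda>v. deriv Psi v / (h v - \<phi> z) / (Psi w - Psi v)) = 1 / (h w - \<phi> z)"
proof -
  define X where "X = {v \<in> W. h v \<noteq> \<phi> z}"
  have "open X" unfolding X_def by (rule open_h_ne)
  have XI: "v \<in> X" if "r \<le> cmod v" "cmod v \<le> 1" for v
    using h_eq_phi_iff[of v z] W_I[of v] that r r0 z by (auto simp: X_def)
  have XPD: "X \<subseteq> PD" using W_subset_PD by (auto simp: X_def)
  have XW: "X \<subseteq> W" by (auto simp: X_def)
  have wX: "w \<in> X" using XI r by auto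
  have rr: "0 < r" using r0 r rho_nonneg by auto
  have hol: "(\<lambda>v. deriv Psi v / (h v - \<phi> z)) holomorphic_on X"
    by (intro holomorphic_on_divide holomorphic_on_diff holomorphic_on_const holomorphic_on_subset[OF deriv_Psi_hol XPD]
      holomorphic_on_subset[OF h_hol XW]) (auto simp: X_def)
  have "circ 1 (\<lambda>v. deriv Psi v / (h v - \<phi> z) / (Psi v - Psi w)) - circ r (\<lambda>v. deriv Psi v / (h v - \<phi> z) / (Psi v - Psi w))
      = deriv Psi w / (h w - \<phi> z) / deriv Psi w"
    by (rule circ_kernel_residue[OF \<open>open X\<close> XI hol holomorphic_on_subset[OF Psi_hol XPD] inj_on_subset[OF Psi_inj XPD] rr r(2,3)])
  also have "\<dots> = 1 / (h w - \<phi> z)"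
    using deriv_Psi_nonzero[of w] wX XPD by auto
  finally have eq: "circ 1 (\<lambda>v. deriv Psi v / (h v - \<phi> z) / (Psi v - Psi w)) - circ r (\<lambda>v. deriv Psi v / (h v - \<phi> z) / (Psi v - Psi w))
      = 1 / (h w - \<phi> z)" .
  have cont: "continuous_on (sphere 0 s) (\<lambda>v. deriv Psi v / (h v - \<phi> z) / (Psi v - Psi w))" if s: "s = r \<or> s = 1" for s
  proof -
    have sX: "sphere 0 s \<subseteq> X" using s r XI by auto
    have ne: "Psi v - Psi w \<noteq> 0" if "v \<in> sphere 0 s" for v
    proof -
      have "v \<in> PD" "w \<in> PD" using that sX XPD wX by blast+
      moreover have "v \<noteq> w" using that s r by auto
      ultimately show ?thesis using Psi_eq_iff[of v w] by simp
    qed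
    show ?thesis
      using ne by (intro continuous_intros continuous_on_subset[OF holomorphic_on_imp_continuous_on[OF hol] sX]
        continuous_on_subset[OF holomorphic_on_imp_continuous_on[OF holomorphic_on_subset[OF Psi_hol XPD]] sX]) auto
  qed
  have neg: "circ s (\<lambda>v. deriv Psi v / (h v - \<phi> z) / (Psi w - Psi v)) = - circ s (\<lambda>v. deriv Psi v / (h v - \<phi> z) / (Psi v - Psi w))"
    if s: "s = r \<or> s = 1" for s
  proof -
    have "circ s (\<lambda>v. deriv Psi v / (h v - \<phi> z) / (Psi w - Psi v)) = circ s (\<lambda>v. (-1) * (deriv Psi v / (h v - \<phi> z) / (Psi v - Psi w)))"
      using s rr by (intro circ_cong divide_diff_swap) auto
    also have "\<dots> = (-1) * circ s (\<lambda>v. deriv Psi v / (h v - \<phi> z) / (Psi v - Psi w))"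
      using s rr by (intro circ_cmult cont) auto
    finally show ?thesis by simp
  qed
  have "\<rho> < cmod w" using r0 r by simp
  then show ?thesis
    using eq neg[of r] neg[of 1] kernel_circle_0[OF z _ r(3)] by simp
qed

text \<open>Inserting \<open>kernel_formula\<close> into \<open>Cauchy_inside\<close> and exchanging
  the integrals leaves the transform \<open>sn\<close> as inner integral. The outer variable runs on
  a circle between r and 1, as the kernel formula demands, and orthogonality enters through the
  factor v^n of \<open>sn\<close>.\<close>

theorem pn_representation:
  assumes z: "z \<in> inside L" and r0: "\<rho> \<le> r0" "\<And>w. r0 < cmod w \<Longrightarrow> \<psi> w \<noteq> z" and r: "r0 < r" "r < 1"
  shows "poly (p n) z = deriv \<phi> z * circ r (\<lambda>v. v ^ n * Yn n v / (h v - \<phi> z))"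
proof -
  define r' where "r' = (r + 1) / 2"
  have rr: "r < r'" "r' < 1" "r0 < r'" "0 < r" "0 < r'" "\<rho> < r" "\<rho> < r'" "r' \<le> S2"
    using r r0 rho_nonneg radii by (auto simp: r'_def)
  have spW: "sphere 0 r \<subseteq> W" "sphere 0 r' \<subseteq> W" using rr r W_I by auto
  have spPD: "sphere 0 r \<subseteq> PD" "sphere 0 r' \<subseteq> PD" using spW W_subset_PD by auto
  have hz: "h v - \<phi> z \<noteq> 0" if "cmod v = r \<or> cmod v = r'" for v
    using h_eq_phi_iff[of v z] that rr r r0 z by auto
  have Pne: "Psi w - Psi v \<noteq> 0" if "cmod w = r'" "cmod v = r" for v w
  proof -
    have "w \<in> sphere 0 r'" "v \<in> sphere 0 r" using that by auto
    then have "v \<in> PD" "w \<in> PD" using spPD by blast+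
    moreover have "w \<noteq> v" using that rr by auto
    ultimately show ?thesis using Psi_eq_iff[of w v] by simp
  qed
  have contr: "continuous_on (sphere 0 r) (\<lambda>v. deriv Psi v / (h v - \<phi> z))" "continuous_on (sphere 0 r) Psi"
    "continuous_on (sphere 0 r') (pn_psi n)" "continuous_on (sphere 0 r') Psi"
    using hz rr radii r
    by (auto intro!: continuous_on_divide continuous_intros cont_sphere_AW
       continuous_on_subset[OF holomorphic_on_imp_continuous_on[OF h_hol] spW(1)])
  have contk: "continuous_on (sphere 0 r) (\<lambda>v. deriv Psi v / (h v - \<phi> z) / (Psi w - Psi v))" if "cmod w = r'" for w
    using Pne[OF that] by (intro continuous_on_divide contr continuous_intros) auto
  have "poly (p n) z = deriv \<phi> z * circ r' (\<lambda>w. poly (p n) (\<psi> w) * deriv \<psi> w / (h w - \<phi> z))"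
    by (rule Cauchy_inside[OF z _ r0(1) rr(3,2) r0(2)]) (auto intro: holomorphic_intros)
  also have "circ r' (\<lambda>w. poly (p n) (\<psi> w) * deriv \<psi> w / (h w - \<phi> z))
      = circ r' (\<lambda>w. circ r (\<lambda>v. pn_psi n w * (deriv Psi v / (h v - \<phi> z) / (Psi w - Psi v))))"
  proof (rule circ_cong)
    fix w :: complex assume w: "cmod w = r'"
    have "circ r (\<lambda>v. pn_psi n w * (deriv Psi v / (h v - \<phi> z) / (Psi w - Psi v)))
        = pn_psi n w * circ r (\<lambda>v. deriv Psi v / (h v - \<phi> z) / (Psi w - Psi v))"
      by (rule circ_cmult[OF contk[OF w] rr(4)])
    also have "circ r (\<lambda>v. deriv Psi v / (h v - \<phi> z) / (Psi w - Psi v)) = 1 / (h w - \<phi> z)"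
      by (rule kernel_formula[OF z r0 r(1)]) (use w rr in auto)
    finally show "poly (p n) (\<psi> w) * deriv \<psi> w / (h w - \<phi> z) = circ r (\<lambda>v. pn_psi n w * (deriv Psi v / (h v - \<phi> z) / (Psi w - Psi v)))"
      by (simp add: pn_psi_def)
  qed (rule rr)
  also have "\<dots> = circ r (\<lambda>v. circ r' (\<lambda>w. pn_psi n w * (deriv Psi v / (h v - \<phi> z) / (Psi w - Psi v))))"
  proof (rule circ_swap)
    show "continuous_on (sphere 0 r' \<times> sphere 0 r) (\<lambda>(w, v). pn_psi n w * (deriv Psi v / (h v - \<phi> z) / (Psi w - Psi v)))"
      unfolding split_beta
      by (intro continuous_on_mult continuous_on_divide continuous_on_diff
        continuous_on_compose2[OF contr(1) continuous_on_snd[OF continuous_on_id]]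
        continuous_on_compose2[OF contr(2) continuous_on_snd[OF continuous_on_id]]
        continuous_on_compose2[OF contr(3) continuous_on_fst[OF continuous_on_id]]
        continuous_on_compose2[OF contr(4) continuous_on_fst[OF continuous_on_id]]) (use Pne in auto)
  qed (rule rr)+
  also have "\<dots> = circ r (\<lambda>v. v ^ n * Yn n v / (h v - \<phi> z))"
  proof (rule circ_cong)
    fix v :: complex assume v: "cmod v = r"
    then have v0: "v \<noteq> 0" using rr by auto
    have "circ r' (\<lambda>w. pn_psi n w * (deriv Psi v / (h v - \<phi> z) / (Psi w - Psi v)))
       = circ r' (\<lambda>w. (deriv Psi v / (h v - \<phi> z)) * (pn_psi n w / (Psi w - Psi v)))"
      by (intro circ_cong rr) simp
    also have "\<dots> = (deriv Psi v / (h v - \<phi> z)) * circ r' (\<lambda>w. pn_psi n w / (Psi w - Psi v))"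
      using Pne[OF _ v] by (intro circ_cmult rr continuous_on_divide contr continuous_intros) auto
    also have "\<dots> = sn n v / (h v - \<phi> z)"
      using sn_any_radius[of r' v n] rr v v0 by simp
    finally show "circ r' (\<lambda>w. pn_psi n w * (deriv Psi v / (h v - \<phi> z) / (Psi w - Psi v))) = v ^ n * Yn n v / (h v - \<phi> z)"
      using sn_eq_Yn[OF v0] by simp
  qed (rule rr)
  finally show ?thesis .
qed

end

section \<open>Decay and analytic continuation\<close>

lemma taylor_coeff_bound:
  assumes "f holomorphic_on ball 0 R" "1 < R" "\<And>v. cmod v \<le> 1 \<Longrightarrow> cmod (f v) \<le> M"
  shows "cmod (taylor_coeff f m) \<le> M"
proof -
  have "cmod ((deriv ^^ m) f 0) \<le> fact m * M / 1 ^ m"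
  proof (rule Cauchy_inequality)
    show "f holomorphic_on ball 0 1"
      by (rule holomorphic_on_subset[OF assms(1)]) (use assms(2) in auto)
    show "continuous_on (cball 0 1) f"
      by (rule continuous_on_subset[OF holomorphic_on_imp_continuous_on[OF assms(1)]]) (use assms(2) in auto)
  qed (use assms(3) in auto)
  then show ?thesis
    by (simp add: taylor_coeff_def norm_divide field_simps)
qed

text \<open>Expanding f into its Taylor series reduces the integral to moments of H of order n and
  higher. The coefficients of f are at most M, and the moments sum up geometrically.\<close>

lemma circ_moment_functional_bound:
  assumes H: "continuous_on (sphere 0 r) H" and r: "0 < r" "r < 1"
    and k: "\<And>n. cmod (circ r (\<lambda>v. v ^ n * H v)) \<le> B * \<sigma> ^ n" and \<sigma>: "0 \<le> \<sigma>" "\<sigma> < 1"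
    and f: "f holomorphic_on ball 0 R" "1 < R" "\<And>v. cmod v \<le> 1 \<Longrightarrow> cmod (f v) \<le> M"
  shows "cmod (circ r (\<lambda>v. v ^ n * f v * H v)) \<le> M * B * \<sigma> ^ n / (1 - \<sigma>)"
proof -
  have "cmod (f 0) \<le> M" by (rule f(3)) simp
  then have M0: "0 \<le> M" by (rule order_trans[OF norm_ge_zero])
  have B0: "0 \<le> B" using order_trans[OF norm_ge_zero k[of 0]] by simp
  let ?S = "\<lambda>N v. \<Sum>m<N. taylor_coeff f m * v ^ m"
  have contf: "continuous_on (sphere 0 r) f"
    by (rule continuous_on_subset[OF holomorphic_on_imp_continuous_on[OF f(1)]]) (use r f(2) in auto)
  have lim: "(\<lambda>N. circ r (\<lambda>v. ?S N v * (v ^ n * H v))) \<longlonglongrightarrow> circ r (\<lambda>v. f v * (v ^ n * H v))"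
  proof (rule circ_uniform_limit[OF _ _ r(1)])
    have "uniform_limit (cball 0 r) ?S f sequentially"
      using r f(2) by (intro taylor_uniform_limit[OF f(1)]) simp
    then have "uniform_limit (sphere 0 r) ?S f sequentially"
      by (rule uniform_limit_on_subset) auto
    moreover have "bounded (f ` sphere 0 r)" "bounded ((\<lambda>v. v ^ n * H v) ` sphere 0 r)"
      by (intro compact_imp_bounded compact_continuous_image continuous_intros contf H; simp)+
    ultimately show "uniform_limit (sphere 0 r) (\<lambda>N v. ?S N v * (v ^ n * H v)) (\<lambda>v. f v * (v ^ n * H v)) sequentially"
      by (intro uniform_lim_mult uniform_limit_const)
    show "continuous_on (sphere 0 r) (\<lambda>v. ?S N v * (v ^ n * H v))" for N
      by (intro continuous_intros H)
  qed
  have "cmod (circ r (\<lambda>v. ?S N v * (v ^ n * H v))) \<le> M * B * \<sigma> ^ n / (1 - \<sigma>)" for N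
  proof -
    have "circ r (\<lambda>v. ?S N v * (v ^ n * H v)) = circ r (\<lambda>v. \<Sum>m<N. taylor_coeff f m * (v ^ (n + m) * H v))"
      by (intro circ_cong r) (simp add: sum_distrib_left sum_distrib_right power_add ac_simps)
    also have "\<dots> = (\<Sum>m<N. circ r (\<lambda>v. taylor_coeff f m * (v ^ (n + m) * H v)))"
      by (intro circ_sum continuous_intros H r) auto
    also have "\<dots> = (\<Sum>m<N. taylor_coeff f m * circ r (\<lambda>v. v ^ (n + m) * H v))"
      by (intro sum.cong refl circ_cmult continuous_intros H r)
    finally have "cmod (circ r (\<lambda>v. ?S N v * (v ^ n * H v))) = cmod (\<Sum>m<N. taylor_coeff f m * circ r (\<lambda>v. v ^ (n + m) * H v))"
      by simp
    also have "\<dots> \<le> (\<Sum>m<N. M * (B * \<sigma> ^ (n + m)))"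
    proof (rule sum_norm_le)
      fix m
      show "cmod (taylor_coeff f m * circ r (\<lambda>v. v ^ (n + m) * H v)) \<le> M * (B * \<sigma> ^ (n + m))"
        unfolding norm_mult using M0 by (intro mult_mono taylor_coeff_bound[OF f] k) auto
    qed
    also have "\<dots> = M * B * \<sigma> ^ n * (\<Sum>m<N. \<sigma> ^ m)"
      by (simp add: sum_distrib_left power_add ac_simps)
    also have "\<dots> \<le> M * B * \<sigma> ^ n * (1 / (1 - \<sigma>))"
    proof (intro mult_left_mono)
      have "(\<Sum>m<N. \<sigma> ^ m) \<le> (\<Sum>m. \<sigma> ^ m)"
        using \<sigma> by (intro sum_le_suminf) auto
      then show "(\<Sum>m<N. \<sigma> ^ m) \<le> 1 / (1 - \<sigma>)"
        using suminf_geometric[of \<sigma>] \<sigma> by simp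
    qed (use M0 B0 \<sigma> in auto)
    finally show ?thesis by simp
  qed
  then have "cmod (circ r (\<lambda>v. f v * (v ^ n * H v))) \<le> M * B * \<sigma> ^ n / (1 - \<sigma>)"
    by (intro LIMSEQ_le_const2[OF tendsto_norm[OF lim]]) auto
  then show ?thesis by (simp add: ac_simps)
qed

text \<open>The moments are the coefficients of the principal part of the Laurent series of H, so
  their decay makes that part converge for \<tau> < |w|. The regular part is the Cauchy integral
  over the outer circle.\<close>

lemma Laurent_extension:
  assumes S: "open S" "\<And>w. r \<le> cmod w \<Longrightarrow> cmod w \<le> r' \<Longrightarrow> w \<in> S" and H: "H holomorphic_on S"
    and r: "0 < r" "r < r'" and \<tau>: "0 < \<tau>"
    and k: "\<And>n. cmod (circ r (\<lambda>v. v ^ n * H v)) \<le> B * \<tau> ^ n"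
  obtains E where "E holomorphic_on {w. \<tau> < cmod w \<and> cmod w < r'}"
    "\<And>w. \<tau> < cmod w \<Longrightarrow> r < cmod w \<Longrightarrow> cmod w < r' \<Longrightarrow> E w = H w"
proof -
  define a where "a = (\<lambda>n. circ r (\<lambda>v. v ^ n * H v))"
  have sub: "sphere 0 r \<subseteq> S" "sphere 0 r' \<subseteq> S" using S(2) r by auto
  have cont: "continuous_on (sphere 0 r) H" "continuous_on (sphere 0 r') H"
    using continuous_on_subset[OF holomorphic_on_imp_continuous_on[OF H]] sub by blast+
  define G where "G = (\<lambda>x. \<Sum>n. a n * x ^ n)"
  have sums: "(\<lambda>n. a n * x ^ n) sums G x" if "cmod x < 1 / \<tau>" for x
  proof -
    have sm: "summable (\<lambda>n. B * (\<tau> * cmod x) ^ n)"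
      using that \<tau> by (intro summable_mult summable_geometric) (simp add: field_simps)
    have bd: "cmod (a n * x ^ n) \<le> B * (\<tau> * cmod x) ^ n" for n
      using mult_right_mono[OF k[of n], of "cmod x ^ n"]
      by (simp add: a_def norm_mult norm_power power_mult_distrib ac_simps)
    have "summable (\<lambda>n. a n * x ^ n)"
      by (rule summable_comparison_test'[OF sm, of 0]) (rule bd)
    then show ?thesis unfolding G_def by (rule summable_sums)
  qed
  have Ghol: "G holomorphic_on ball 0 (1 / \<tau>)"
    by (rule power_series_holomorphic[of _ _ a]) (use sums in simp)
  define E where "E = (\<lambda>w. circ r' (\<lambda>v. H v / (v - w)) + (1 / w) * G (1 / w))"
  show ?thesis
  proof (rule that)
    have "(\<lambda>w. circ r' (\<lambda>v. H v / (v - w))) holomorphic_on - (\<lambda>v. v) ` sphere 0 r'"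
      using r by (intro circ_transform_holomorphic cont continuous_on_id) auto
    then have 1: "(\<lambda>w. circ r' (\<lambda>v. H v / (v - w))) holomorphic_on {w. \<tau> < cmod w \<and> cmod w < r'}"
      by (rule holomorphic_on_subset) auto
    have "(G \<circ> (\<lambda>w. 1 / w)) holomorphic_on {w. \<tau> < cmod w \<and> cmod w < r'}"
    proof (rule holomorphic_on_compose_gen[OF _ Ghol])
      show "(\<lambda>w. 1 / w) holomorphic_on {w. \<tau> < cmod w \<and> cmod w < r'}"
        using \<tau> by (intro holomorphic_intros) auto
      show "(\<lambda>w. 1 / w) ` {w. \<tau> < cmod w \<and> cmod w < r'} \<subseteq> ball 0 (1 / \<tau>)"
        using \<tau> by (auto simp: norm_divide intro!: divide_strict_left_mono mult_pos_pos)
    qed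
    then have 2: "(\<lambda>w. G (1 / w)) holomorphic_on {w. \<tau> < cmod w \<and> cmod w < r'}" by (simp add: o_def)
    show "E holomorphic_on {w. \<tau> < cmod w \<and> cmod w < r'}"
      unfolding E_def using \<tau> by (intro holomorphic_on_add holomorphic_on_mult 1 2 holomorphic_on_divide holomorphic_on_const holomorphic_on_ident) auto
  next
    fix w assume w: "\<tau> < cmod w" "r < cmod w" "cmod w < r'"
    have w0: "w \<noteq> 0" using w r by auto
    have cw: "cmod w > 0" using w0 by simp
    have ne: "v \<noteq> w" if "cmod v = r" for v using that w by auto
    have "circ r' (\<lambda>v. H v / (v - w)) - circ r (\<lambda>v. H v / (v - w)) = H w / deriv (\<lambda>x. x) w"
      by (rule circ_kernel_residue[OF S H _ _ r(1) w(2,3), of "\<lambda>x. x"]) auto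
    then have eq: "H w = circ r' (\<lambda>v. H v / (v - w)) - circ r (\<lambda>v. H v / (v - w))" by simp
    have contq: "continuous_on (sphere 0 r) (\<lambda>v. H v / (v - w))"
      using ne cont by (intro continuous_intros) auto
    have bdd: "bounded ((\<lambda>v. H v / (v - w)) ` sphere 0 r)"
      by (intro compact_imp_bounded compact_continuous_image contq) auto
    then obtain M where M: "M > 0" "\<And>v. cmod v = r \<Longrightarrow> cmod (H v / (v - w)) \<le> M"
      unfolding bounded_pos by auto
    \<comment> \<open>The geometric sum in v/w identifies the remainder of the principal part, which
      tends to 0 because |v| = r < |w|.\<close>
    have part: "(\<Sum>n<N. a n * (1 / w) ^ n) * (1 / w) + circ r (\<lambda>v. H v / (v - w)) = circ r (\<lambda>v. (v / w) ^ N * (H v / (v - w)))" for N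
    proof -
      have "(\<Sum>n<N. a n * (1 / w) ^ n) * (1 / w) = (\<Sum>n<N. circ r (\<lambda>v. ((1 / w) ^ n * (1 / w)) * (v ^ n * H v)))"
        unfolding sum_distrib_right a_def
        by (intro sum.cong refl, subst circ_cmult) (auto intro!: continuous_intros cont r simp: ac_simps)
      also have "\<dots> = circ r (\<lambda>v. \<Sum>n<N. ((1 / w) ^ n * (1 / w)) * (v ^ n * H v))"
        by (intro circ_sum[symmetric] continuous_intros cont r) auto
      finally have e1: "(\<Sum>n<N. a n * (1 / w) ^ n) * (1 / w) = circ r (\<lambda>v. \<Sum>n<N. ((1 / w) ^ n * (1 / w)) * (v ^ n * H v))" .
      have "(\<Sum>n<N. a n * (1 / w) ^ n) * (1 / w) + circ r (\<lambda>v. H v / (v - w)) = circ r (\<lambda>v. \<Sum>n<N. ((1 / w) ^ n * (1 / w)) * (v ^ n * H v)) + circ r (\<lambda>v. H v / (v - w))"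
        by (simp only: e1)
      also have "\<dots> = circ r (\<lambda>v. (\<Sum>n<N. ((1 / w) ^ n * (1 / w)) * (v ^ n * H v)) + H v / (v - w))"
        by (intro circ_add[symmetric] continuous_intros cont contq r)
      also have "\<dots> = circ r (\<lambda>v. (v / w) ^ N * (H v / (v - w)))"
      proof (rule circ_cong[OF _ r(1)])
        fix v :: complex assume v: "cmod v = r"
        have vw: "v / w \<noteq> 1" "v - w \<noteq> 0" using ne[OF v] w0 by auto
        have "(\<Sum>n<N. ((1 / w) ^ n * (1 / w)) * (v ^ n * H v)) = (\<Sum>n<N. (v / w) ^ n) * (H v / w)"
          unfolding sum_distrib_right by (intro sum.cong refl) (simp add: power_divide)
        also have "(\<Sum>n<N. (v / w) ^ n) = ((v / w) ^ N - 1) / (v / w - 1)"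
          by (rule geometric_sum[OF vw(1)])
        also have "v / w - 1 = (v - w) / w" using w0 by (simp add: diff_divide_distrib)
        also have "((v / w) ^ N - 1) / ((v - w) / w) * (H v / w) = (v / w) ^ N * (H v / (v - w)) - H v / (v - w)"
          using w0 vw(2) by (simp add: left_diff_distrib diff_divide_distrib)
        finally show "(\<Sum>n<N. ((1 / w) ^ n * (1 / w)) * (v ^ n * H v)) + H v / (v - w) = (v / w) ^ N * (H v / (v - w))"
          by simp
      qed
      finally show ?thesis .
    qed
    have "(\<lambda>N. circ r (\<lambda>v. (v / w) ^ N * (H v / (v - w)))) \<longlonglongrightarrow> 0"
    proof (rule Lim_null_comparison)
      show "\<forall>\<^sub>F N in sequentially. cmod (circ r (\<lambda>v. (v / w) ^ N * (H v / (v - w)))) \<le> r * ((r / cmod w) ^ N * M)"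
      proof (rule always_eventually, rule allI, rule circ_bound[OF _ r(1)])
        fix N
        show "continuous_on (sphere 0 r) (\<lambda>v. (v / w) ^ N * (H v / (v - w)))"
          using w0 by (intro continuous_intros contq) auto
        fix v :: complex assume v: "cmod v = r"
        show "cmod ((v / w) ^ N * (H v / (v - w))) \<le> (r / cmod w) ^ N * M"
          unfolding norm_mult norm_power using v M r by (intro mult_mono) (auto simp: norm_divide)
      qed
      have "(\<lambda>N. r * ((r / cmod w) ^ N * M)) \<longlonglongrightarrow> r * (0 * M)"
        using r w cw by (intro tendsto_intros LIMSEQ_power_zero) (simp add: divide_less_eq)
      then show "(\<lambda>N. r * ((r / cmod w) ^ N * M)) \<longlonglongrightarrow> 0" by simp
    qed
    then have l1: "(\<lambda>N. (\<Sum>n<N. a n * (1 / w) ^ n) * (1 / w) + circ r (\<lambda>v. H v / (v - w))) \<longlonglongrightarrow> 0"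
      unfolding part .
    have "cmod (1 / w) < 1 / \<tau>"
      unfolding norm_divide norm_one using w(1) \<tau> cw by (intro divide_strict_left_mono) auto
    from sums[OF this] have "(\<lambda>N. (\<Sum>n<N. a n * (1 / w) ^ n) * (1 / w) + circ r (\<lambda>v. H v / (v - w))) \<longlonglongrightarrow>
        G (1 / w) * (1 / w) + circ r (\<lambda>v. H v / (v - w))"
      unfolding sums_def by (intro tendsto_intros)
    from LIMSEQ_unique[OF l1 this] have "G (1 / w) * (1 / w) = - circ r (\<lambda>v. H v / (v - w))"
      by (simp add: eq_neg_iff_add_eq_0)
    then show "E w = H w"
      unfolding E_def eq by (simp add: mult.commute)
  qed
qed

context carleman_setting
begin

text \<open>Bootstrap: as \<open>Y\<^sub>n - a\<^sub>n = O(S1\<^bsup>-n\<^esup>)\<close>, a rate \<open>\<sigma>\<close> for the moments improves to \<open>max \<tau> (\<sigma> / S1)\<close>.\<close>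
lemma kernel_coefficients_decay:
  assumes z: "z \<in> inside L" and r0: "\<rho> \<le> r0" "\<And>w. r0 < cmod w \<Longrightarrow> \<psi> w \<noteq> z" and r: "r0 < r" "r < 1"
    and \<tau>: "0 < \<tau>" "\<tau> < 1" and decay: "\<And>n. cmod (poly (p n) z) \<le> C * \<tau> ^ n"
  shows "\<exists>B. \<forall>n. cmod (circ r (\<lambda>v. v ^ n * (1 / (h v - \<phi> z)))) \<le> B * \<tau> ^ n"
proof -
  define H where "H = (\<lambda>v. 1 / (h v - \<phi> z))"
  define k where "k = (\<lambda>n. circ r (\<lambda>v. v ^ n * H v))"
  have rr: "0 < r" "\<rho> < r" using r r0 rho_nonneg by auto
  have spW: "sphere 0 r \<subseteq> W" using rr r W_I by auto
  have hz: "h v - \<phi> z \<noteq> 0" if "cmod v = r" for v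
    using h_eq_phi_iff[of v z] that rr r r0 z by auto
  have contH: "continuous_on (sphere 0 r) H"
    unfolding H_def using hz
    by (intro continuous_on_divide continuous_on_diff continuous_on_const
      continuous_on_subset[OF holomorphic_on_imp_continuous_on[OF h_hol] spW]) auto
  obtain C1 where C1: "C1 \<ge> 0" "\<And>n v. cmod v \<le> 1 \<Longrightarrow> cmod (Yn n v - of_real (an n)) \<le> C1 / S1 ^ n"
    using Yn_estimate by blast
  obtain c where c: "c > 0" "\<And>n. c \<le> an n"
    using an_bounds by blast
  have S1: "1 < S1" "0 < S1" by (rule radii)+
  have zN: "z \<in> N" using z inside_subset_N by auto
  define D where "D = cmod (deriv \<phi> z)"
  have D: "D > 0" using phi_deriv_nonzero[OF zN] by (simp add: D_def)
  have C0: "0 \<le> C" using order_trans[OF norm_ge_zero decay[of 0]] by simp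
  have contY: "continuous_on (sphere 0 r) (Yn n)" for n
    by (rule continuous_on_subset[OF holomorphic_on_imp_continuous_on[OF Yn_hol]]) (use radii r in auto)
  have rep: "of_real (an n) * k n = poly (p n) z / deriv \<phi> z - circ r (\<lambda>v. v ^ n * (Yn n v - of_real (an n)) * H v)" for n
  proof -
    have "poly (p n) z / deriv \<phi> z = circ r (\<lambda>v. v ^ n * Yn n v / (h v - \<phi> z))"
      using pn_representation[OF z r0 r, of n] D by (simp add: D_def)
    also have "\<dots> = circ r (\<lambda>v. of_real (an n) * (v ^ n * H v) + v ^ n * (Yn n v - of_real (an n)) * H v)"
      by (intro circ_cong rr) (simp add: H_def algebra_simps diff_divide_distrib)
    also have "\<dots> = circ r (\<lambda>v. of_real (an n) * (v ^ n * H v)) + circ r (\<lambda>v. v ^ n * (Yn n v - of_real (an n)) * H v)"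
      by (intro circ_add continuous_intros contH contY rr)
    also have "circ r (\<lambda>v. of_real (an n) * (v ^ n * H v)) = of_real (an n) * k n"
      unfolding k_def by (intro circ_cmult continuous_intros contH rr)
    finally show ?thesis by simp
  qed
  have step: "\<exists>B\<ge>0. \<forall>n. cmod (k n) \<le> B * (max \<tau> (\<sigma> / S1)) ^ n"
    if B: "B \<ge> 0" "\<And>n. cmod (k n) \<le> B * \<sigma> ^ n" and \<sigma>: "0 \<le> \<sigma>" "\<sigma> < 1" for B \<sigma>
  proof -
    define B' where "B' = (C / D + C1 * B / (1 - \<sigma>)) / c"
    let ?m = "max \<tau> (\<sigma> / S1)"
    have m0: "0 \<le> ?m" using \<tau> by simp
    have "cmod (k n) \<le> B' * ?m ^ n" for n
    proof -
      have e: "cmod (circ r (\<lambda>v. v ^ n * (Yn n v - of_real (an n)) * H v)) \<le> (C1 / S1 ^ n) * B * \<sigma> ^ n / (1 - \<sigma>)"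
        by (rule circ_moment_functional_bound[OF contH rr(1) r(2) _ \<sigma>, of _ _ S2])
          (use B(2) C1(2) radii in \<open>auto simp: k_def intro!: holomorphic_intros Yn_hol\<close>)
      have "c * cmod (k n) \<le> an n * cmod (k n)"
        by (intro mult_right_mono c) simp
      also have "\<dots> = cmod (poly (p n) z / deriv \<phi> z - circ r (\<lambda>v. v ^ n * (Yn n v - of_real (an n)) * H v))"
        using arg_cong[OF rep[of n], of cmod] an_pos[of n] by (simp add: norm_mult)
      also have "\<dots> \<le> cmod (poly (p n) z / deriv \<phi> z) + cmod (circ r (\<lambda>v. v ^ n * (Yn n v - of_real (an n)) * H v))"
        by (rule norm_triangle_ineq4)
      also have "\<dots> \<le> C * \<tau> ^ n / D + (C1 / S1 ^ n) * B * \<sigma> ^ n / (1 - \<sigma>)"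
        using e decay[of n] D by (intro add_mono) (auto simp: norm_divide D_def divide_right_mono)
      also have "\<dots> = C / D * \<tau> ^ n + C1 * B / (1 - \<sigma>) * (\<sigma> / S1) ^ n"
        by (simp add: power_divide)
      also have "\<dots> \<le> C / D * ?m ^ n + C1 * B / (1 - \<sigma>) * ?m ^ n"
        using C0 D C1(1) B(1) \<sigma> \<tau> S1 by (intro add_mono mult_left_mono power_mono) auto
      also have "\<dots> = c * (B' * ?m ^ n)"
        using c(1) by (simp add: B'_def distrib_right)
      finally show ?thesis using c(1) by simp
    qed
    moreover have "B' \<ge> 0"
      using C0 D C1(1) B(1) \<sigma> c(1) by (auto simp: B'_def)
    ultimately show ?thesis by blast
  qed
  have iter: "\<exists>B\<ge>0. \<forall>n. cmod (k n) \<le> B * (max \<tau> (r / S1 ^ j)) ^ n" for j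
  proof (induction j)
    case 0
    have "bounded (H ` sphere 0 r)"
      by (intro compact_imp_bounded compact_continuous_image contH) auto
    then obtain M where M: "M > 0" "\<And>v. cmod v = r \<Longrightarrow> cmod (H v) \<le> M"
      unfolding bounded_pos by auto
    have "cmod (k n) \<le> (r * M) * (max \<tau> (r / S1 ^ 0)) ^ n" for n
    proof -
      have "cmod (k n) \<le> r * (r ^ n * M)"
        unfolding k_def
      proof (rule circ_bound[OF _ rr(1)])
        show "continuous_on (sphere 0 r) (\<lambda>v. v ^ n * H v)"
          by (intro continuous_intros contH)
        fix v :: complex assume "cmod v = r"
        then show "cmod (v ^ n * H v) \<le> r ^ n * M"
          unfolding norm_mult norm_power using M rr by (intro mult_mono) auto
      qed
      also have "\<dots> \<le> r * ((max \<tau> (r / S1 ^ 0)) ^ n * M)"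
        using rr M by (intro mult_left_mono mult_right_mono power_mono) auto
      finally show ?thesis by (simp add: ac_simps)
    qed
    then show ?case using rr M by (intro exI[of _ "r * M"]) auto
  next
    case (Suc j)
    then obtain B where B: "B \<ge> 0" "\<And>n. cmod (k n) \<le> B * (max \<tau> (r / S1 ^ j)) ^ n" by blast
    have le1: "r / S1 ^ j \<le> r"
      using S1 rr(1) one_le_power[of S1 j] by (simp add: field_simps)
    obtain B' where B': "B' \<ge> 0" "\<And>n. cmod (k n) \<le> B' * (max \<tau> (max \<tau> (r / S1 ^ j) / S1)) ^ n"
      using step[OF B] le1 \<tau> r by fastforce
    have "max \<tau> (max \<tau> (r / S1 ^ j) / S1) \<le> max \<tau> (r / S1 ^ Suc j)"
    proof -
      have "\<tau> / S1 \<le> \<tau>" using S1 \<tau> by (simp add: field_simps)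
      moreover have eq: "r / S1 ^ Suc j = r / S1 ^ j / S1" by (simp add: mult.commute)
      ultimately show ?thesis unfolding eq by (auto simp: max_def)
    qed
    then have "cmod (k n) \<le> B' * (max \<tau> (r / S1 ^ Suc j)) ^ n" for n
      using B'(2)[of n] B'(1) \<tau> by (intro order_trans[OF B'(2)] mult_left_mono power_mono) auto
    then show ?case using B'(1) by blast
  qed
  obtain j where "r / \<tau> < S1 ^ j"
    using real_arch_pow[OF S1(1)] by blast
  then have "r / S1 ^ j \<le> \<tau>"
    using \<tau> S1 by (simp add: field_simps)
  then have "max \<tau> (r / S1 ^ j) = \<tau>" by simp
  then show ?thesis
    using iter[of j] unfolding k_def H_def by auto
qed

end

section \<open>Nicely meromorphic functions and their continuation\<close>

lemma nicely_meromorphic_on_local: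
  assumes "f nicely_meromorphic_on A" "x \<in> A" "open U" "x \<in> U" "\<And>y. y \<in> U \<Longrightarrow> g y = f y"
  shows "g nicely_meromorphic_on {x}"
proof -
  have ev: "\<forall>\<^sub>F y in at x. g y = f y"
    using eventually_at_in_open'[OF assms(3,4)] by eventually_elim (rule assms(5))
  have "g meromorphic_on {x} \<longleftrightarrow> f meromorphic_on {x}"
    by (rule meromorphic_on_cong) (use ev in auto)
  moreover have "f meromorphic_on {x}"
    using assms(1,2) by (auto simp: nicely_meromorphic_on_def intro: meromorphic_on_subset)
  moreover have "is_pole g x \<longleftrightarrow> is_pole f x"
    by (rule is_pole_cong[OF ev refl])
  moreover have "g \<midarrow>x\<rightarrow> g x \<longleftrightarrow> f \<midarrow>x\<rightarrow> f x"
    using assms(5)[OF assms(4)] tendsto_cong[OF ev, of "f x"] by simp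
  moreover have "(is_pole f x \<and> f x = 0) \<or> f \<midarrow>x\<rightarrow> f x"
    using assms(1,2) by (auto simp: nicely_meromorphic_on_def)
  ultimately show ?thesis
    using assms(5)[OF assms(4)] by (simp add: nicely_meromorphic_on_def)
qed

lemma nicely_meromorphic_on_pointwise:
  "(\<And>x. x \<in> A \<Longrightarrow> f nicely_meromorphic_on {x}) \<Longrightarrow> f nicely_meromorphic_on A"
  by (auto simp: nicely_meromorphic_on_def meromorphic_on_meromorphic_at[of f A])

text \<open>Both conventions put 0 at a pole, and elsewhere the value is the limit.\<close>

lemma nicely_meromorphic_remove_sings:
  assumes "f nicely_meromorphic_on A" "x \<in> A"
  shows "remove_sings f x = f x"
proof (cases "is_pole f x")
  case True
  have "f x = 0"
  proof (rule ccontr)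
    assume "f x \<noteq> 0"
    then have "f \<midarrow>x\<rightarrow> f x" using assms by (auto simp: nicely_meromorphic_on_def)
    then show False
      using True unfolding is_pole_def by (meson at_neq_bot not_tendsto_and_filterlim_at_infinity)
  qed
  then show ?thesis using True by simp
next
  case False
  then show ?thesis
    using assms by (intro remove_sings_eqI) (auto simp: nicely_meromorphic_on_def)
qed

text \<open>On a connected open set a meromorphic function either equals c or avoids it, up to a
  sparse set. Taking the value c on an open set rules out the second case.\<close>

lemma meromorphic_identity_const:
  assumes f: "f meromorphic_on A" and A: "open A" "connected A"
    and U: "open U" "U \<noteq> {}" "U \<subseteq> A" "\<And>w. w \<in> U \<Longrightarrow> f w = c" and x: "x \<in> A"
  shows "\<forall>\<^sub>F w in at x. f w = c"
proof -
  have "\<not> (\<forall>\<^sub>F w in cosparse A. f w \<noteq> c)"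
  proof
    assume ev: "\<forall>\<^sub>F w in cosparse A. f w \<noteq> c"
    obtain u where u: "u \<in> U" using U(2) by auto
    then have "\<forall>\<^sub>F w in at u. f w \<noteq> c"
      using ev U(3) by (auto simp: eventually_cosparse_open_eq[OF A(1)])
    moreover have "\<forall>\<^sub>F w in at u. w \<in> U"
      by (rule eventually_at_in_open'[OF U(1) u])
    ultimately have "\<forall>\<^sub>F w in at u. False"
      by eventually_elim (use U(4) in auto)
    then show False by simp
  qed
  then have "\<forall>\<^sub>F w in cosparse A. f w = c"
    using meromorphic_imp_constant_or_avoid[OF f A, of c] by blast
  then show ?thesis
    using x by (auto simp: eventually_cosparse_open_eq[OF A(1)])
qed

lemma meromorphic_reciprocal_identity:
  assumes h: "h meromorphic_on A" and E: "E holomorphic_on A" and A: "open A" "connected A"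
    and U: "open U" "U \<noteq> {}" "U \<subseteq> A" "\<And>w. w \<in> U \<Longrightarrow> (h w - c) * E w = 1" and x: "x \<in> A"
  shows "\<forall>\<^sub>F w in at x. (h w - c) * E w = 1"
proof (rule meromorphic_identity_const[OF _ A U x])
  have "E meromorphic_on A"
    using E A(1) by (auto intro!: analytic_on_imp_meromorphic_on simp: analytic_on_open)
  then show "(\<lambda>w. (h w - c) * E w) meromorphic_on A"
    using h by (intro meromorphic_intros)
qed

lemma connected_annulus_cmod: "connected {w::complex. a < cmod w \<and> cmod w < b}"
  using connected_annulus(1)[of a "0::complex" b] by simp

lemma open_annulus_cmod: "open {w::complex. a < cmod w \<and> cmod w < b}"
  by (intro open_Collect_conj open_Collect_less continuous_intros)

context carleman_setting
begin

lemma annulus_iff: "w \<in> annulus (ereal m) (1 / ereal \<rho>) \<longleftrightarrow> m < cmod w \<and> \<rho> * cmod w < 1"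
  by (auto simp: annulus_def less_inverse_rho_iff)

lemma open_annulus_rho: "open (annulus (ereal m) (1 / ereal \<rho>))"
proof -
  have "annulus (ereal m) (1 / ereal \<rho>) = {w. m < cmod w \<and> \<rho> * cmod w < 1}"
    using annulus_iff by blast
  then show ?thesis
    by (simp only:) (intro open_Collect_conj open_Collect_less continuous_intros)
qed

lemma rho_mult_less_1: "cmod w \<le> 1 \<Longrightarrow> \<rho> * cmod w < 1"
  using mult_left_mono[of "cmod w" 1 \<rho>] rho_nonneg rho_less_1 by simp

text \<open>\<phi> \<circ> \<psi> itself competes for the minimum. The point to check is niceness:
  by injectivity of \<psi> the poles of \<phi> pull back to poles, and the default value 0 is
  carried along.\<close>

lemma mu_le_rho: "\<mu> \<le> \<rho>"
proof (rule ccontr)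
  assume "\<not> \<mu> \<le> \<rho>"
  define A where "A = annulus (ereal \<rho>) (1 / ereal \<rho>)"
  define pts where "pts = {w \<in> A. is_pole \<phi> (\<psi> w)}"
  have A: "\<rho> < cmod w" "\<psi> w \<in> GR" if "w \<in> A" for w
    using that psi_in_GR by (auto simp: A_def annulus_iff)
  have ana: "\<psi> analytic_on {w}" if "w \<in> A" for w
    using holomorphic_on_imp_analytic_at[OF psi_hol open_region] A(1)[OF that] by simp
  have "(\<lambda>w. \<phi> (\<psi> w)) nicely_meromorphic_on A"
  proof (rule nicely_meromorphic_onI_open)
    show "open A" unfolding A_def by (rule open_annulus_rho)
    show "(\<lambda>w. \<phi> (\<psi> w)) analytic_on A - pts"
    proof (subst analytic_on_analytic_at, rule ballI)
      fix w assume w: "w \<in> A - pts"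
      then have "\<phi> analytic_on {\<psi> w}"
        using phi_mero A(2) by (intro nicely_meromorphic_on_imp_analytic_at) (auto simp: pts_def)
      then have "(\<phi> \<circ> \<psi>) analytic_on {w}"
        using ana[of w] w by (intro analytic_on_compose) auto
      then show "(\<lambda>w. \<phi> (\<psi> w)) analytic_on {w}" by (simp add: o_def)
    qed
    show "is_pole (\<lambda>w. \<phi> (\<psi> w)) w \<and> \<phi> (\<psi> w) = 0" if "w \<in> pts" for w
    proof
      have w: "w \<in> A" "is_pole \<phi> (\<psi> w)" using that by (auto simp: pts_def)
      show "is_pole (\<lambda>w. \<phi> (\<psi> w)) w"
      proof (rule is_pole_compose[OF w(2)])
        show "\<psi> \<midarrow>w\<rightarrow> \<psi> w"
          using psi_isCont[OF A(1)[OF w(1)]] by (simp add: isCont_def)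
        have "\<forall>\<^sub>F v in at w. v \<in> {v. \<rho> < cmod v} - {w}"
          using A(1)[OF w(1)] by (intro eventually_at_in_open open_region) auto
        then show "\<forall>\<^sub>F v in at w. \<psi> v \<noteq> \<psi> w"
          by eventually_elim (use psi_eq_iff A(1)[OF w(1)] in auto)
      qed
      show "\<phi> (\<psi> w) = 0"
        using nicely_meromorphic_remove_sings[OF phi_mero A(2)[OF w(1)]] w(2) by simp
    qed
    show "isolated_singularity_at (\<lambda>w. \<phi> (\<psi> w)) w" if "w \<in> A" for w
    proof (rule isolated_singularity_at_compose[OF _ ana[OF that]])
      have "\<phi> meromorphic_on {\<psi> w}"
        using phi_mero A(2)[OF that] by (auto simp: nicely_meromorphic_on_def intro: meromorphic_on_subset)
      then show "isolated_singularity_at \<phi> (\<psi> w)"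
        by (rule meromorphic_on_isolated_singularity)
    qed
  qed
  then have "meromorphic_continuation \<psi> \<phi> \<rho> \<rho> (\<lambda>w. \<phi> (\<psi> w))"
    by (simp add: meromorphic_continuation_def A_def)
  then show False
    using mu_minimal[OF rho_nonneg] \<open>\<not> \<mu> \<le> \<rho>\<close> by simp
qed

lemma solutions_iff: "w \<in> solutions \<phi> h \<mu> z \<longleftrightarrow> \<mu> < cmod w \<and> cmod w < 1 \<and> \<not> is_pole h w \<and> h w = \<phi> z"
  by (auto simp: solutions_def annulus_def sphere_val_def one_ereal_def)

text \<open>The decay extends 1 / (h - \<phi>(z)) to a holomorphic E on \<tau> < |w|. At a solution
  of modulus above \<tau> continuity would violate (h - \<phi>(z)) E = 1; and if \<tau> < \<mu>,
  then \<phi>(z) + 1/E would continue h below \<mu>.\<close>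

theorem decay_consequences:
  assumes z: "z \<in> inside L" and \<tau>: "0 < \<tau>" "\<tau> < 1"
    and decay: "\<And>n. cmod (poly (p n) z) \<le> C * \<tau> ^ n"
  shows "\<mu> \<le> \<tau>" "w \<in> solutions \<phi> h \<mu> z \<Longrightarrow> cmod w \<le> \<tau>"
proof -
  obtain r0 where r0: "\<rho> \<le> r0" "r0 < 1" "\<And>w. r0 < cmod w \<Longrightarrow> \<psi> w \<noteq> z"
    using critical_radius[OF z] by auto
  \<comment> \<open>The two radii lie at one third and two thirds of the way from \<open>r0\<close>
    to 1; on the closed ring between them \<open>H\<close> is holomorphic.\<close>
  define r where "r = (2 * r0 + 1) / 3"
  define r' where "r' = (r0 + 2) / 3"
  have r: "r0 < r" "r < 1" "0 < r" "r < r'" "r' < 1" "\<rho> < r"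
    using r0 rho_nonneg by (auto simp: r_def r'_def)
  define H where "H = (\<lambda>v. 1 / (h v - \<phi> z))"
  define X where "X = {v \<in> W. h v \<noteq> \<phi> z}"
  have "open X" unfolding X_def by (rule open_h_ne)
  have hz: "h v \<noteq> \<phi> z" if "r0 < cmod v" "cmod v \<le> 1" for v
    using h_eq_phi_iff[of v z] that r0 z by auto
  have XI: "v \<in> X" if "r \<le> cmod v" "cmod v \<le> r'" for v
    using hz[of v] W_I[of v] that r by (auto simp: X_def)
  have Hhol: "H holomorphic_on X"
    unfolding H_def
    by (intro holomorphic_on_divide holomorphic_on_diff holomorphic_on_const holomorphic_on_subset[OF h_hol]) (auto simp: X_def)
  obtain B where B: "\<And>n. cmod (circ r (\<lambda>v. v ^ n * H v)) \<le> B * \<tau> ^ n"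
    using kernel_coefficients_decay[OF z r0(1,3) r(1,2) \<tau> decay] unfolding H_def by blast
  obtain E where E: "E holomorphic_on {w. \<tau> < cmod w \<and> cmod w < r'}"
    "\<And>w. \<tau> < cmod w \<Longrightarrow> r < cmod w \<Longrightarrow> cmod w < r' \<Longrightarrow> E w = H w"
    using Laurent_extension[OF \<open>open X\<close> XI Hhol r(3,4) \<tau>(1) B] by blast
  \<comment> \<open>h is available beyond \<mu> and E beyond \<tau>. The identity theorem is applied
    on the common annulus, which is nonempty only if m < r'.\<close>
  define m where "m = max \<tau> \<mu>"
  define A where "A = {w::complex. m < cmod w \<and> cmod w < r'}"
  have m0: "0 \<le> m" using \<tau> by (simp add: m_def)
  have A: "open A" "connected A"
    unfolding A_def by (rule open_annulus_cmod, rule connected_annulus_cmod)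
  have hA: "h meromorphic_on A"
  proof (rule meromorphic_on_subset)
    show "h meromorphic_on annulus (ereal \<mu>) (1 / ereal \<rho>)"
      using h_mero by (simp add: nicely_meromorphic_on_def)
    show "A \<subseteq> annulus (ereal \<mu>) (1 / ereal \<rho>)"
      using rho_mult_less_1 r(5) by (auto simp: A_def m_def annulus_iff)
  qed
  have EA: "E holomorphic_on A"
    by (rule holomorphic_on_subset[OF E(1)]) (auto simp: A_def m_def)
  have ident: "\<forall>\<^sub>F w in at x. (h w - \<phi> z) * E w = 1" if x: "x \<in> A" "m < r'" for x
  proof (rule meromorphic_reciprocal_identity[OF hA EA A _ _ _ _ x(1)])
    define U where "U = {w::complex. max m r < cmod w \<and> cmod w < r'}"
    show "open U" unfolding U_def by (rule open_annulus_cmod)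
    show "U \<noteq> {}"
    proof -
      have "max m r < r'" using x(2) r by simp
      then obtain s where s: "max m r < s" "s < r'" using dense by blast
      then have "of_real s \<in> U" using m0 by (simp add: U_def)
      then show ?thesis by blast
    qed
    show "U \<subseteq> A" by (auto simp: U_def A_def)
    show "(h w - \<phi> z) * E w = 1" if "w \<in> U" for w
      using E(2)[of w] hz[of w] that r by (auto simp: U_def m_def H_def)
  qed
  show sol: "cmod w \<le> \<tau>" if "w \<in> solutions \<phi> h \<mu> z" for w
  proof (rule ccontr)
    assume "\<not> cmod w \<le> \<tau>"
    then have w: "\<tau> < cmod w" "\<mu> < cmod w" "cmod w < 1" "\<not> is_pole h w" "h w = \<phi> z"
      using that by (auto simp: solutions_iff)
    have "cmod w \<le> r0" using hz[of w] w by force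
    then have wA: "w \<in> A" "m < r'" using w r by (auto simp: A_def m_def)
    have "h \<midarrow>w\<rightarrow> h w"
      using h_mero w rho_mult_less_1[of w] by (auto simp: nicely_meromorphic_on_def annulus_iff)
    moreover have "E \<midarrow>w\<rightarrow> E w"
      using holomorphic_on_imp_continuous_on[OF EA] A(1) wA by (simp add: continuous_on_eq_continuous_at isCont_def)
    ultimately have "(\<lambda>w. (h w - \<phi> z) * E w) \<midarrow>w\<rightarrow> (h w - \<phi> z) * E w"
      by (intro tendsto_intros)
    moreover have "(\<lambda>w. (h w - \<phi> z) * E w) \<midarrow>w\<rightarrow> 1"
      by (rule tendsto_eventually[OF ident[OF wA]])
    ultimately show False
      using LIM_unique w(5) by fastforce
  qed
  show "\<mu> \<le> \<tau>"
  proof (rule ccontr)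
    assume "\<not> \<mu> \<le> \<tau>"
    then have m: "m = \<mu>" "\<tau> < \<mu>" by (auto simp: m_def)
    have mr: "\<mu> < r" using mu_le_rho r by simp
    have mr': "m < r'" using m mr r by simp
    define A' where "A' = {w::complex. \<tau> < cmod w \<and> cmod w < r'}"
    \<comment> \<open>E may vanish, namely at poles of h, so this function is only meromorphic.
      Applying \<open>remove_sings\<close> selects the nice representative, which can be glued to
      h.\<close>
    define N0 where "N0 = (\<lambda>w. inverse (E w) + \<phi> z)"
    have A': "open A'" unfolding A'_def by (rule open_annulus_cmod)
    have "E meromorphic_on A'"
      using E(1) A' by (auto intro!: analytic_on_imp_meromorphic_on simp: analytic_on_open A'_def)
    then have "N0 meromorphic_on A'"
      unfolding N0_def by (intro meromorphic_intros)
    then have N0: "remove_sings N0 nicely_meromorphic_on A'"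
      by (rule remove_sings_nicely_meromorphic)
    have N0_eq: "remove_sings N0 x = h x" if x: "x \<in> A" for x
    proof -
      have "\<forall>\<^sub>F w in at x. N0 w = h w"
        using ident[OF x mr']
      proof eventually_elim
        case (elim w)
        then have "inverse (E w) = h w - \<phi> z"
          by (metis inverse_unique mult.commute)
        then show ?case by (simp add: N0_def)
      qed
      then have "remove_sings N0 x = remove_sings h x"
        by (rule remove_sings_cong) simp
      also have "\<dots> = h x"
        using x m r rho_mult_less_1[of x] by (intro nicely_meromorphic_remove_sings[OF h_mero]) (auto simp: A_def annulus_iff)
      finally show ?thesis .
    qed
    define g where "g = (\<lambda>w. if \<mu> < cmod w then h w else remove_sings N0 w)"
    have "g nicely_meromorphic_on annulus (ereal \<tau>) (1 / ereal \<rho>)"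
    proof (rule nicely_meromorphic_on_pointwise)
      fix x assume "x \<in> annulus (ereal \<tau>) (1 / ereal \<rho>)"
      then have x: "\<tau> < cmod x" "\<rho> * cmod x < 1" by (auto simp: annulus_iff)
      show "g nicely_meromorphic_on {x}"
      proof (cases "\<mu> < cmod x")
        case True
        show ?thesis
          by (rule nicely_meromorphic_on_local[OF h_mero _ open_region[of \<mu>]])
            (use True x in \<open>auto simp: annulus_iff g_def\<close>)
      next
        case False
        then have xA': "x \<in> A'" using x mr r by (auto simp: A'_def)
        show ?thesis
        proof (rule nicely_meromorphic_on_local[OF N0 xA' A' xA'])
          fix y assume "y \<in> A'"
          then show "g y = remove_sings N0 y"
            using N0_eq[of y] m by (auto simp: g_def A_def A'_def)
        qed
      qed
    qed
    moreover have "g w = \<phi> (\<psi> w)" if "w \<in> annulus (ereal \<rho>) (1 / ereal \<rho>)" for w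
      using that mu_le_rho h_eq by (auto simp: g_def annulus_iff)
    ultimately have "meromorphic_continuation \<psi> \<phi> \<rho> \<tau> g"
      by (auto simp: meromorphic_continuation_def)
    then show False
      using mu_minimal[of \<tau> g] \<tau> m by simp
  qed
qed

end

section \<open>Root asymptotics\<close>

text \<open>The factor n + 1 stems from the linear bound on a_n. It is at most 2n for n > 0, and the
  nth root of that tends to 1.\<close>

lemma root_squeeze:
  assumes c: "0 < c" and C: "0 < C" and \<tau>: "0 \<le> \<tau>"
    and x: "\<forall>\<^sub>F n in sequentially. c * \<tau> ^ n \<le> x n" "\<And>n. x n \<le> C * (real n + 1) * \<tau> ^ n"
  shows "(\<lambda>n. root n (x n)) \<longlonglongrightarrow> \<tau>"
proof (rule tendsto_sandwich)
  show "(\<lambda>n. root n c * \<tau>) \<longlonglongrightarrow> \<tau>"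
    using tendsto_mult[OF LIMSEQ_root_const[OF c] tendsto_const[of \<tau>]] by simp
  show "(\<lambda>n. root n (2 * C) * root n n * \<tau>) \<longlonglongrightarrow> \<tau>"
    using tendsto_mult[OF tendsto_mult[OF LIMSEQ_root_const[of "2 * C"] LIMSEQ_root] tendsto_const[of \<tau>]] C by simp
  have rt: "root n (\<tau> ^ n) = \<tau>" if "n > 0" for n
    using that \<tau> by (rule real_root_power_cancel)
  show "\<forall>\<^sub>F n in sequentially. root n c * \<tau> \<le> root n (x n)"
    using x(1) eventually_gt_at_top[of 0]
  proof eventually_elim
    case (elim n)
    have "root n c * \<tau> = root n (c * \<tau> ^ n)"
      using elim by (simp add: real_root_mult rt)
    then show ?case using elim by (simp add: real_root_le_mono)
  qed
  show "\<forall>\<^sub>F n in sequentially. root n (x n) \<le> root n (2 * C) * root n n * \<tau>"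
    using eventually_gt_at_top[of 0]
  proof eventually_elim
    case (elim n)
    have "x n \<le> C * (real n + 1) * \<tau> ^ n" by (rule x(2))
    also have "\<dots> \<le> C * (2 * real n) * \<tau> ^ n"
      using C \<tau> elim by (intro mult_right_mono mult_left_mono) auto
    finally have "root n (x n) \<le> root n (2 * C * real n * \<tau> ^ n)"
      using elim by (intro real_root_le_mono) (auto simp: ac_simps)
    then show ?case using elim by (simp add: real_root_mult rt)
  qed
qed

context carleman_setting
begin

lemma h_analytic_at:
  assumes "\<mu> < cmod w" "cmod w \<le> 1" "\<not> is_pole h w"
  shows "h analytic_on {w}"
  using assms rho_mult_less_1 by (intro nicely_meromorphic_on_imp_analytic_at[OF h_mero]) (auto simp: annulus_iff)

text \<open>Solutions can be lost in the limit only at the inner circle |w| = \<mu>. A pole is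
  excluded because |\<phi>(z_n)| < 1, and the unit circle because |h| = 1 there while |\<phi>(z0)| <
  1.\<close>

lemma solution_limit:
  assumes z: "\<And>n. z n \<in> inside L" "z \<longlonglongrightarrow> z0" "z0 \<in> inside L"
    and w: "\<And>n. w n \<in> solutions \<phi> h \<mu> (z n)" "w \<longlonglongrightarrow> w0" and w0: "\<mu> < cmod w0"
  shows "w0 \<in> solutions \<phi> h \<mu> z0"
proof -
  have wn: "cmod (w n) < 1" "\<not> is_pole h (w n)" "h (w n) = \<phi> (z n)" for n
    using w(1)[of n] by (auto simp: solutions_iff)
  have le1: "cmod w0 \<le> 1"
    by (rule LIMSEQ_le_const2[OF tendsto_norm[OF w(2)]]) (use wn(1) in \<open>auto intro: less_imp_le\<close>)
  have np: "\<not> is_pole h w0"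
  proof
    assume pole: "is_pole h w0"
    then have "w n \<noteq> w0" for n using wn(2)[of n] by auto
    then have "filterlim w (at w0) sequentially"
      using w(2) by (auto simp: filterlim_at intro!: always_eventually)
    with pole have "filterlim (\<lambda>n. h (w n)) at_infinity sequentially"
      unfolding is_pole_def by (rule filterlim_compose)
    then have "\<forall>\<^sub>F n in sequentially. 1 \<le> cmod (h (w n))"
      unfolding filterlim_at_infinity_conv_norm_at_top filterlim_at_top by blast
    then obtain n where "1 \<le> cmod (h (w n))"
      using eventually_happens'[OF sequentially_bot] by blast
    then show False using wn(3)[of n] phi_less_1[OF z(1)[of n]] by simp
  qed
  have "h analytic_on {w0}"
    by (rule h_analytic_at[OF w0 le1 np])
  then have l1: "(\<lambda>n. h (w n)) \<longlonglongrightarrow> h w0"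
    by (rule isCont_tendsto_compose[OF analytic_at_imp_isCont w(2)])
  have "isCont \<phi> z0"
    using holomorphic_on_imp_continuous_on[OF phi_hol_inside] curve_topology(2) z(3)
    by (simp add: continuous_on_eq_continuous_at)
  then have l2: "(\<lambda>n. \<phi> (z n)) \<longlonglongrightarrow> \<phi> z0"
    by (rule isCont_tendsto_compose[OF _ z(2)])
  have eq: "h w0 = \<phi> z0"
    using LIMSEQ_unique[OF l1] l2 wn(3) by simp
  have "cmod w0 \<noteq> 1"
    using h_circle[of w0] eq phi_less_1[OF z(3)] by auto
  then show ?thesis
    using le1 w0 np eq by (simp add: solutions_iff)
qed

text \<open>At z0 the dominant solution is alone on its circle. By compactness, solutions for nearby
  z of almost that modulus are close to it, where h is injective because the solution is simple;
  inverting h there gives the branch.\<close>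

lemma local_branch:
  assumes z0: "z0 \<in> Sigma1_set L \<phi> h \<mu>"
  obtains V \<omega> r where "open V" "z0 \<in> V" "V \<subseteq> inside L" "\<omega> holomorphic_on V" "\<mu> < r"
    "\<And>z. z \<in> V \<Longrightarrow> r < cmod (\<omega> z)" "\<And>z. z \<in> V \<Longrightarrow> \<omega> z \<in> solutions \<phi> h \<mu> z"
    "\<And>z. z \<in> V \<Longrightarrow> deriv h (\<omega> z) \<noteq> 0"
    "\<And>z w. z \<in> V \<Longrightarrow> w \<in> solutions \<phi> h \<mu> z \<Longrightarrow> r \<le> cmod w \<Longrightarrow> w = \<omega> z"
proof -
  obtain \<omega>0 where z0G: "z0 \<in> inside L" and largest: "largest_solutions \<phi> h \<mu> z0 = {\<omega>0}" and d0: "deriv h \<omega>0 \<noteq> 0"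
    using z0 by (auto simp: Sigma1_set_def Sigma_set_def)
  have sol0: "\<omega>0 \<in> solutions \<phi> h \<mu> z0" and max0: "\<And>w. w \<in> solutions \<phi> h \<mu> z0 \<Longrightarrow> cmod w \<le> cmod \<omega>0"
    using largest by (auto simp: largest_solutions_def)
  have \<omega>0: "\<mu> < cmod \<omega>0" "cmod \<omega>0 < 1" "\<not> is_pole h \<omega>0" "h \<omega>0 = \<phi> z0"
    using sol0 by (auto simp: solutions_iff)
  have "h analytic_on {\<omega>0}"
    using \<omega>0 by (intro h_analytic_at) auto
  then obtain X0 where X0: "open X0" "\<omega>0 \<in> X0" "h holomorphic_on X0" by (auto simp: analytic_at)
  define X where "X = X0 \<inter> {w. \<mu> < cmod w \<and> cmod w < 1}"
  have X: "open X" "\<omega>0 \<in> X" "h holomorphic_on X"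
    using X0 \<omega>0 open_annulus_cmod by (auto simp: X_def intro: holomorphic_on_subset)
  obtain \<delta> where \<delta>: "\<delta> > 0" "ball \<omega>0 \<delta> \<subseteq> X" "inj_on h (ball \<omega>0 \<delta>)"
    using has_complex_derivative_locally_injective[OF X(3,2,1) d0] by metis
  define B where "B = ball \<omega>0 \<delta>"
  have hB: "h holomorphic_on B" using holomorphic_on_subset[OF X(3) \<delta>(2)] by (simp add: B_def)
  have npB: "\<not> is_pole h w" "\<mu> < cmod w" "cmod w < 1" if "w \<in> B" for w
  proof -
    have wX: "w \<in> X" using subsetD[OF \<delta>(2)] that by (simp add: B_def)
    show "\<not> is_pole h w" by (rule not_is_pole_holomorphic[OF X(1) wX X(3)])
    show "\<mu> < cmod w" "cmod w < 1" using wX by (auto simp: X_def)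
  qed
  \<comment> \<open>Otherwise solutions outside \<open>B\<close> would accumulate at a solution for
    \<open>z0\<close> of modulus at least that of \<open>\<omega>0\<close>, which can only be
    \<open>\<omega>0\<close> itself.\<close>
  have "\<exists>n. \<forall>z w. z \<in> inside L \<and> dist z z0 < 1 / real (Suc n) \<and> w \<in> solutions \<phi> h \<mu> z \<and>
      cmod \<omega>0 - 1 / real (Suc n) \<le> cmod w \<longrightarrow> w \<in> B"
  proof (rule ccontr)
    assume "\<not> ?thesis"
    then have "\<forall>n. \<exists>z w. z \<in> inside L \<and> dist z z0 < 1 / real (Suc n) \<and> w \<in> solutions \<phi> h \<mu> z \<and>
      cmod \<omega>0 - 1 / real (Suc n) \<le> cmod w \<and> w \<notin> B" by blast
    then obtain z w where zw: "\<And>n. z n \<in> inside L" "\<And>n. dist (z n) z0 < 1 / real (Suc n)"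
      "\<And>n. w n \<in> solutions \<phi> h \<mu> (z n)" "\<And>n. cmod \<omega>0 - 1 / real (Suc n) \<le> cmod (w n)" "\<And>n. w n \<notin> B"
      by metis
    have inv: "(\<lambda>n. 1 / real (Suc n)) \<longlonglongrightarrow> 0"
      using LIMSEQ_Suc[OF lim_1_over_n[where ?'a = real]] by simp
    have zlim: "z \<longlonglongrightarrow> z0"
      by (rule metric_tendsto_imp_tendsto[OF inv]) (use zw(2) in \<open>auto intro!: always_eventually less_imp_le\<close>)
    have "\<forall>n. w n \<in> cball 0 1"
      using zw(3) by (auto simp: solutions_iff intro: less_imp_le)
    then obtain w0 s where s: "strict_mono (s :: nat \<Rightarrow> nat)" "(w \<circ> s) \<longlonglongrightarrow> w0"
      using compact_cball[of 0 1] unfolding compact_def by metis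
    have ge: "cmod \<omega>0 \<le> cmod w0"
    proof (rule LIMSEQ_le)
      show "(\<lambda>n. cmod ((w \<circ> s) n)) \<longlonglongrightarrow> cmod w0" by (rule tendsto_norm[OF s(2)])
      have "((\<lambda>n. 1 / real (Suc n)) \<circ> s) \<longlonglongrightarrow> 0"
        by (rule LIMSEQ_subseq_LIMSEQ[OF inv s(1)])
      from tendsto_diff[OF tendsto_const[of "cmod \<omega>0"] this]
      show "(\<lambda>n. cmod \<omega>0 - 1 / real (Suc (s n))) \<longlonglongrightarrow> cmod \<omega>0" by (simp add: o_def)
      show "\<exists>N. \<forall>n\<ge>N. cmod \<omega>0 - 1 / real (Suc (s n)) \<le> cmod ((w \<circ> s) n)"
        using zw(4) by auto
    qed
    have "w0 \<in> solutions \<phi> h \<mu> z0"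
      by (rule solution_limit[OF _ LIMSEQ_subseq_LIMSEQ[OF zlim s(1)] z0G _ s(2)])
        (use zw(1,3) ge \<omega>0(1) in auto)
    then have "w0 \<in> largest_solutions \<phi> h \<mu> z0"
      using max0 ge by (auto simp: largest_solutions_def intro: order_trans)
    then have "w0 = \<omega>0" using largest by simp
    then have "w0 \<in> B" using \<delta>(1) by (simp add: B_def)
    then have "\<forall>\<^sub>F n in sequentially. (w \<circ> s) n \<in> B"
      using topological_tendstoD[OF s(2), of B] by (simp add: B_def)
    then show False
      using eventually_happens'[OF sequentially_bot] zw(5) by force
  qed
  then obtain n where n: "\<And>z w. z \<in> inside L \<Longrightarrow> dist z z0 < 1 / real (Suc n) \<Longrightarrow> w \<in> solutions \<phi> h \<mu> z \<Longrightarrow>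
      cmod \<omega>0 - 1 / real (Suc n) \<le> cmod w \<Longrightarrow> w \<in> B" by blast
  define \<epsilon> where "\<epsilon> = 1 / real (Suc n)"
  have \<epsilon>: "\<epsilon> > 0" by (simp add: \<epsilon>_def)
  \<comment> \<open>The first term keeps the tolerance just found, the second keeps \<open>r\<close>
    above \<mu>.\<close>
  define r where "r = max (cmod \<omega>0 - \<epsilon>) ((\<mu> + cmod \<omega>0) / 2)"
  have r: "\<mu> < r" "r < cmod \<omega>0" "cmod \<omega>0 - \<epsilon> \<le> r"
    using \<omega>0(1) \<epsilon> by (simp_all add: r_def less_max_iff_disj)
  define B' where "B' = B \<inter> {w. r < cmod w}"
  have B': "open B'" "B' \<subseteq> B" "\<omega>0 \<in> B'"
    using open_region[of r] r \<delta>(1) by (auto simp: B'_def B_def)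
  have hB': "h holomorphic_on B'" "inj_on h B'"
    using holomorphic_on_subset[OF hB B'(2)] inj_on_subset[OF \<delta>(3)] B'(2) by (auto simp: B_def)
  obtain k where k: "k holomorphic_on h ` B'" "\<And>w. w \<in> B' \<Longrightarrow> k (h w) = w"
    using holomorphic_has_inverse[OF hB'(1) B'(1) hB'(2)] by metis
  have ohB: "open (h ` B')" by (rule open_mapping_thm3[OF hB'(1) B'(1) hB'(2)])
  define V where "V = (inside L \<inter> \<phi> -` (h ` B')) \<inter> ball z0 \<epsilon>"
  define \<omega> where "\<omega> = (\<lambda>z. k (\<phi> z))"
  have \<omega>V: "\<omega> z \<in> B' \<and> h (\<omega> z) = \<phi> z" if "z \<in> V" for z
    using that k(2) by (auto simp: V_def \<omega>_def)
  show ?thesis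
  proof (rule that[of V \<omega> r])
    show "open V"
      unfolding V_def
      by (intro open_Int continuous_open_preimage[OF holomorphic_on_imp_continuous_on[OF phi_hol_inside] curve_topology(2) ohB]) auto
    show "z0 \<in> V" using z0G \<omega>0(4) B'(3) \<epsilon> by (auto simp: V_def intro!: image_eqI[of _ h \<omega>0])
    show VG: "V \<subseteq> inside L" by (auto simp: V_def)
    have "(k \<circ> \<phi>) holomorphic_on V"
      by (rule holomorphic_on_compose_gen[OF holomorphic_on_subset[OF phi_hol_inside VG] k(1)]) (auto simp: V_def)
    then show "\<omega> holomorphic_on V" by (simp add: \<omega>_def o_def)
    show "\<mu> < r" by (rule r)
    show "r < cmod (\<omega> z)" if "z \<in> V" for z
      using \<omega>V[OF that] by (auto simp: B'_def)
    show "\<omega> z \<in> solutions \<phi> h \<mu> z" if "z \<in> V" for z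
      using \<omega>V[OF that] npB[of "\<omega> z"] B'(2) by (auto simp: solutions_iff)
    show "deriv h (\<omega> z) \<noteq> 0" if "z \<in> V" for z
      using holomorphic_injective_imp_regular[OF hB'(1) B'(1) hB'(2)] \<omega>V[OF that] by blast
    show "w = \<omega> z" if "z \<in> V" "w \<in> solutions \<phi> h \<mu> z" "r \<le> cmod w" for z w
    proof -
      have "w \<in> B"
        by (rule n[of z]) (use that r(3) in \<open>auto simp: V_def \<epsilon>_def dist_commute\<close>)
      moreover have "h w = h (\<omega> z)"
        using that(2) \<omega>V[OF that(1)] by (simp add: solutions_iff)
      ultimately show ?thesis
        using \<delta>(3) \<omega>V[OF that(1)] B'(2) unfolding B_def inj_on_def by blast
    qed
  qed
qed

text \<open>Shrinking the circle of \<open>pn_representation\<close> to radius s picks up the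
  residue at \<omega> and nothing else. It has the size a_n |\<omega>|^n up to constant factors,
  while the remaining integral is O(n s^n).\<close>

lemma pn_asymptotics:
  assumes z: "z \<in> inside L" and sol: "\<omega> \<in> solutions \<phi> h \<mu> z" and d: "deriv h \<omega> \<noteq> 0"
    and s: "\<mu> < s" "s < cmod \<omega>" and unique: "\<And>w. w \<in> solutions \<phi> h \<mu> z \<Longrightarrow> s \<le> cmod w \<Longrightarrow> w = \<omega>"
  shows "(\<lambda>n. root n (cmod (poly (p n) z))) \<longlonglongrightarrow> cmod \<omega>"
proof -
  have \<omega>: "\<mu> < cmod \<omega>" "cmod \<omega> < 1" "\<not> is_pole h \<omega>" "h \<omega> = \<phi> z"
    using sol by (auto simp: solutions_iff)
  have s0: "0 < s" using s mu_nonneg by simp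
  obtain r0 where r0: "\<rho> \<le> r0" "r0 < 1" "\<And>w. r0 < cmod w \<Longrightarrow> \<psi> w \<noteq> z"
    using critical_radius[OF z] by auto
  define r where "r = (max r0 (cmod \<omega>) + 1) / 2"
  have r: "r0 < r" "r < 1" "cmod \<omega> < r" "0 < r" "\<rho> < r"
    using r0 \<omega> rho_nonneg by (auto simp: r_def)
  define f where "f = (\<lambda>w. 1 / (h w - \<phi> z))"
  \<comment> \<open>At a pole of h the default value 0 gives \<open>f\<close> a wrong value, whereas
    its limit there is 0; \<open>remove_sings\<close> corrects this.\<close>
  define H where "H = remove_sings f"
  have fmero: "f meromorphic_on annulus (ereal \<mu>) (1 / ereal \<rho>)"
    unfolding f_def using h_mero by (intro meromorphic_intros) (auto simp: nicely_meromorphic_on_def)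
  have fiso: "isolated_singularity_at f w" if "\<mu> < cmod w" "cmod w \<le> 1" for w
    by (rule meromorphic_on_isolated_singularity[OF meromorphic_on_subset[OF fmero]])
      (use that rho_mult_less_1 in \<open>auto simp: annulus_iff\<close>)
  have fan: "f analytic_on {w}" if "\<mu> < cmod w" "cmod w \<le> 1" "\<not> is_pole h w" "h w \<noteq> \<phi> z" for w
    unfolding f_def using that by (intro analytic_intros h_analytic_at) auto
  have Han: "H analytic_on {w}" if w: "\<mu> < cmod w" "cmod w \<le> 1" "w \<notin> solutions \<phi> h \<mu> z" for w
  proof (cases "is_pole h w")
    case True
    have "is_pole (\<lambda>w. h w - \<phi> z) w"
      using True is_pole_plus_const_iff[of h w "- \<phi> z"] by simp
    then have "f \<midarrow>w\<rightarrow> 0"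
      unfolding f_def is_pole_def by (intro tendsto_divide_0[OF tendsto_const])
    then show ?thesis
      unfolding H_def by (rule remove_sings_analytic_at[OF fiso[OF w(1,2)]])
  next
    case False
    have "h w \<noteq> \<phi> z"
    proof
      assume "h w = \<phi> z"
      then have "cmod w \<noteq> 1" using h_circle[of w] phi_less_1[OF z] by auto
      then show False using w False \<open>h w = \<phi> z\<close> by (auto simp: solutions_iff)
    qed
    then have "f analytic_on {w}" using fan[of w] w False by simp
    then show ?thesis
      unfolding H_def using fiso[OF w(1,2)] by (intro remove_sings_analytic_at[of f w "f w"]) (auto simp: analytic_at_imp_isCont isContD)
  qed
  define S where "S = {w. H analytic_on {w}} \<union> {\<omega>}"
  have "open S"
  proof -
    have "isolated_singularity_at H \<omega>"
      unfolding H_def using fiso[of \<omega>] \<omega> by simp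
    then obtain e where e: "e > 0" "H analytic_on ball \<omega> e - {\<omega>}"
      by (auto simp: isolated_singularity_at_def)
    then have "ball \<omega> e - {\<omega>} \<subseteq> {w. H analytic_on {w}}"
      using analytic_on_subset by blast
    then have "S = {w. H analytic_on {w}} \<union> ball \<omega> e"
      using e(1) by (auto simp: S_def)
    then show ?thesis using open_analytic_points[of H] by auto
  qed
  have SI: "w \<in> S" if "s \<le> cmod w" "cmod w \<le> r" for w
    using Han[of w] unique[of w] that r s by (cases "w \<in> solutions \<phi> h \<mu> z") (auto simp: S_def)
  have Hhol: "H holomorphic_on S - {\<omega>}"
    by (rule analytic_imp_holomorphic) (subst analytic_on_analytic_at, auto simp: S_def)
  have Hlim: "(\<lambda>w. (w - \<omega>) * H w) \<midarrow>\<omega>\<rightarrow> 1 / deriv h \<omega>"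
  proof -
    have "(h has_field_derivative deriv h \<omega>) (at \<omega>)"
      using h_analytic_at[of \<omega>] \<omega> by (intro analytic_derivI) auto
    then have "(\<lambda>w. (h w - h \<omega>) / (w - \<omega>)) \<midarrow>\<omega>\<rightarrow> deriv h \<omega>"
      by (simp add: has_field_derivative_iff)
    then have l: "(\<lambda>w. 1 / ((h w - h \<omega>) / (w - \<omega>))) \<midarrow>\<omega>\<rightarrow> 1 / deriv h \<omega>"
      using d by (intro tendsto_intros)
    have ev: "\<forall>\<^sub>F w in at \<omega>. H w = f w"
      unfolding H_def using \<omega> by (intro eventually_remove_sings_eq_at fiso) auto
    show ?thesis
      by (rule Lim_transform_eventually[OF l]) (use ev in eventually_elim, simp add: f_def \<omega>(4))
  qed
  have Hr: "H v = 1 / (h v - \<phi> z)" if "cmod v = r" for v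
  proof -
    have vW: "v \<in> W" using that r by (intro W_I) auto
    have "\<not> is_pole h v" using not_is_pole_holomorphic[OF open_W vW h_hol] .
    moreover have "h v \<noteq> \<phi> z" using h_eq_phi_iff[of v z] that r r0 z by auto
    ultimately have "f analytic_on {v}" using fan[of v] that r mu_le_rho by auto
    then show ?thesis by (simp add: H_def f_def)
  qed
  obtain C1 where C1: "C1 \<ge> 0" "\<And>n v. cmod v \<le> 1 \<Longrightarrow> cmod (Yn n v - of_real (an n)) \<le> C1 / S1 ^ n"
    using Yn_estimate by blast
  obtain c C2 where c: "c > 0" "C2 \<ge> 0" "\<And>n. c \<le> an n" "\<And>n. an n \<le> real n + C2"
    using an_bounds by blast
  have Y1: "cmod (Yn n v) \<le> (C1 + C2 + 1) * (real n + 1)" if "cmod v \<le> 1" for n v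
  proof -
    have "cmod (Yn n v) \<le> cmod (Yn n v - of_real (an n)) + cmod (of_real (an n) :: complex)"
      using norm_triangle_ineq[of "Yn n v - of_real (an n)" "of_real (an n)"] by simp
    also have "\<dots> \<le> C1 / S1 ^ n + (real n + C2)"
      using C1(2)[OF that, of n] c(4)[of n] an_pos[of n] by simp
    also have "C1 / S1 ^ n \<le> C1 / 1"
      using C1(1) radii(1) by (intro divide_left_mono) auto
    also have "C1 / 1 + (real n + C2) \<le> (C1 + C2 + 1) * (real n + 1)"
      using C1(1) c(2) by (simp add: algebra_simps)
    finally show ?thesis by simp
  qed
  define K where "K = C1 + C2 + 1"
  have K: "K > 0" using C1(1) c(2) by (simp add: K_def)
  have sS: "sphere 0 s \<subseteq> S - {\<omega>}" using SI r s by auto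
  have contH: "continuous_on (sphere 0 s) H"
    by (rule continuous_on_subset[OF holomorphic_on_imp_continuous_on[OF Hhol] sS])
  have "bounded (H ` sphere 0 s)"
    by (intro compact_imp_bounded compact_continuous_image contH) auto
  then obtain M where M: "M > 0" "\<And>v. cmod v = s \<Longrightarrow> cmod (H v) \<le> M"
    unfolding bounded_pos by auto
  define R where "R = (\<lambda>n. circ s (\<lambda>v. v ^ n * Yn n v * H v))"
  have Rbound: "cmod (R n) \<le> s * (s ^ n * (K * (real n + 1)) * M)" for n
    unfolding R_def
  proof (rule circ_bound[OF _ s0])
    have "continuous_on (sphere 0 s) (Yn n)"
      by (rule continuous_on_subset[OF holomorphic_on_imp_continuous_on[OF Yn_hol]]) (use s \<omega> radii in auto)
    then show "continuous_on (sphere 0 s) (\<lambda>v. v ^ n * Yn n v * H v)"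
      by (intro continuous_intros contH)
    fix v :: complex assume v: "cmod v = s"
    show "cmod (v ^ n * Yn n v * H v) \<le> s ^ n * (K * (real n + 1)) * M"
      unfolding norm_mult norm_power using v M Y1[of v n] s s0 \<omega> K by (intro mult_mono) (auto simp: K_def)
  qed
  define D where "D = deriv \<phi> z"
  have D: "D \<noteq> 0" using phi_deriv_nonzero z inside_subset_N by (auto simp: D_def)
  have main: "poly (p n) z = D * (\<omega> ^ n * Yn n \<omega> / deriv h \<omega> + R n)" for n
  proof -
    define S' where "S' = S \<inter> ball 0 S2"
    have S': "open S'" using \<open>open S\<close> by (auto simp: S'_def)
    have hol: "(\<lambda>v. v ^ n * Yn n v * H v) holomorphic_on S' - {\<omega>}"
      by (intro holomorphic_on_mult holomorphic_on_power holomorphic_on_ident holomorphic_on_subset[OF Yn_hol]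
        holomorphic_on_subset[OF Hhol]) (auto simp: S'_def)
    have "circ r (\<lambda>v. v ^ n * Yn n v * H v) - R n = \<omega> ^ n * Yn n \<omega> * (1 / deriv h \<omega>)"
      unfolding R_def
    proof (rule circ_pole[OF S' hol _ s0 s(2) r(3)])
      show "w \<in> S'" if "s \<le> cmod w" "cmod w \<le> r" for w
        using SI[OF that] that r radii by (auto simp: S'_def)
      have "isCont (Yn n) \<omega>"
        using holomorphic_on_imp_continuous_on[OF Yn_hol, of n] \<omega> radii by (simp add: continuous_on_eq_continuous_at)
      then have "(\<lambda>w. w ^ n * Yn n w * ((w - \<omega>) * H w)) \<midarrow>\<omega>\<rightarrow> \<omega> ^ n * Yn n \<omega> * (1 / deriv h \<omega>)"
        by (intro tendsto_intros Hlim) (simp add: isCont_def)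
      then show "(\<lambda>w. (w - \<omega>) * (w ^ n * Yn n w * H w)) \<midarrow>\<omega>\<rightarrow> \<omega> ^ n * Yn n \<omega> * (1 / deriv h \<omega>)"
        by (simp add: ac_simps)
    qed
    moreover have "circ r (\<lambda>v. v ^ n * Yn n v * H v) = circ r (\<lambda>v. v ^ n * Yn n v / (h v - \<phi> z))"
      using r by (intro circ_cong) (auto simp: Hr)
    ultimately show ?thesis
      using pn_representation[OF z r0(1,3) r(1,2), of n] by (simp add: D_def algebra_simps)
  qed
  define a where "a = cmod \<omega>"
  have a: "0 < a" "s < a" "a < 1" using s s0 \<omega> by (auto simp: a_def)
  define h1 where "h1 = cmod (deriv h \<omega>)"
  have h1: "h1 > 0" using d by (simp add: h1_def)
  \<comment> \<open>The error relative to |\<omega>|^n: the first term is the deviation of Y_n from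
    a_n, the second the integral over the smaller circle.\<close>
  define e where "e = (\<lambda>n. C1 / S1 ^ n / h1 + s * K * M * ((real n + 1) * (s / a) ^ n))"
  have elim0: "e \<longlonglongrightarrow> 0"
  proof -
    have 1: "(\<lambda>n. C1 / S1 ^ n) \<longlonglongrightarrow> 0"
      using LIMSEQ_divide_realpow_zero[OF radii(1)] .
    have q: "norm (s / a) < 1" using a s0 by simp
    have "(\<lambda>n. real n * (s / a) ^ n + (s / a) ^ n) \<longlonglongrightarrow> 0 + 0"
      by (intro tendsto_add powser_times_n_limit_0[OF q, THEN tendsto_eq_rhs] LIMSEQ_power_zero q) simp
    then have 2: "(\<lambda>n. (real n + 1) * (s / a) ^ n) \<longlonglongrightarrow> 0"
      by (simp add: algebra_simps)
    have "e \<longlonglongrightarrow> 0 / h1 + s * K * M * 0"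
      unfolding e_def using h1 by (intro tendsto_intros 1 2) simp
    then show ?thesis by simp
  qed
  have Rn: "cmod (R n) \<le> s * K * M * ((real n + 1) * (s / a) ^ n) * a ^ n" for n
  proof -
    have "s ^ n = (s / a) ^ n * a ^ n" using a by (simp add: power_divide)
    then show ?thesis using Rbound[of n] by (simp add: ac_simps)
  qed
  have "(\<lambda>n. root n (cmod (poly (p n) z))) \<longlonglongrightarrow> a"
  proof (rule root_squeeze[of "cmod D * (c / (2 * h1))" "cmod D * (K / h1 + s * K * M)" a])
    show "0 < cmod D * (c / (2 * h1))" using D c(1) h1 by simp
    show "0 < cmod D * (K / h1 + s * K * M)" using D K h1 s0 M by (simp add: add_pos_pos)
    show "0 \<le> a" using a by simp
    show "cmod (poly (p n) z) \<le> cmod D * (K / h1 + s * K * M) * (real n + 1) * a ^ n" for n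
    proof -
      have "cmod (\<omega> ^ n * Yn n \<omega> / deriv h \<omega> + R n) \<le> a ^ n * (K * (real n + 1)) / h1 + s * K * M * ((real n + 1) * a ^ n)"
      proof (rule norm_triangle_le[OF add_mono])
        show "cmod (\<omega> ^ n * Yn n \<omega> / deriv h \<omega>) \<le> a ^ n * (K * (real n + 1)) / h1"
          unfolding norm_divide norm_mult norm_power h1_def[symmetric] a_def[symmetric]
          using Y1[of \<omega> n] \<omega> h1 a by (intro divide_right_mono mult_left_mono) (auto simp: K_def)
        have "cmod (R n) \<le> s * (s ^ n * (K * (real n + 1)) * M)" by (rule Rbound)
        also have "\<dots> \<le> s * (a ^ n * (K * (real n + 1)) * M)"
          using s0 a K M by (intro mult_left_mono mult_right_mono power_mono) auto
        finally show "cmod (R n) \<le> s * K * M * ((real n + 1) * a ^ n)" by (simp add: ac_simps)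
      qed
      also have "\<dots> = (K / h1 + s * K * M) * (real n + 1) * a ^ n"
        by (simp add: field_simps)
      finally have "cmod D * cmod (\<omega> ^ n * Yn n \<omega> / deriv h \<omega> + R n) \<le> cmod D * ((K / h1 + s * K * M) * (real n + 1) * a ^ n)"
        by (intro mult_left_mono) auto
      then show ?thesis unfolding main norm_mult by (simp add: mult.assoc)
    qed
    have "\<forall>\<^sub>F n in sequentially. e n < c / (2 * h1)"
      using order_tendstoD(2)[OF elim0, of "c / (2 * h1)"] c(1) h1 by simp
    then show "\<forall>\<^sub>F n in sequentially. cmod D * (c / (2 * h1)) * a ^ n \<le> cmod (poly (p n) z)"
    proof eventually_elim
      case (elim n)
      have Ylow: "c - C1 / S1 ^ n \<le> cmod (Yn n \<omega>)"
      proof -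
        have "an n - cmod (Yn n \<omega> - of_real (an n)) \<le> cmod (Yn n \<omega>)"
          using norm_triangle_ineq2[of "of_real (an n) :: complex" "of_real (an n) - Yn n \<omega>"] an_pos[of n]
          by (simp add: norm_minus_commute)
        then show ?thesis using C1(2)[of \<omega> n] c(3)[of n] \<omega> by linarith
      qed
      have "(c / (2 * h1)) * a ^ n \<le> (c / h1 - e n) * a ^ n"
        using elim a by (intro mult_right_mono) (auto simp: field_simps)
      also have "\<dots> = (c - C1 / S1 ^ n) / h1 * a ^ n - s * K * M * ((real n + 1) * (s / a) ^ n) * a ^ n"
        by (simp add: e_def algebra_simps diff_divide_distrib)
      also have "\<dots> \<le> cmod (Yn n \<omega>) / h1 * a ^ n - cmod (R n)"
        using Ylow Rn[of n] h1 a by (intro diff_mono mult_right_mono divide_right_mono) auto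
      also have "\<dots> = cmod (\<omega> ^ n * Yn n \<omega> / deriv h \<omega>) - cmod (R n)"
        by (simp add: norm_mult norm_divide norm_power a_def h1_def)
      also have "\<dots> \<le> cmod (\<omega> ^ n * Yn n \<omega> / deriv h \<omega> + R n)"
        by (rule norm_diff_ineq)
      finally have "cmod D * ((c / (2 * h1)) * a ^ n) \<le> cmod D * cmod (\<omega> ^ n * Yn n \<omega> / deriv h \<omega> + R n)"
        by (intro mult_left_mono) auto
      then show ?case unfolding main norm_mult by (simp add: mult.assoc)
    qed
  qed
  then show ?thesis by (simp add: a_def)
qed

end

section \<open>Zero-free discs\<close>

text \<open>The quotient f/g attains its maximal modulus 1 over V at x, so the maximum principle
  makes it constant.\<close>

lemma holomorphic_modulus_le_imp_proportional:
  assumes S: "open S" "connected S" "f holomorphic_on S" "g holomorphic_on S" "\<And>w. w \<in> S \<Longrightarrow> g w \<noteq> 0"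
    and V: "open V" "V \<subseteq> S" "x \<in> V" "\<And>w. w \<in> V \<Longrightarrow> cmod (f w) \<le> cmod (g w)" "cmod (f x) = cmod (g x)"
  obtains c where "cmod c = 1" "\<And>w. w \<in> S \<Longrightarrow> f w = c * g w"
proof -
  define q where "q = (\<lambda>w. f w / g w)"
  have q: "q holomorphic_on S"
    unfolding q_def by (intro holomorphic_on_divide S)
  have xS: "x \<in> S" using V by auto
  have q1: "cmod (q x) = 1"
    using V(5) S(5)[OF xS] by (simp add: q_def norm_divide)
  have "q constant_on S"
  proof (rule maximum_modulus_principle[OF q S(1,2) V(1,2,3)])
    fix w assume w: "w \<in> V"
    then have "g w \<noteq> 0" using V(2) S(5) by blast
    then show "cmod (q w) \<le> cmod (q x)"
      unfolding q1 using V(4)[OF w] by (simp add: q_def norm_divide)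
  qed
  then obtain c where c: "\<And>w. w \<in> S \<Longrightarrow> q w = c"
    by (auto simp: constant_on_def)
  have "f w = c * g w" if "w \<in> S" for w
    using c[OF that] S(5)[OF that] by (simp add: q_def field_simps)
  moreover have "cmod c = 1" using c[OF xS] q1 by simp
  ultimately show ?thesis using that by blast
qed

context carleman_setting
begin

text \<open>By continuation the relation holds near the unit circle, where \<open>h\<close> is injective.\<close>
lemma h_rotation_trivial:
  assumes d: "cmod d = 1" and B: "open B" "B \<noteq> {}" "B \<subseteq> {w. \<mu> < cmod w \<and> cmod w < 1}"
    and eq: "\<And>w. w \<in> B \<Longrightarrow> h (d * w) = h w"
  shows "d = 1"
proof -
  define A where "A = {w::complex. \<mu> < cmod w \<and> cmod w < 1}"
  have A: "open A" "connected A"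
    unfolding A_def by (rule open_annulus_cmod, rule connected_annulus_cmod)
  have hA: "h meromorphic_on A"
    by (rule meromorphic_on_subset[of _ "annulus (ereal \<mu>) (1 / ereal \<rho>)"])
      (use h_mero rho_mult_less_1 in \<open>auto simp: nicely_meromorphic_on_def A_def annulus_iff\<close>)
  have "(\<lambda>w. h (d * w)) meromorphic_on A"
    by (rule meromorphic_on_compose[OF hA]) (auto intro!: analytic_intros simp: A_def norm_mult d)
  then have mero: "(\<lambda>w. h (d * w) - h w) meromorphic_on A"
    using hA by (intro meromorphic_intros)
  define X where "X = {w::complex. \<rho> < cmod w \<and> cmod w < 1}"
  define x where "x = (of_real r1 :: complex)"
  have x: "x \<in> X" "x \<in> A"
    using radii mu_le_rho by (auto simp: x_def X_def A_def)
  have "\<forall>\<^sub>F w in at x. h (d * w) - h w = 0"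
    by (rule meromorphic_identity_const[OF mero A B(1,2) _ _ x(2)]) (use B(3) eq in \<open>auto simp: A_def\<close>)
  moreover have "\<forall>\<^sub>F w in at x. w \<in> X"
    by (rule eventually_at_in_open'[OF _ x(1)]) (unfold X_def, rule open_annulus_cmod)
  ultimately have "\<forall>\<^sub>F w in at x. w \<in> X \<and> h (d * w) = h w"
    by eventually_elim auto
  then obtain w where w: "w \<in> X" "h (d * w) = h w"
    using eventually_happens'[OF at_neq_bot] by blast
  have "d * w \<in> W" "w \<in> W"
    using w(1) d by (auto simp: X_def norm_mult intro!: W_I)
  then have "d * w = w"
    by (rule inj_onD[OF h_inj w(2)])
  moreover have "w \<noteq> 0" using w(1) rho_nonneg by (auto simp: X_def)
  ultimately show ?thesis by simp
qed

lemma pn_exponential_bound_all: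
  assumes "0 < \<tau>" "\<forall>\<^sub>F n in sequentially. cmod (poly (p n) z) \<le> \<tau> ^ n"
  shows "\<exists>C. \<forall>n. cmod (poly (p n) z) \<le> C * \<tau> ^ n"
proof -
  obtain N0 where N0: "\<And>n. n \<ge> N0 \<Longrightarrow> cmod (poly (p n) z) \<le> \<tau> ^ n"
    using assms(2) by (auto simp: eventually_sequentially)
  define C where "C = 1 + (\<Sum>n<N0. cmod (poly (p n) z) / \<tau> ^ n)"
  have nonneg: "0 \<le> (\<Sum>n<N0. cmod (poly (p n) z) / \<tau> ^ n)"
    using assms(1) by (intro sum_nonneg) auto
  have "cmod (poly (p n) z) \<le> C * \<tau> ^ n" for n
  proof (cases "n \<ge> N0")
    case True
    have "1 * \<tau> ^ n \<le> C * \<tau> ^ n"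
      using assms(1) nonneg by (intro mult_right_mono) (auto simp: C_def)
    then show ?thesis using N0[OF True] by simp
  next
    case False
    have "cmod (poly (p n) z) / \<tau> ^ n \<le> (\<Sum>n<N0. cmod (poly (p n) z) / \<tau> ^ n)"
      using False assms(1) by (intro member_le_sum) auto
    then have "cmod (poly (p n) z) / \<tau> ^ n \<le> C" by (simp add: C_def)
    then show ?thesis using assms(1) by (simp add: field_simps)
  qed
  then show ?thesis by blast
qed

text \<open>A second solution of the modulus of \<open>g(z)\<close> would, by the maximum principle, move with
  \<open>g\<close> as \<open>c g\<close> for a constant \<open>c\<close> of modulus 1, contradicting the previous rigidity.\<close>
lemma dominating_branch_subset_Sigma1:
  assumes U: "open U" "U \<subseteq> inside L" and g: "g holomorphic_on U"
    and sol: "\<And>z. z \<in> U \<Longrightarrow> g z \<in> solutions \<phi> h \<mu> z"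
    and dom: "\<And>z w. z \<in> U \<Longrightarrow> w \<in> solutions \<phi> h \<mu> z \<Longrightarrow> cmod w \<le> cmod (g z)"
  shows "U \<subseteq> Sigma1_set L \<phi> h \<mu>"
proof
  fix z assume z: "z \<in> U"
  have hg: "h (g y) = \<phi> y" "\<mu> < cmod (g y)" "cmod (g y) < 1" "\<not> is_pole h (g y)" if "y \<in> U" for y
    using sol[OF that] by (auto simp: solutions_iff)
  have hda: "(h has_field_derivative deriv h (g z)) (at (g z))"
    using hg[OF z] by (intro analytic_derivI h_analytic_at) auto
  \<comment> \<open>Differentiating h(g(y)) = \<phi>(y) yields simplicity of the solution, since
    \<phi>' has no zero.\<close>
  have "((\<lambda>y. h (g y)) has_field_derivative deriv h (g z) * deriv g z) (at z)"
    by (rule DERIV_chain2[OF hda holomorphic_derivI[OF g U(1) z]])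
  then have "(\<phi> has_field_derivative deriv h (g z) * deriv g z) (at z)"
    by (rule has_field_derivative_transform_within_open[OF _ U(1) z]) (rule hg(1))
  then have "deriv \<phi> z = deriv h (g z) * deriv g z" by (rule DERIV_imp_deriv)
  moreover have "deriv \<phi> z \<noteq> 0"
    using phi_deriv_nonzero z U(2) inside_subset_N by blast
  ultimately have d: "deriv h (g z) \<noteq> 0" by auto
  have unique: "w' = g z" if w': "w' \<in> solutions \<phi> h \<mu> z" "cmod w' = cmod (g z)" for w'
  proof -
    have w: "\<mu> < cmod w'" "cmod w' < 1" "\<not> is_pole h w'" "h w' = \<phi> z"
      using w'(1) by (auto simp: solutions_iff)
    have "h analytic_on {w'}" using w by (intro h_analytic_at) auto
    then obtain X0 where X0: "open X0" "w' \<in> X0" "h holomorphic_on X0" by (auto simp: analytic_at)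
    define X where "X = X0 \<inter> {w. \<mu> < cmod w \<and> cmod w < 1}"
    have X: "open X" "w' \<in> X" "h holomorphic_on X"
      using X0 w open_annulus_cmod by (auto simp: X_def intro: holomorphic_on_subset)
    have XnP: "\<not> is_pole h y" "\<mu> < cmod y" "cmod y < 1" if "y \<in> X" for y
      using not_is_pole_holomorphic[OF X(1) that X(3)] that by (auto simp: X_def)
    obtain \<Phi> where Phi: "\<Phi> holomorphic_on \<phi> ` N" "\<And>y. y \<in> N \<Longrightarrow> \<Phi> (\<phi> y) = y"
      using holomorphic_has_inverse[OF phi_hol open_N phi_inj] by metis
    have UN: "U \<subseteq> N" using U(2) inside_subset_N by blast
    have phiU: "open (\<phi> ` U)"
      by (rule open_mapping_thm3[OF holomorphic_on_subset[OF phi_hol UN] U(1) inj_on_subset[OF phi_inj UN]])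
    define X' where "X' = X \<inter> h -` (\<phi> ` U)"
    have X': "open X'"
      unfolding X'_def by (rule continuous_open_preimage[OF holomorphic_on_imp_continuous_on[OF X(3)] X(1) phiU])
    have "w' \<in> X'" using X(2) w(4) z by (auto simp: X'_def)
    then obtain e where e: "e > 0" "ball w' e \<subseteq> X'"
      using X' open_contains_ball by blast
    \<comment> \<open>A point x near w' is a solution for the parameter \<Phi>(h(x)), whose
      dominating solution is F(x). Hence |x| <= |F(x)|, with equality at w'.\<close>
    define F where "F = (\<lambda>w. g (\<Phi> (h w)))"
    have FX: "\<exists>y\<in>U. h w = \<phi> y \<and> F w = g y" if wX: "w \<in> X'" for w
    proof -
      obtain y where y: "y \<in> U" "h w = \<phi> y" using wX by (auto simp: X'_def)
      then have "\<Phi> (h w) = y" using Phi(2) UN by auto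
      then show ?thesis using y by (auto simp: F_def)
    qed
    have F1: "(\<Phi> \<circ> h) holomorphic_on X'"
      by (rule holomorphic_on_compose_gen[OF holomorphic_on_subset[OF X(3)] Phi(1)]) (use UN in \<open>auto simp: X'_def\<close>)
    have "(g \<circ> (\<Phi> \<circ> h)) holomorphic_on X'"
    proof (rule holomorphic_on_compose_gen[OF F1 g])
      show "(\<Phi> \<circ> h) ` X' \<subseteq> U"
      proof
        fix u assume "u \<in> (\<Phi> \<circ> h) ` X'"
        then obtain w y where "u = \<Phi> (h w)" "y \<in> U" "h w = \<phi> y" by (auto simp: X'_def)
        then show "u \<in> U" using Phi(2) UN by auto
      qed
    qed
    then have F: "F holomorphic_on ball w' e"
      unfolding F_def o_def by (rule holomorphic_on_subset[OF _ e(2)])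
    have Fz: "F w' = g z"
    proof -
      have "\<Phi> (h w') = z" unfolding w(4) using Phi(2) z UN by auto
      then show ?thesis by (simp add: F_def)
    qed
    have Fne: "F x \<noteq> 0" if "x \<in> ball w' e" for x
    proof -
      have xX: "x \<in> X'" using e(2) that by blast
      obtain y where "y \<in> U" "F x = g y" using FX[OF xX] by blast
      then show ?thesis using hg(2)[of y] mu_nonneg by auto
    qed
    have le: "cmod x \<le> cmod (F x)" if "x \<in> ball w' e" for x
    proof -
      have xX: "x \<in> X'" using e(2) that by blast
      obtain y where y: "y \<in> U" "h x = \<phi> y" "F x = g y" using FX[OF xX] by blast
      have "x \<in> solutions \<phi> h \<mu> y"
        using XnP[of x] xX y by (auto simp: solutions_iff X'_def)
      then show ?thesis using dom[OF y(1)] y(3) by simp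
    qed
    obtain c where c: "cmod c = 1" "\<And>x. x \<in> ball w' e \<Longrightarrow> x = c * F x"
      by (rule holomorphic_modulus_le_imp_proportional[of "ball w' e" "\<lambda>x. x" F "ball w' e" w'])
        (use F Fne le e(1) w'(2) Fz in auto)
    have "1 / c = 1"
    proof (rule h_rotation_trivial)
      show "cmod (1 / c) = 1" using c(1) by (simp add: norm_divide)
      show "ball w' e \<subseteq> {w. \<mu> < cmod w \<and> cmod w < 1}"
        using e(2) XnP by (auto simp: X'_def)
      show "h (1 / c * x) = h x" if x: "x \<in> ball w' e" for x
      proof -
        have "c \<noteq> 0" using c(1) by auto
        then have "1 / c * x = F x" using c(2)[OF x] by (simp add: field_simps)
        moreover obtain y where "y \<in> U" "h x = \<phi> y" "F x = g y" using FX[of x] e(2) x by blast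
        ultimately show ?thesis using hg(1) by simp
      qed
    qed (use e(1) in auto)
    then have "c = 1" using c(1) by (simp add: divide_eq_1_iff)
    then show ?thesis using c(2)[of w'] e(1) Fz by simp
  qed
  have "largest_solutions \<phi> h \<mu> z = {g z}"
  proof (intro equalityI subsetI)
    fix w assume "w \<in> largest_solutions \<phi> h \<mu> z"
    then have "w \<in> solutions \<phi> h \<mu> z" "cmod (g z) \<le> cmod w"
      using sol[OF z] by (auto simp: largest_solutions_def)
    then show "w \<in> {g z}" using unique[of w] dom[OF z, of w] by simp
  qed (use sol[OF z] dom[OF z] in \<open>auto simp: largest_solutions_def\<close>)
  then show "z \<in> Sigma1_set L \<phi> h \<mu>"
    using sol[OF z] z U(2) d by (auto simp: Sigma1_set_def Sigma_set_def)
qed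

text \<open>The set where g is locally a solution is closed in U: limits are solutions by
  \<open>solution_limit\<close>, and the identity theorem spreads this to a neighbourhood. The lower
  bound on |g| keeps the limits away from the circle |w| = \<mu>.\<close>

lemma continue_solution:
  assumes U: "open U" "connected U" "U \<subseteq> inside L" and g: "g holomorphic_on U"
    and mod: "\<And>z. z \<in> U \<Longrightarrow> \<mu> < cmod (g z)"
    and V: "open V" "V \<subseteq> U" "z0 \<in> V" "\<And>z. z \<in> V \<Longrightarrow> g z \<in> solutions \<phi> h \<mu> z"
    and z: "z \<in> U"
  shows "g z \<in> solutions \<phi> h \<mu> z"
proof -
  define T where "T = interior {y \<in> U. g y \<in> solutions \<phi> h \<mu> y}"
  have TU: "T \<subseteq> U" "open T" and Tsol: "\<And>y. y \<in> T \<Longrightarrow> g y \<in> solutions \<phi> h \<mu> y"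
    using interior_subset by (auto simp: T_def)
  have z0T: "z0 \<in> T"
    unfolding T_def using V by (intro interiorI[of V]) auto
  have closed: "y \<in> T" if y: "y \<in> U" "y \<in> closure T" for y
  proof -
    obtain s where s: "\<And>n. s n \<in> T" "s \<longlonglongrightarrow> y"
      using y(2) by (auto simp: closure_sequential)
    have contg: "isCont g y"
      using holomorphic_on_imp_continuous_on[OF g] U(1) y(1) by (simp add: continuous_on_eq_continuous_at)
    have "g y \<in> solutions \<phi> h \<mu> y"
      by (rule solution_limit[OF _ s(2) _ _ isCont_tendsto_compose[OF contg s(2)]])
        (use s(1) TU U(3) y(1) Tsol mod in auto)
    then have gy: "cmod (g y) < 1" "\<not> is_pole h (g y)" by (auto simp: solutions_iff)
    then have "h analytic_on {g y}" using mod[OF y(1)] by (intro h_analytic_at) auto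
    then obtain X0 where X0: "open X0" "g y \<in> X0" "h holomorphic_on X0" by (auto simp: analytic_at)
    define X where "X = X0 \<inter> ball 0 1"
    have X: "open X" "g y \<in> X" "h holomorphic_on X"
      using X0 gy by (auto simp: X_def intro: holomorphic_on_subset)
    have "open (U \<inter> g -` X)"
      by (rule continuous_open_preimage[OF holomorphic_on_imp_continuous_on[OF g] U(1) X(1)])
    then obtain e where e: "e > 0" "ball y e \<subseteq> U \<inter> g -` X"
      using y(1) X(2) open_contains_ball[of "U \<inter> g -` X"] by blast
    have "(h \<circ> g) holomorphic_on ball y e"
      by (rule holomorphic_on_compose_gen[OF holomorphic_on_subset[OF g] X(3)]) (use e in auto)
    then have hg: "(\<lambda>x. h (g x)) holomorphic_on ball y e" by (simp add: o_def)
    have phi: "\<phi> holomorphic_on ball y e"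
      by (rule holomorphic_on_subset[OF phi_hol_inside]) (use e U(3) in auto)
    have ne: "T \<inter> ball y e \<noteq> {}"
    proof -
      have "\<forall>\<^sub>F n in sequentially. s n \<in> ball y e"
        using topological_tendstoD[OF s(2), of "ball y e"] e(1) by simp
      then obtain n where "s n \<in> ball y e" using eventually_happens'[OF sequentially_bot] by blast
      then show ?thesis using s(1) by blast
    qed
    have "h (g x) = \<phi> x" if "x \<in> ball y e" for x
    proof (rule analytic_continuation_open[of "T \<inter> ball y e" "ball y e" "\<lambda>x. h (g x)" \<phi>])
      show "\<And>x. x \<in> T \<inter> ball y e \<Longrightarrow> h (g x) = \<phi> x" using Tsol by (auto simp: solutions_iff)
    qed (use TU ne hg phi that in auto)
    moreover have "\<not> is_pole h (g x)" "cmod (g x) < 1" if "x \<in> ball y e" for x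
    proof -
      have "g x \<in> X" using e(2) that by blast
      then show "\<not> is_pole h (g x)" "cmod (g x) < 1"
        using not_is_pole_holomorphic[OF X(1) _ X(3)] by (auto simp: X_def)
    qed
    ultimately have "ball y e \<subseteq> {y \<in> U. g y \<in> solutions \<phi> h \<mu> y}"
      using e(2) mod by (auto simp: solutions_iff)
    then show ?thesis
      unfolding T_def using e(1) by (intro interiorI[of "ball y e"]) auto
  qed
  have "T = U"
  proof (rule ccontr)
    assume "T \<noteq> U"
    have "U \<subseteq> T \<union> - closure T" using closed by auto
    moreover have "T \<inter> (- closure T) \<inter> U = {}" using closure_subset by auto
    moreover have "T \<inter> U \<noteq> {}" using z0T TU by auto
    moreover have "- closure T \<inter> U \<noteq> {}"
      using \<open>T \<noteq> U\<close> TU closed by blast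
    ultimately show False
      using connectedD[OF U(2) TU(2), of "- closure T"] by (auto simp: open_Compl)
  qed
  then show ?thesis using z Tsol by blast
qed

theorem zero_free_disc_subset_Sigma1:
  assumes U: "ball z1 \<delta> \<subseteq> inside L" "\<delta> > 0"
    and zfree: "\<And>n z. n \<ge> N0 \<Longrightarrow> z \<in> ball z1 \<delta> \<Longrightarrow> poly (p n) z \<noteq> 0"
    and z0: "z0 \<in> ball z1 \<delta>" "z0 \<in> Sigma1_set L \<phi> h \<mu>"
  shows "ball z1 \<delta> \<subseteq> Sigma1_set L \<phi> h \<mu>"
proof -
  define U where "U = ball z1 \<delta>"
  have U': "open U" "connected U" "convex U" "z1 \<in> U" "U \<subseteq> inside L" "z0 \<in> U"
    using U z0 by (auto simp: U_def)
  \<comment> \<open>The successor makes every index M + n positive, so that roots of that order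
    exist, and keeps it in the zero-free range.\<close>
  define M where "M = Suc N0"
  have "\<exists>l. l holomorphic_on U \<and> (\<forall>x\<in>U. exp (l x) = poly (p (M + n)) x)" for n
    by (rule holomorphic_logarithm_exists[OF U'(3,1) _ _ U'(4), of "poly (p (M + n))"])
      (use zfree in \<open>auto simp: U_def M_def intro!: holomorphic_intros\<close>)
  then obtain l where l: "\<And>n. l n holomorphic_on U" "\<And>n x. x \<in> U \<Longrightarrow> exp (l n x) = poly (p (M + n)) x"
    by metis
  define g where "g = (\<lambda>n x. exp (l n x / of_nat (M + n)))"
  have ghol: "g n holomorphic_on U" for n
    unfolding g_def by (intro holomorphic_intros l) (simp add: M_def)
  have gne: "g n x \<noteq> 0" for n x by (simp add: g_def)
  have gpow: "cmod (g n x) ^ (M + n) = cmod (poly (p (M + n)) x)" if "x \<in> U" for n x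
  proof -
    have "of_nat (M + n) \<noteq> (0 :: complex)"
      unfolding of_nat_eq_0_iff by (simp add: M_def)
    then have "of_nat (M + n) * (l n x / of_nat (M + n)) = l n x" by simp
    then have "g n x ^ (M + n) = exp (l n x)"
      unfolding g_def exp_of_nat_mult[symmetric] by (simp only:)
    then show ?thesis using l(2)[OF that, of n] by (metis norm_power)
  qed
  have groot: "cmod (g n x) = root (M + n) (cmod (poly (p (M + n)) x))" if "x \<in> U" for n x
    unfolding gpow[OF that, symmetric] by (subst real_root_power_cancel) (auto simp: M_def)
  have gbound: "\<exists>B. \<forall>n. \<forall>x\<in>K. cmod (g n x) \<le> B" if K: "compact K" "K \<subseteq> U" for K
  proof -
    obtain C where C: "C \<ge> 0" "\<And>n x. x \<in> K \<Longrightarrow> cmod (poly (p n) x) \<le> C"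
      using pn_bounded_compact[OF K(1)] K(2) U'(5) by blast
    have "cmod (g n x) \<le> max 1 C" if x: "x \<in> K" for n x
    proof (cases "cmod (g n x) \<le> 1")
      case False
      then have "cmod (g n x) ^ 1 \<le> cmod (g n x) ^ (M + n)"
        by (intro power_increasing) (auto simp: M_def)
      also have "\<dots> \<le> C" using gpow[of x n] C(2)[OF x] x K(2) by auto
      finally show ?thesis by simp
    qed simp
    then show ?thesis by blast
  qed
  obtain V \<omega> r where V: "open V" "z0 \<in> V" "V \<subseteq> inside L" "\<omega> holomorphic_on V" "\<mu> < r"
    "\<And>z. z \<in> V \<Longrightarrow> r < cmod (\<omega> z)" "\<And>z. z \<in> V \<Longrightarrow> \<omega> z \<in> solutions \<phi> h \<mu> z"
    "\<And>z. z \<in> V \<Longrightarrow> deriv h (\<omega> z) \<noteq> 0"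
    "\<And>z w. z \<in> V \<Longrightarrow> w \<in> solutions \<phi> h \<mu> z \<Longrightarrow> r \<le> cmod w \<Longrightarrow> w = \<omega> z"
    by (rule local_branch[OF z0(2)], rule that; assumption)
  have asym: "(\<lambda>n. root n (cmod (poly (p n) z))) \<longlonglongrightarrow> cmod (\<omega> z)" if "z \<in> V" for z
    by (rule pn_asymptotics[OF _ V(7)[OF that] V(8)[OF that] V(5) V(6)[OF that] V(9)[OF that]])
      (use V(3) that in auto)
  have normal: "\<exists>k G. strict_mono k \<and> G holomorphic_on U \<and> (\<forall>x\<in>U. (\<lambda>n. g (s (k n)) x) \<longlonglongrightarrow> G x) \<and>
      (\<forall>x\<in>V \<inter> U. cmod (G x) = cmod (\<omega> x)) \<and> (\<forall>x\<in>U. G x \<noteq> 0)" if s: "strict_mono s" for s :: "nat \<Rightarrow> nat"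
  proof -
    obtain G k where G: "G holomorphic_on U" "strict_mono (k :: nat \<Rightarrow> nat)"
      "\<And>x. x \<in> U \<Longrightarrow> (\<lambda>n. g (s (k n)) x) \<longlonglongrightarrow> G x"
      "\<And>K. compact K \<Longrightarrow> K \<subseteq> U \<Longrightarrow> uniform_limit K ((\<lambda>n. g (s n)) \<circ> k) G sequentially"
    proof (rule Montel[of U "range g" "\<lambda>n. g (s n)"])
      show "\<exists>B. \<forall>h\<in>range g. \<forall>z\<in>K. cmod (h z) \<le> B" if "compact K" "K \<subseteq> U" for K
        using gbound[OF that] by blast
    qed (use U'(1) ghol in auto)
    have mod: "cmod (G x) = cmod (\<omega> x)" if x: "x \<in> V \<inter> U" for x
    proof -
      have "strict_mono (\<lambda>n. M + s (k n))"
        using s G(2) by (auto simp: strict_mono_def)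
      from LIMSEQ_subseq_LIMSEQ[OF asym this] have "(\<lambda>n. cmod (g (s (k n)) x)) \<longlonglongrightarrow> cmod (\<omega> x)"
        using x groot[of x] by (simp add: o_def)
      moreover have "(\<lambda>n. cmod (g (s (k n)) x)) \<longlonglongrightarrow> cmod (G x)"
        using x by (intro tendsto_norm G) auto
      ultimately show ?thesis by (rule LIMSEQ_unique[symmetric])
    qed
    have Gz0: "G z0 \<noteq> 0"
      using mod[of z0] V(2,5) V(6)[of z0] U'(6) mu_nonneg by auto
    \<comment> \<open>By Hurwitz a nonconstant limit of zero-free functions is zero-free, and a
      constant one has its nonzero value at \<open>z0\<close>.\<close>
    have "G x \<noteq> 0" if x: "x \<in> U" for x
    proof (cases "G constant_on U")
      case True
      then show ?thesis using Gz0 x U'(6) by (auto simp: constant_on_def)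
    next
      case False
      show ?thesis
        by (rule Hurwitz_no_zeros[OF U'(1,2) _ G(1) G(4) False _ x]) (use ghol gne in auto)
    qed
    then show ?thesis using G mod by blast
  qed
  obtain k0 G where G: "strict_mono (k0 :: nat \<Rightarrow> nat)" "G holomorphic_on U" "\<And>x. x \<in> U \<Longrightarrow> (\<lambda>n. g (k0 n) x) \<longlonglongrightarrow> G x"
    "\<And>x. x \<in> V \<inter> U \<Longrightarrow> cmod (G x) = cmod (\<omega> x)" "\<And>x. x \<in> U \<Longrightarrow> G x \<noteq> 0"
    using normal[OF strict_mono_id] by (auto simp: id_def)
  \<comment> \<open>A subsequence violating the bound would have a limit \<open>G2\<close> with
    |G2(z)| >= \<tau>. But near \<open>z0\<close> both limits have the modulus of the branch
    \<omega>, so \<open>G2\<close> is a unimodular multiple of \<open>G\<close> on all of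
    \<open>U\<close>.\<close>
  have decay: "\<forall>\<^sub>F n in sequentially. cmod (poly (p n) z) \<le> \<tau> ^ n" if z: "z \<in> U" and \<tau>: "cmod (G z) < \<tau>" for z \<tau>
  proof (rule ccontr)
    assume no: "\<not> ?thesis"
    define S where "S = {n. \<not> cmod (poly (p (M + n)) z) \<le> \<tau> ^ (M + n)}"
    have "infinite S"
      unfolding infinite_nat_iff_unbounded_le
    proof
      fix m
      obtain n where "n \<ge> M + m" "\<not> cmod (poly (p n) z) \<le> \<tau> ^ n"
        using no unfolding eventually_sequentially by blast
      then show "\<exists>n\<ge>m. n \<in> S"
        by (intro exI[of _ "n - M"]) (auto simp: S_def)
    qed
    then obtain s where s: "strict_mono (s :: nat \<Rightarrow> nat)" "\<And>n. s n \<in> S"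
      using infinite_enumerate by blast
    obtain k G2 where G2: "strict_mono (k :: nat \<Rightarrow> nat)" "G2 holomorphic_on U" "\<And>x. x \<in> U \<Longrightarrow> (\<lambda>n. g (s (k n)) x) \<longlonglongrightarrow> G2 x"
      "\<And>x. x \<in> V \<inter> U \<Longrightarrow> cmod (G2 x) = cmod (\<omega> x)"
      using normal[OF s(1)] by blast
    have \<tau>0: "0 \<le> \<tau>" using \<tau> norm_ge_zero[of "G z"] by linarith
    have "\<tau> \<le> cmod (g (s (k n)) z)" for n
    proof (rule ccontr)
      assume "\<not> \<tau> \<le> cmod (g (s (k n)) z)"
      then have "cmod (g (s (k n)) z) ^ (M + s (k n)) \<le> \<tau> ^ (M + s (k n))"
        by (intro power_mono) auto
      then show False
        using gpow[OF z, of "s (k n)"] s(2)[of "k n"] by (simp add: S_def)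
    qed
    then have "\<tau> \<le> cmod (G2 z)"
      by (intro LIMSEQ_le_const[OF tendsto_norm[OF G2(3)[OF z]]]) auto
    moreover obtain c where "cmod c = 1" "\<And>w. w \<in> U \<Longrightarrow> G2 w = c * G w"
      by (rule holomorphic_modulus_le_imp_proportional[of U G2 G "V \<inter> U" z0])
        (use U' V(1,2) G G2 in auto)
    ultimately show False using z \<tau> by (simp add: norm_mult)
  qed
  have Gle1: "cmod (G z) \<le> 1" if z: "z \<in> U" for z
  proof -
    obtain C where C: "C \<ge> 0" "\<And>n x. x \<in> {z} \<Longrightarrow> cmod (poly (p n) x) \<le> C"
      using pn_bounded_compact[of "{z}"] z U'(5) by auto
    have "strict_mono (\<lambda>n. M + k0 n)"
      using G(1) by (auto simp: strict_mono_def)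
    from LIMSEQ_subseq_LIMSEQ[OF LIMSEQ_root_const[of "C + 1"] this] C(1)
    have "(\<lambda>n. root (M + k0 n) (C + 1)) \<longlonglongrightarrow> 1" by (simp add: o_def)
    moreover have "cmod (g (k0 n) z) \<le> root (M + k0 n) (C + 1)" for n
      unfolding groot[OF z] using C(2)[of z "M + k0 n"] by (intro real_root_le_mono) (auto simp: M_def)
    ultimately show ?thesis
      by (intro LIMSEQ_le[OF tendsto_norm[OF G(3)[OF z]]]) auto
  qed
  have VU: "open (V \<inter> U)" "z0 \<in> V \<inter> U" using V(1,2) U'(1,6) by auto
  obtain e where e: "e > 0" "ball z0 e \<subseteq> V \<inter> U" by (rule openE[OF VU])
  have sub: "ball z0 e \<subseteq> V" "ball z0 e \<subseteq> U" using e(2) by auto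
  have eqm: "cmod (\<omega> x) = cmod (G x)" if "x \<in> ball z0 e" for x
    using G(4)[of x] subsetD[OF e(2) that] by simp
  \<comment> \<open>The limit G shares only the modulus with the branch \<omega>; a unimodular
    constant aligns the two near \<open>z0\<close>.\<close>
  obtain c where c: "cmod c = 1" "\<And>x. x \<in> ball z0 e \<Longrightarrow> \<omega> x = c * G x"
    by (rule holomorphic_modulus_le_imp_proportional[of "ball z0 e" \<omega> G "ball z0 e" z0])
      (use e(1) sub eqm G(5) holomorphic_on_subset[OF V(4) sub(1)] holomorphic_on_subset[OF G(2) sub(2)] in auto)
  define g0 where "g0 = (\<lambda>z. c * G z)"
  have g0hol: "g0 holomorphic_on U" unfolding g0_def by (intro holomorphic_intros G)
  have g0mod: "cmod (g0 z) = cmod (G z)" for z by (simp add: g0_def norm_mult c(1))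
  have g0V: "g0 z \<in> solutions \<phi> h \<mu> z" if "z \<in> ball z0 e" for z
    using V(7)[of z] sub(1) that c(2)[OF that] by (auto simp: g0_def)
  \<comment> \<open>With this the image of \<open>U\<close> is open, which sharpens |g0| <= 1 and
    |g0| >= \<mu> to strict inequalities.\<close>
  have nonconst: "\<not> g0 constant_on U"
  proof
    assume "g0 constant_on U"
    then obtain a where a: "\<And>x. x \<in> U \<Longrightarrow> g0 x = a" by (auto simp: constant_on_def)
    define y where "y = z0 + of_real (e / 2)"
    have y: "y \<in> ball z0 e" "z0 \<in> ball z0 e" "y \<noteq> z0" using e(1) by (auto simp: y_def dist_norm)
    have "\<phi> y = h (g0 y)" "\<phi> z0 = h (g0 z0)" using g0V y by (auto simp: solutions_iff)
    moreover have "g0 y = g0 z0"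
      using a[OF subsetD[OF sub(2) y(1)]] a[OF subsetD[OF sub(2) y(2)]] by simp
    ultimately have "\<phi> y = \<phi> z0" by simp
    then show False
      using phi_inj inside_subset_N U'(5) sub(2) y unfolding inj_on_def by blast
  qed
  have opn: "open (g0 ` U)"
    by (rule open_mapping_thm[OF g0hol U'(1,2,1) order_refl nonconst])
  have lt1: "cmod (G z) < 1" if z: "z \<in> U" for z
  proof -
    have "g0 ` U \<subseteq> cball 0 1" using Gle1 g0mod by auto
    then have "g0 ` U \<subseteq> interior (cball 0 1)" using opn by (rule interior_maximal)
    then show ?thesis using z g0mod[of z] by (auto simp: image_subset_iff)
  qed
  have cons: "\<mu> \<le> \<tau>" "\<And>w. w \<in> solutions \<phi> h \<mu> z \<Longrightarrow> cmod w \<le> \<tau>"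
    if z: "z \<in> U" and \<tau>: "cmod (G z) < \<tau>" "\<tau> < 1" for z \<tau>
  proof -
    have \<tau>0: "0 < \<tau>" using \<tau> norm_ge_zero[of "G z"] by linarith
    obtain C where C: "\<And>n. cmod (poly (p n) z) \<le> C * \<tau> ^ n"
      using pn_exponential_bound_all[OF \<tau>0 decay[OF z \<tau>(1)]] by blast
    have zG: "z \<in> inside L" using z U'(5) by blast
    show "\<mu> \<le> \<tau>" "\<And>w. w \<in> solutions \<phi> h \<mu> z \<Longrightarrow> cmod w \<le> \<tau>"
      using decay_consequences[OF zG \<tau>0 \<tau>(2) C] by blast+
  qed
  \<comment> \<open>Every \<tau> strictly between |G(z)| and 1 is an admissible rate, so bounds by
    all such \<tau> pass to |G(z)|.\<close>
  have muG: "\<mu> \<le> cmod (G z)" if z: "z \<in> U" for z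
    by (rule dense_ge_bounded[OF lt1[OF z]]) (rule cons(1)[OF z])
  have dom: "cmod w \<le> cmod (g0 z)" if z: "z \<in> U" and w: "w \<in> solutions \<phi> h \<mu> z" for z w
    unfolding g0mod by (rule dense_ge_bounded[OF lt1[OF z]]) (rule cons(2)[OF z _ _ w])
  have mu_lt: "\<mu> < cmod (g0 z)" if z: "z \<in> U" for z
  proof (rule ccontr)
    assume "\<not> \<mu> < cmod (g0 z)"
    then have eq: "cmod (g0 z) = \<mu>" using muG[OF z] g0mod[of z] by simp
    then have mu0: "\<mu> > 0" using G(5)[OF z] g0mod[of z] by auto
    obtain d where d: "d > 0" "ball (g0 z) d \<subseteq> g0 ` U"
      using opn z open_contains_ball by blast
    \<comment> \<open>The point (1 - t) g0(z) is at distance t \<mu> from g0(z); the choice keeps it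
      in the ball of radius \<open>d\<close>, hence in the image, although its modulus is below
      \<mu>.\<close>
    define t where "t = min (1 / 2) (d / (2 * \<mu>))"
    have t: "0 < t" "t < 1" "t * \<mu> < d"
      using d(1) mu0 by (auto simp: t_def min_def field_simps)
    have "of_real (1 - t) * g0 z \<in> ball (g0 z) d"
    proof -
      have "dist (g0 z) (of_real (1 - t) * g0 z) = cmod (of_real t * g0 z)"
        by (simp add: dist_norm algebra_simps)
      also have "\<dots> = t * \<mu>" using t eq by (simp add: norm_mult)
      finally show ?thesis using t by simp
    qed
    then obtain y where y: "y \<in> U" "g0 y = of_real (1 - t) * g0 z" using d(2) by (metis imageE subsetD)
    have "cmod (g0 y) = (1 - t) * \<mu>"
      unfolding y(2) norm_mult norm_of_real eq using t by simp
    also have "\<dots> < \<mu>" using t mu0 by (simp add: algebra_simps)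
    finally show False using muG[OF y(1)] g0mod[of y] by simp
  qed
  have "g0 z \<in> solutions \<phi> h \<mu> z" if z: "z \<in> U" for z
    by (rule continue_solution[OF U'(1,2,5) g0hol mu_lt, of "ball z0 e" z0])
      (use sub(2) e(1) g0V z in auto)
  then have "U \<subseteq> Sigma1_set L \<phi> h \<mu>"
    by (rule dominating_branch_subset_Sigma1[OF U'(1,5) g0hol]) (use dom in auto)
  then show ?thesis by (simp add: U_def)
qed

text \<open>At finite points the frontier in the sphere can be tested with planar discs, since
  \<open>Some\<close> is continuous and maps open sets to open sets.\<close>

lemma frontier_Sigma1_subset_zero_accumulation:
  "(riemann_sphere frontier_of (Some ` Sigma1_set L \<phi> h \<mu>)) \<inter> Some ` inside L \<subseteq> zero_accumulation p"
proof (rule ccontr)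
  let ?S = "Sigma1_set L \<phi> h \<mu>"
  assume "\<not> ?thesis"
  then obtain z1 where z1: "z1 \<in> inside L" "Some z1 \<in> riemann_sphere frontier_of (Some ` ?S)"
    "Some z1 \<notin> zero_accumulation p" by auto
  then obtain X where X: "openin riemann_sphere X" "Some z1 \<in> X" "finite {n. \<exists>z. poly (p n) z = 0 \<and> Some z \<in> X}"
    by (auto simp: zero_accumulation_def)
  have "openin euclidean {z \<in> topspace euclidean. Some z \<in> X}"
    by (rule openin_continuous_map_preimage[OF continuous_map_Some X(1)])
  then have "open {z. Some z \<in> X}"
    by (simp only: topspace_euclidean UNIV_I simp_thms open_openin)
  then have Xo: "open ({z. Some z \<in> X} \<inter> inside L)" "z1 \<in> {z. Some z \<in> X} \<inter> inside L"
    using curve_topology(2) z1(1) X(2) by auto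
  obtain \<delta> where \<delta>: "\<delta> > 0" "ball z1 \<delta> \<subseteq> {z. Some z \<in> X} \<inter> inside L"
    by (rule openE[OF Xo])
  have "\<exists>N0. \<forall>n\<in>{n. \<exists>z. poly (p n) z = 0 \<and> Some z \<in> X}. n < N0"
    using X(3) unfolding finite_nat_set_iff_bounded .
  then obtain N0 where N0: "\<And>n z. poly (p n) z = 0 \<Longrightarrow> Some z \<in> X \<Longrightarrow> n < N0"
    by blast
  have opn: "openin riemann_sphere (Some ` ball z1 \<delta>)"
    unfolding openin_Alexandroff_compactification_image_Some open_openin[symmetric] by simp
  have "Some z1 \<in> riemann_sphere closure_of (Some ` ?S)"
    using z1(2) by (simp add: frontier_of_def)
  then obtain y where "y \<in> Some ` ?S" "y \<in> Some ` ball z1 \<delta>"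
    using opn \<delta>(1) unfolding in_closure_of by (metis centre_in_ball image_eqI)
  then obtain z0 where z0: "z0 \<in> ?S" "z0 \<in> ball z1 \<delta>" by auto
  have sub: "ball z1 \<delta> \<subseteq> ?S"
  proof (rule zero_free_disc_subset_Sigma1[OF _ \<delta>(1) _ z0(2,1)])
    show "ball z1 \<delta> \<subseteq> inside L" using \<delta>(2) by auto
    show "poly (p n) z \<noteq> 0" if "n \<ge> N0" "z \<in> ball z1 \<delta>" for n z
      using N0[of n z] that subsetD[OF \<delta>(2) that(2)] by auto
  qed
  have "Some ` ball z1 \<delta> \<subseteq> riemann_sphere interior_of (Some ` ?S)"
    by (rule interior_of_maximal[OF image_mono[OF sub] opn])
  then have "Some z1 \<in> riemann_sphere interior_of (Some ` ?S)"
    using \<delta>(1) by auto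
  then show False using z1(2) by (simp add: frontier_of_def)
qed

end

theorem theorem2:
  fixes L :: "complex set" and p :: "nat \<Rightarrow> complex poly"
    and \<psi> \<phi> h :: "complex \<Rightarrow> complex" and \<rho> \<mu> :: real
  assumes "analytic_jordan_curve L"
    and "bergman_orthonormal (inside L) p"
    and "exterior_map L \<psi>"
    and "is_rho \<psi> \<rho>"
    and "interior_map L \<psi> \<rho> \<phi>"
    and "is_mu \<psi> \<phi> \<rho> \<mu> h"
  shows "(riemann_sphere frontier_of (Some ` Sigma1_set L \<phi> h \<mu>)) \<inter> Some ` inside L
           \<subseteq> zero_accumulation p"
proof -
  interpret carleman_setting L p \<psi> \<phi> h \<rho> \<mu>
    using assms by unfold_locales
  show ?thesis
    by (rule frontier_Sigma1_subset_zero_accumulation)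
qed

end
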